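(* Let $h\ge 1$ and let $G$ be a finite graph that does not have the complete graph $K_{h+1}$ as a minor, such that every prime factor of $|\operatorname{Aut}(G)|$ is greater than $\max\{\alpha_h,2\}$. Then $\operatorname{Aut}(G)$ is obtained from abelian groups by repeatedly taking direct products and wreath products.
   Context: Fix a constant $a\ge 1$ such that for every $h\ge 1$ every finite graph with no $K_{h+1}$-minor has average degree at most $a\cdot h\cdot\sqrt{\log h}$ (such a constant exists by Kostochka's theorem), and set $\alpha_h:=\lceil a\cdot h\cdot\sqrt{\log h}\rceil$. A graph $H$ is a minor of $G$ if there is a partition of $V(G)$ into sets inducing connected subgraphs such that $H$ is isomorphic to a subgraph of the graph obtained by contracting each part (two parts adjacent iff some edge joins them). "Repeated direct and wreath products of abelian groups" refers to the smallest class of groups containing all abelian groups and closed under direct products and under (permutational) wreath products $\Delta\wr\Phi$ with $\Delta$ in the class and $\Phi$ an abelian permutation group. *)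

theory Defs
  imports
    "HOL-Algebra.Bij"
    "HOL-Algebra.Coset"
    "HOL-Computational_Algebra.Primes"
    "HOL-Library.Disjoint_Sets"
    "Graph_Theory.Graph_Theory"
begin

text \<open>
  A finite simple graph is a \<^locale>\<open>pair_graph\<close>: each undirected edge is represented by its
  two orientations.
\<close>

section \<open>Minors and average degree\<close>

definition complete_graph :: "nat \<Rightarrow> nat pair_pre_digraph" where
  "complete_graph n = \<lparr> pverts = {..<n}, parcs = {(u, v). u < n \<and> v < n \<and> u \<noteq> v} \<rparr>"

definition contraction :: "'a pair_pre_digraph \<Rightarrow> 'a set set \<Rightarrow> 'a set pair_pre_digraph" where
  "contraction G P = \<lparr> pverts = P,
     parcs = {(A, B). A \<in> P \<and> B \<in> P \<and> A \<noteq> B \<and> (\<exists>u\<in>A. \<exists>v\<in>B. (u, v) \<in> parcs G)} \<rparr>"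

definition is_minor :: "'b pair_pre_digraph \<Rightarrow> 'a pair_pre_digraph \<Rightarrow> bool" where
  "is_minor H G \<longleftrightarrow> (\<exists>P. partition_on (pverts G) P
     \<and> (\<forall>A\<in>P. Digraph_Component.connected (with_proj G \<restriction> A))
     \<and> (\<exists>S. subgraph S (with_proj (contraction G P)) \<and> digraph_iso (with_proj H) S))"

text \<open>Since both orientations of an edge are arcs, the out-degree is the undirected degree.
  The graph without vertices gets average degree 0.\<close>

definition average_degree :: "'a pair_pre_digraph \<Rightarrow> real" where
  "average_degree G =
     (\<Sum>v\<in>pverts G. real (out_degree (with_proj G) v)) / real (card (pverts G))"

text \<open>
  Vertices are taken from \<^typ>\<open>nat\<close>, which covers every finite graph up to isomorphism.
  The logarithm is the natural one. This loses no generality against any larger logarithm,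
  in particular the binary one: if \<open>a \<ge> 1\<close> is an admissible constant for \<open>log 2\<close>, then
  \<open>a / sqrt (ln 2) \<ge> 1\<close> is admissible for \<open>ln\<close> and yields the same numbers \<open>alpha\<close>.
\<close>

definition kostochka_constant :: "real \<Rightarrow> bool" where
  "kostochka_constant a \<longleftrightarrow> 1 \<le> a \<and>
     (\<forall>h\<ge>1. \<forall>G :: nat pair_pre_digraph. pair_graph G \<and> \<not> is_minor (complete_graph (h + 1)) G \<longrightarrow>
        average_degree G \<le> a * real h * sqrt (ln (real h)))"

definition alpha :: "real \<Rightarrow> nat \<Rightarrow> int" where
  "alpha a h = \<lceil>a * real h * sqrt (ln (real h))\<rceil>"


section \<open>Groups\<close>

definition aut_group :: "'a pair_pre_digraph \<Rightarrow> ('a \<Rightarrow> 'a) monoid" where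
  "aut_group G = (BijGroup (pverts G)) \<lparr> carrier := {\<pi> \<in> Bij (pverts G).
     \<forall>u\<in>pverts G. \<forall>v\<in>pverts G. (\<pi> u, \<pi> v) \<in> parcs G \<longleftrightarrow> (u, v) \<in> parcs G} \<rparr>"

definition perm_group :: "'w set \<Rightarrow> ('w \<Rightarrow> 'w) set \<Rightarrow> ('w \<Rightarrow> 'w) monoid" where
  "perm_group \<Omega> \<Phi> = (BijGroup \<Omega>) \<lparr> carrier := \<Phi> \<rparr>"

text \<open>The (unrestricted) permutational wreath product: the semidirect product of
  \<open>\<Delta>\<close>-valued functions on \<open>\<Omega>\<close> by \<open>\<Phi>\<close>, which permutes the coordinates.\<close>

definition wreath ::
    "('d, 'm) monoid_scheme \<Rightarrow> 'w set \<Rightarrow> ('w \<Rightarrow> 'w) set \<Rightarrow> (('w \<Rightarrow> 'd) \<times> ('w \<Rightarrow> 'w)) monoid" where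
  "wreath \<Delta> \<Omega> \<Phi> = \<lparr>
     carrier = (\<Omega> \<rightarrow>\<^sub>E carrier \<Delta>) \<times> \<Phi>,
     monoid.mult = (\<lambda>(f, \<pi>) (g, \<rho>).
       (\<lambda>\<omega>\<in>\<Omega>. f \<omega> \<otimes>\<^bsub>\<Delta>\<^esub> g (inv_into \<Omega> \<pi> \<omega>), \<pi> \<otimes>\<^bsub>BijGroup \<Omega>\<^esub> \<rho>)),
     one = (\<lambda>\<omega>\<in>\<Omega>. \<one>\<^bsub>\<Delta>\<^esub>, \<one>\<^bsub>BijGroup \<Omega>\<^esub>) \<rparr>"

text \<open>
  An inductive predicate ranges over groups on one carrier type only. With carriers in
  \<^typ>\<open>nat\<close>, and each rule closed under isomorphism, the class contains an isomorphic copy of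
  every finite group obtained from abelian groups: all factors of a finite direct
  product are finite, and in a finite wreath product either \<open>\<Delta>\<close>, \<open>\<Omega>\<close> and \<open>\<Phi>\<close> are finite, or
  \<open>\<Delta>\<close> is trivial or \<open>\<Omega>\<close> is empty, in which case the product is isomorphic to the abelian
  group \<open>\<Phi>\<close>.
\<close>

inductive abelian_wreath_class :: "nat monoid \<Rightarrow> bool" where
  abelian: "comm_group K \<Longrightarrow> abelian_wreath_class K"
| direct: "\<lbrakk>abelian_wreath_class \<Delta>\<^sub>1; abelian_wreath_class \<Delta>\<^sub>2; group K; \<Delta>\<^sub>1 \<times>\<times> \<Delta>\<^sub>2 \<cong> K\<rbrakk>
    \<Longrightarrow> abelian_wreath_class K"
| wreath: "\<lbrakk>abelian_wreath_class \<Delta>; subgroup \<Phi> (BijGroup (\<Omega> :: nat set));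
      comm_group (perm_group \<Omega> \<Phi>); group K; wreath \<Delta> \<Omega> \<Phi> \<cong> K\<rbrakk>
    \<Longrightarrow> abelian_wreath_class K"

definition built_from_abelian :: "('g, 'm) monoid_scheme \<Rightarrow> bool" where
  "built_from_abelian G \<longleftrightarrow> (\<exists>K. abelian_wreath_class K \<and> G \<cong> K)"


section \<open>Consistency checks\<close>

lemma complete_graph_complete: "K\<^bsub>n\<^esub> (with_proj (complete_graph n))"
  by (auto simp: complete_digraph_pair_def complete_graph_def)

lemma subgroup_aut_group: "subgroup (carrier (aut_group G)) (BijGroup (pverts G))"
proof -
  interpret group "BijGroup (pverts G)" by (rule group_BijGroup)
  let ?V = "pverts G"
  show ?thesis
  proof (rule subgroupI)
    show "carrier (aut_group G) \<subseteq> carrier (BijGroup ?V)"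
      by (auto simp: aut_group_def BijGroup_def)
    have "(\<lambda>x\<in>?V. x) \<in> carrier (aut_group G)"
      by (auto simp: aut_group_def id_Bij)
    then show "carrier (aut_group G) \<noteq> {}" by blast
  next
    fix \<pi> assume p: "\<pi> \<in> carrier (aut_group G)"
    then have B: "\<pi> \<in> Bij ?V" by (simp add: aut_group_def)
    then have s: "\<pi> (inv_into ?V \<pi> u) = u" "inv_into ?V \<pi> u \<in> ?V" if "u \<in> ?V" for u
      using that by (auto simp: Bij_def bij_betw_def f_inv_into_f inv_into_into)
    have "(inv_into ?V \<pi> u, inv_into ?V \<pi> v) \<in> parcs G \<longleftrightarrow> (u, v) \<in> parcs G"
      if "u \<in> ?V" "v \<in> ?V" for u v
    proof -
      have "(\<pi> (inv_into ?V \<pi> u), \<pi> (inv_into ?V \<pi> v)) \<in> parcs G \<longleftrightarrow>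
          (inv_into ?V \<pi> u, inv_into ?V \<pi> v) \<in> parcs G"
        using p s(2)[OF that(1)] s(2)[OF that(2)] unfolding aut_group_def by simp
      then show ?thesis using s(1) that by simp
    qed
    then show "inv\<^bsub>BijGroup ?V\<^esub> \<pi> \<in> carrier (aut_group G)"
      by (simp add: inv_BijGroup[OF B] aut_group_def restrict_inv_into_Bij[OF B])
  next
    fix \<pi> \<rho> assume "\<pi> \<in> carrier (aut_group G)" "\<rho> \<in> carrier (aut_group G)"
    then show "\<pi> \<otimes>\<^bsub>BijGroup ?V\<^esub> \<rho> \<in> carrier (aut_group G)"
      using Bij_imp_funcset[of \<rho> ?V] compose_Bij[of \<pi> ?V \<rho>]
      by (auto simp: aut_group_def BijGroup_def Pi_iff compose_eq)
  qed
qed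

lemma group_aut_group: "group (aut_group G)"
proof -
  have "aut_group G = (BijGroup (pverts G)) \<lparr> carrier := carrier (aut_group G) \<rparr>"
    by (simp add: aut_group_def)
  then show ?thesis
    using subgroup.subgroup_is_group[OF subgroup_aut_group group_BijGroup] by metis
qed

lemma group_wreath:
  assumes "group \<Delta>" and "subgroup \<Phi> (BijGroup \<Omega>)"
  shows "group (wreath \<Delta> \<Omega> \<Phi>)"
proof -
  interpret D: group \<Delta> by fact
  interpret B: group "BijGroup \<Omega>" by (rule group_BijGroup)
  interpret P: subgroup \<Phi> "BijGroup \<Omega>" by fact
  have val: "f \<omega> \<in> carrier \<Delta>" if "f \<in> \<Omega> \<rightarrow>\<^sub>E carrier \<Delta>" "\<omega> \<in> \<Omega>" for f \<omega>
    using that by (rule PiE_mem)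
  have bij: "\<pi> \<in> Bij \<Omega>" if "\<pi> \<in> \<Phi>" for \<pi>
    using P.mem_carrier[OF that] by (simp add: BijGroup_def)
  have inv_mem: "inv_into \<Omega> \<pi> \<omega> \<in> \<Omega>" if "\<pi> \<in> \<Phi>" "\<omega> \<in> \<Omega>" for \<pi> \<omega>
    using Bij_inv_into_mem[OF bij] that by blast
  have app_mem: "\<pi> \<omega> \<in> \<Omega>" if "\<pi> \<in> \<Phi>" "\<omega> \<in> \<Omega>" for \<pi> \<omega>
    using Bij_imp_funcset[OF bij] that by blast
  have inv_app: "inv_into \<Omega> \<pi> (\<pi> \<omega>) = \<omega>" if "\<pi> \<in> \<Phi>" "\<omega> \<in> \<Omega>" for \<pi> \<omega>
    using bij[OF that(1)] that(2) by (auto simp: Bij_def bij_betw_def)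
  have app_inv: "\<pi> (inv_into \<Omega> \<pi> \<omega>) = \<omega>" if "\<pi> \<in> \<Phi>" "\<omega> \<in> \<Omega>" for \<pi> \<omega>
    using bij[OF that(1)] that(2) by (auto simp: Bij_def bij_betw_def f_inv_into_f)
  have mult: "(\<pi> \<otimes>\<^bsub>BijGroup \<Omega>\<^esub> \<rho>) \<omega> = \<pi> (\<rho> \<omega>)" if "\<pi> \<in> \<Phi>" "\<rho> \<in> \<Phi>" "\<omega> \<in> \<Omega>" for \<pi> \<rho> \<omega>
    using that bij by (simp add: BijGroup_def compose_def)
  have inv_mult: "inv_into \<Omega> (\<pi> \<otimes>\<^bsub>BijGroup \<Omega>\<^esub> \<rho>) \<omega> = inv_into \<Omega> \<rho> (inv_into \<Omega> \<pi> \<omega>)"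
    if "\<pi> \<in> \<Phi>" "\<rho> \<in> \<Phi>" "\<omega> \<in> \<Omega>" for \<pi> \<rho> \<omega>
  proof -
    have "(\<pi> \<otimes>\<^bsub>BijGroup \<Omega>\<^esub> \<rho>) (inv_into \<Omega> \<rho> (inv_into \<Omega> \<pi> \<omega>)) = \<omega>"
      using that by (simp add: mult inv_mem app_inv)
    then show ?thesis
      using inv_app[OF P.m_closed[OF that(1,2)], of "inv_into \<Omega> \<rho> (inv_into \<Omega> \<pi> \<omega>)"] that
      by (simp add: inv_mem)
  qed
  have inv_one: "inv_into \<Omega> (\<one>\<^bsub>BijGroup \<Omega>\<^esub>) \<omega> = \<omega>" if "\<omega> \<in> \<Omega>" for \<omega>
    using inv_app[OF P.one_closed that] that by (simp add: BijGroup_def)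
  show ?thesis
  proof (rule groupI)
    fix x y assume "x \<in> carrier (wreath \<Delta> \<Omega> \<Phi>)" "y \<in> carrier (wreath \<Delta> \<Omega> \<Phi>)"
    then show "x \<otimes>\<^bsub>wreath \<Delta> \<Omega> \<Phi>\<^esub> y \<in> carrier (wreath \<Delta> \<Omega> \<Phi>)"
      by (auto simp: wreath_def inv_mem val)
  next
    show "\<one>\<^bsub>wreath \<Delta> \<Omega> \<Phi>\<^esub> \<in> carrier (wreath \<Delta> \<Omega> \<Phi>)"
      by (auto simp: wreath_def)
  next
    fix x y z
    assume "x \<in> carrier (wreath \<Delta> \<Omega> \<Phi>)" "y \<in> carrier (wreath \<Delta> \<Omega> \<Phi>)" "z \<in> carrier (wreath \<Delta> \<Omega> \<Phi>)"
    then show "x \<otimes>\<^bsub>wreath \<Delta> \<Omega> \<Phi>\<^esub> y \<otimes>\<^bsub>wreath \<Delta> \<Omega> \<Phi>\<^esub> z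
        = x \<otimes>\<^bsub>wreath \<Delta> \<Omega> \<Phi>\<^esub> (y \<otimes>\<^bsub>wreath \<Delta> \<Omega> \<Phi>\<^esub> z)"
      by (auto simp: wreath_def inv_mem val inv_mult D.m_assoc B.m_assoc P.mem_carrier
          intro!: restrict_ext)
  next
    fix x assume "x \<in> carrier (wreath \<Delta> \<Omega> \<Phi>)"
    then obtain f \<pi> where x: "x = (f, \<pi>)" and f: "f \<in> \<Omega> \<rightarrow>\<^sub>E carrier \<Delta>" and p: "\<pi> \<in> \<Phi>"
      by (auto simp: wreath_def)
    have "(\<lambda>\<omega>\<in>\<Omega>. (\<lambda>\<omega>\<in>\<Omega>. \<one>\<^bsub>\<Delta>\<^esub>) \<omega> \<otimes>\<^bsub>\<Delta>\<^esub> f (inv_into \<Omega> (\<one>\<^bsub>BijGroup \<Omega>\<^esub>) \<omega>)) = restrict f \<Omega>"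
      using f by (intro restrict_ext) (simp add: inv_one val)
    also have "\<dots> = f" using f by (rule PiE_restrict)
    finally show "\<one>\<^bsub>wreath \<Delta> \<Omega> \<Phi>\<^esub> \<otimes>\<^bsub>wreath \<Delta> \<Omega> \<Phi>\<^esub> x = x"
      using p by (simp add: wreath_def x)
  next
    fix x assume "x \<in> carrier (wreath \<Delta> \<Omega> \<Phi>)"
    then obtain f \<pi> where x: "x = (f, \<pi>)" and f: "f \<in> \<Omega> \<rightarrow>\<^sub>E carrier \<Delta>" and p: "\<pi> \<in> \<Phi>"
      by (auto simp: wreath_def)
    let ?q = "inv\<^bsub>BijGroup \<Omega>\<^esub> \<pi>"
    let ?y = "(\<lambda>\<omega>\<in>\<Omega>. inv\<^bsub>\<Delta>\<^esub> (f (\<pi> \<omega>)), ?q)"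
    have q: "?q \<in> \<Phi>" using p by (rule P.m_inv_closed)
    have iq: "inv_into \<Omega> ?q \<omega> = \<pi> \<omega>" if w: "\<omega> \<in> \<Omega>" for \<omega>
    proof -
      have "?q (\<pi> \<omega>) = \<omega>"
        using w p by (simp add: inv_BijGroup[OF bij[OF p]] app_mem inv_app)
      then show ?thesis using inv_app[OF q app_mem[OF p w]] by simp
    qed
    have "?y \<in> carrier (wreath \<Delta> \<Omega> \<Phi>)"
      using q f p by (auto simp: wreath_def app_mem val)
    moreover have "?y \<otimes>\<^bsub>wreath \<Delta> \<Omega> \<Phi>\<^esub> x = \<one>\<^bsub>wreath \<Delta> \<Omega> \<Phi>\<^esub>"
      using f p unfolding x
      by (auto simp: wreath_def iq app_mem val P.mem_carrier intro!: restrict_ext)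
    ultimately show "\<exists>y\<in>carrier (wreath \<Delta> \<Omega> \<Phi>). y \<otimes>\<^bsub>wreath \<Delta> \<Omega> \<Phi>\<^esub> x = \<one>\<^bsub>wreath \<Delta> \<Omega> \<Phi>\<^esub>"
      by blast
  qed
qed

end

theory Submission
  imports Defs
begin

text \<open>
  All divisors \<open>d > 1\<close> of the group order exceed the average degree of every minor and also \<open>h\<close>. Hence,
  whenever the group acts on a minor, the stabiliser of a vertex fixes every neighbour whose orbit is
  not larger. For a connected graph this yields an equivariant contraction onto a smallest orbit \<open>B\<close>,
  on which the group acts as a regular group. That group is abelian: contracting the cosets of cyclic
  subgroups generated by edges shows that these subgroups are normal, and a nontrivial commutator
  would produce a complete minor on more than \<open>h\<close> vertices.

  Let \<open>N\<close> be the stabiliser of a point of \<open>B\<close> and \<open>W\<close> its set of fixed points. As the group order is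
  odd, \<open>N\<close> fixes every component of \<open>G - W\<close>, and a component fixed by a further element would produce a
  dense complete bipartite minor. So the components are permuted semiregularly modulo \<open>N\<close>, and the
  group is the wreath product of its restriction to orbit representatives of the components by the
  abelian group induced on \<open>B\<close>. If the graph is disconnected, no two components are isomorphic and the
  group is a direct product.
\<close>

section \<open>Minors\<close>

text \<open>Orbit lengths divide the group order, so an orbit is a single point or has more than
  \<open>r\<close> points; degree bounds in minors act only through this dichotomy. Counting arcs
  between two orbits bounds the degree at the larger orbit only, and this asymmetry is why
  everything is contracted towards a smallest orbit. The three thresholds on divisors have separate
  jobs: \<open>r\<close> for average degrees, \<open>h\<close> for the complete minor that excludes
  commutators, 2 for an involution swapping two components.

  For the wreath product no complement of \<open>N\<close> is given in advance. A transversal of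
  \<open>N\<close> yields the standard embedding of an extension into a wreath product. It is onto
  because components of \<open>G - W\<close> are attached only to \<open>W\<close>, which
  \<open>N\<close> fixes pointwise, so choices made on different translates do not interfere.

  The induction cannot run over full automorphism groups: the graph induced on the representatives
  forgets their attachment to \<open>W\<close> and may have symmetries that do not extend.\<close>

definition conn :: "('a \<times> 'a) set \<Rightarrow> 'a set \<Rightarrow> bool" where
  "conn E A \<longleftrightarrow> (\<forall>x\<in>A. \<forall>y\<in>A. (x, y) \<in> (E \<inter> A \<times> A)\<^sup>*)"

text \<open>The form in which connectedness is mostly used: \<open>S\<close> becomes a fixed-point
  set, a centraliser condition, an orbit or a component, which replaces inductions over
  walks.\<close>

lemma conn_closed:
  assumes "conn E A" "x \<in> A" "y \<in> A" "x \<in> S"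
    and "\<And>u v. (u, v) \<in> E \<Longrightarrow> u \<in> A \<Longrightarrow> v \<in> A \<Longrightarrow> u \<in> S \<Longrightarrow> v \<in> S"
  shows "y \<in> S"
proof -
  have "(x, y) \<in> (E \<inter> A \<times> A)\<^sup>*" using assms by (auto simp: conn_def)
  then show ?thesis
  proof (induction rule: rtrancl_induct)
    case (step u v) then show ?case using assms(5)[of u v] by blast
  qed (rule assms(4))
qed

lemma conn_empty: "conn E {}" and conn_singleton: "conn E {x}"
  by (auto simp: conn_def)

lemma conn_mono: "conn E A \<Longrightarrow> E \<inter> A \<times> A \<subseteq> F \<Longrightarrow> conn F A"
  unfolding conn_def using rtrancl_mono[of "E \<inter> A \<times> A" "F \<inter> A \<times> A"] by blast

text \<open>A walk in the index graph \<open>F\<close> is lifted one edge at a time, and the gap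
  between consecutive crossing edges is bridged inside a single \<open>A j\<close>. This is what
  makes minors compose.\<close>

lemma conn_UN:
  assumes "conn F S" and "\<And>j. j \<in> S \<Longrightarrow> conn E (A j)"
    and "\<And>i j. (i, j) \<in> F \<Longrightarrow> i \<in> S \<Longrightarrow> j \<in> S \<Longrightarrow> \<exists>u\<in>A i. \<exists>v\<in>A j. (u, v) \<in> E"
  shows "conn E (\<Union>j\<in>S. A j)"
  unfolding conn_def
proof (intro ballI)
  let ?U = "\<Union>j\<in>S. A j"
  have inside: "(x, y) \<in> (E \<inter> ?U \<times> ?U)\<^sup>*" if "j \<in> S" "x \<in> A j" "y \<in> A j" for j x y
  proof -
    have "(x, y) \<in> (E \<inter> A j \<times> A j)\<^sup>*" using assms(2) that by (auto simp: conn_def)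
    moreover have "E \<inter> A j \<times> A j \<subseteq> E \<inter> ?U \<times> ?U" using that by auto
    ultimately show ?thesis using rtrancl_mono by blast
  qed
  fix x y assume "x \<in> ?U" "y \<in> ?U"
  then obtain i j where ij: "i \<in> S" "x \<in> A i" "j \<in> S" "y \<in> A j" by auto
  have "(i, j) \<in> (F \<inter> S \<times> S)\<^sup>*" using assms(1) ij by (auto simp: conn_def)
  then have "\<forall>y\<in>A j. (x, y) \<in> (E \<inter> ?U \<times> ?U)\<^sup>*"
  proof (induction rule: rtrancl_induct)
    case base then show ?case using inside ij by blast
  next
    case (step k l)
    then obtain u v where uv: "u \<in> A k" "v \<in> A l" "(u, v) \<in> E" using assms(3) by blast
    have kl: "k \<in> S" "l \<in> S" using step.hyps by auto
    have "(x, u) \<in> (E \<inter> ?U \<times> ?U)\<^sup>*" using step uv by blast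
    moreover have "(u, v) \<in> E \<inter> ?U \<times> ?U" using uv kl by auto
    ultimately have "(x, v) \<in> (E \<inter> ?U \<times> ?U)\<^sup>*" by (rule rtrancl_into_rtrancl)
    then show ?case using inside[OF kl(2) uv(2)] by (blast intro: rtrancl_trans)
  qed
  then show "(x, y) \<in> (E \<inter> ?U \<times> ?U)\<^sup>*" using ij by blast
qed

lemma conn_star:
  assumes "sym F" "d \<in> S" "\<And>j. j \<in> S \<Longrightarrow> j = d \<or> (d, j) \<in> F"
  shows "conn F S"
  unfolding conn_def
proof (intro ballI)
  fix x y assume xy: "x \<in> S" "y \<in> S"
  have "(x, d) \<in> (F \<inter> S \<times> S)\<^sup>*"
  proof (cases "x = d")
    case False
    then have "(x, d) \<in> F \<inter> S \<times> S" using assms(1,2) assms(3)[OF xy(1)] xy by (auto dest: symD)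
    then show ?thesis by blast
  qed simp
  moreover have "(d, y) \<in> (F \<inter> S \<times> S)\<^sup>*"
  proof (cases "y = d")
    case False
    then have "(d, y) \<in> F \<inter> S \<times> S" using assms(1,2) assms(3)[OF xy(2)] xy by auto
    then show ?thesis by blast
  qed simp
  ultimately show "(x, y) \<in> (F \<inter> S \<times> S)\<^sup>*" by (rule rtrancl_trans)
qed

lemma conn_Un:
  assumes "sym E" "conn E A" "conn E B" "a \<in> A" "b \<in> B" "(a, b) \<in> E"
  shows "conn E (A \<union> B)"
proof -
  have "conn E (\<Union>j\<in>{A, B}. j)"
  proof (rule conn_UN[where F = "{(A, B), (B, A)}"])
    show "conn {(A, B), (B, A)} {A, B}"
      by (rule conn_star[where d = A]) (auto simp: sym_def)
    have "(b, a) \<in> E" using assms(1,6) by (rule symD)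
    then show "\<exists>u\<in>i. \<exists>v\<in>j. (u, v) \<in> E" if "(i, j) \<in> {(A, B), (B, A)}" for i j
      using that assms(4-6) by blast
  qed (use assms in auto)
  then show ?thesis by simp
qed

lemma conn_path:
  assumes "sym E" "\<And>i. Suc i < n \<Longrightarrow> (p i, p (Suc i)) \<in> E"
  shows "conn E (p ` {..<n})"
  using assms(2)
proof (induction n)
  case (Suc n)
  show ?case
  proof (cases n)
    case 0 then show ?thesis by (simp add: lessThan_Suc conn_singleton)
  next
    case (Suc m)
    have "conn E (p ` {..<n} \<union> {p n})"
      using Suc Suc.prems Suc.IH
      by (intro conn_Un[where a = "p m" and b = "p n"]) (auto simp: assms(1) conn_singleton)
    then show ?thesis by (simp add: lessThan_Suc Un_commute)
  qed
qed (simp add: conn_empty)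

lemma conn_image:
  assumes "conn E A" "\<And>u v. (u, v) \<in> E \<Longrightarrow> u \<in> A \<Longrightarrow> v \<in> A \<Longrightarrow> g u = g v \<or> (g u, g v) \<in> F"
  shows "conn F (g ` A)"
proof -
  have "(g x, g y) \<in> (F \<inter> g ` A \<times> g ` A)\<^sup>*" if "x \<in> A" "y \<in> A" for x y
  proof -
    have "y \<in> {y. (g x, g y) \<in> (F \<inter> g ` A \<times> g ` A)\<^sup>*}"
    proof (rule conn_closed[OF assms(1) that])
      fix u v assume uv: "(u, v) \<in> E" "u \<in> A" "v \<in> A" "u \<in> {y. (g x, g y) \<in> (F \<inter> g ` A \<times> g ` A)\<^sup>*}"
      show "v \<in> {y. (g x, g y) \<in> (F \<inter> g ` A \<times> g ` A)\<^sup>*}"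
      proof (cases "g u = g v")
        case False
        then have e: "(g u, g v) \<in> F \<inter> g ` A \<times> g ` A" using assms(2) uv by auto
        have "(g x, g u) \<in> (F \<inter> g ` A \<times> g ` A)\<^sup>*" using uv(4) by simp
        then have "(g x, g v) \<in> (F \<inter> g ` A \<times> g ` A)\<^sup>*" using e by (rule rtrancl_into_rtrancl)
        then show ?thesis by simp
      qed (use uv in simp)
    qed simp
    then show ?thesis by simp
  qed
  then show ?thesis by (auto simp: conn_def)
qed

text \<open>Branch sets may miss vertices, and \<open>F\<close> lists only the adjacencies that are
  demanded, so a model is not completed to a partition at every step. Agreement with
  \<open>is_minor\<close> on complete graphs is \<open>minor_of_if_is_minor\<close> and
  \<open>is_minor_if_minor_of\<close>.\<close>

definition minor_of :: "'b set \<Rightarrow> ('b \<times> 'b) set \<Rightarrow> 'a set \<Rightarrow> ('a \<times> 'a) set \<Rightarrow> bool" where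
  "minor_of J F V E \<longleftrightarrow> F \<subseteq> J \<times> J \<and> (\<exists>A. (\<forall>j\<in>J. A j \<subseteq> V \<and> A j \<noteq> {} \<and> conn E (A j))
     \<and> disjoint_family_on A J \<and> (\<forall>(i, j)\<in>F. \<exists>u\<in>A i. \<exists>v\<in>A j. (u, v) \<in> E))"

lemma minor_ofI:
  assumes "F \<subseteq> J \<times> J" "\<And>j. j \<in> J \<Longrightarrow> A j \<subseteq> V" "\<And>j. j \<in> J \<Longrightarrow> A j \<noteq> {}" "\<And>j. j \<in> J \<Longrightarrow> conn E (A j)"
    and "\<And>i j x. i \<in> J \<Longrightarrow> j \<in> J \<Longrightarrow> x \<in> A i \<Longrightarrow> x \<in> A j \<Longrightarrow> i = j"
    and "\<And>i j. (i, j) \<in> F \<Longrightarrow> \<exists>u\<in>A i. \<exists>v\<in>A j. (u, v) \<in> E"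
  shows "minor_of J F V E"
proof -
  have "disjoint_family_on A J" using assms(5) by (auto simp: disjoint_family_on_def)
  moreover have "\<forall>(i, j)\<in>F. \<exists>u\<in>A i. \<exists>v\<in>A j. (u, v) \<in> E" using assms(6) by (auto split: prod.split)
  ultimately show ?thesis using assms(1-4) unfolding minor_of_def by (intro conjI exI[of _ A]) simp_all
qed

lemma minor_ofD:
  assumes "minor_of J F V E"
  shows "\<exists>A. (\<forall>j\<in>J. A j \<subseteq> V) \<and> (\<forall>j\<in>J. A j \<noteq> {}) \<and> (\<forall>j\<in>J. conn E (A j))
    \<and> (\<forall>i\<in>J. \<forall>j\<in>J. \<forall>x. x \<in> A i \<longrightarrow> x \<in> A j \<longrightarrow> i = j)
    \<and> (\<forall>i j. (i, j) \<in> F \<longrightarrow> (\<exists>u\<in>A i. \<exists>v\<in>A j. (u, v) \<in> E))"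
proof -
  from assms obtain A where A: "\<forall>j\<in>J. A j \<subseteq> V \<and> A j \<noteq> {} \<and> conn E (A j)" "disjoint_family_on A J"
      "\<forall>(i, j)\<in>F. \<exists>u\<in>A i. \<exists>v\<in>A j. (u, v) \<in> E"
    unfolding minor_of_def by (elim conjE exE)
  have "i = j" if "i \<in> J" "j \<in> J" "x \<in> A i" "x \<in> A j" for i j x
    using A(2) that unfolding disjoint_family_on_def by blast
  moreover have "\<exists>u\<in>A i. \<exists>v\<in>A j. (u, v) \<in> E" if "(i, j) \<in> F" for i j
    using bspec[OF A(3) that] by simp
  ultimately show ?thesis using A(1) by (intro exI[of _ A]) simp
qed

lemma minor_of_subgraph: "J \<subseteq> V \<Longrightarrow> F \<subseteq> E \<Longrightarrow> F \<subseteq> J \<times> J \<Longrightarrow> minor_of J F V E"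
  by (rule minor_ofI[where A = "\<lambda>j. {j}"]) (auto simp: conn_singleton)

lemma minor_of_trans:
  assumes "minor_of I D J F" "minor_of J F V E"
  shows "minor_of I D V E"
proof -
  obtain A where A: "\<forall>i\<in>I. A i \<subseteq> J" "\<forall>i\<in>I. A i \<noteq> {}" "\<forall>i\<in>I. conn F (A i)"
      "\<forall>i\<in>I. \<forall>j\<in>I. \<forall>x. x \<in> A i \<longrightarrow> x \<in> A j \<longrightarrow> i = j"
      "\<forall>i j. (i, j) \<in> D \<longrightarrow> (\<exists>u\<in>A i. \<exists>v\<in>A j. (u, v) \<in> F)"
    using minor_ofD[OF assms(1)] by (elim conjE exE)
  obtain B where B: "\<forall>j\<in>J. B j \<subseteq> V" "\<forall>j\<in>J. B j \<noteq> {}" "\<forall>j\<in>J. conn E (B j)"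
      "\<forall>i\<in>J. \<forall>j\<in>J. \<forall>x. x \<in> B i \<longrightarrow> x \<in> B j \<longrightarrow> i = j"
      "\<forall>i j. (i, j) \<in> F \<longrightarrow> (\<exists>u\<in>B i. \<exists>v\<in>B j. (u, v) \<in> E)"
    using minor_ofD[OF assms(2)] by (elim conjE exE)
  show ?thesis
  proof (rule minor_ofI[where A = "\<lambda>i. \<Union>j\<in>A i. B j"])
    show "D \<subseteq> I \<times> I" using assms(1) by (simp add: minor_of_def)
    fix i assume i: "i \<in> I"
    then have sub: "A i \<subseteq> J" using A(1) by blast
    show "conn E (\<Union>j\<in>A i. B j)"
    proof (rule conn_UN)
      show "conn F (A i)" using A(3) i by blast
      show "conn E (B j)" if "j \<in> A i" for j using B(3) that sub by blast
      show "\<exists>u\<in>B j. \<exists>v\<in>B k. (u, v) \<in> E" if "(j, k) \<in> F" for j k using B(5) that by blast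
    qed
    show "(\<Union>j\<in>A i. B j) \<subseteq> V" using sub B(1) by blast
    obtain j where "j \<in> A i" using A(2) i by blast
    then show "(\<Union>j\<in>A i. B j) \<noteq> {}" using sub B(2) by blast
  next
    fix i j x assume ij: "i \<in> I" "j \<in> I" and "x \<in> (\<Union>j\<in>A i. B j)" "x \<in> (\<Union>k\<in>A j. B k)"
    then obtain k l where kl: "k \<in> A i" "x \<in> B k" "l \<in> A j" "x \<in> B l" by blast
    then have "k \<in> J" "l \<in> J" using A(1) ij by blast+
    then have "k = l" using B(4) kl by blast
    then show "i = j" using A(4) ij kl by blast
  next
    fix i j assume "(i, j) \<in> D"
    then obtain u v where "u \<in> A i" "v \<in> A j" "(u, v) \<in> F" using A(5) by blast
    moreover then obtain x y where "x \<in> B u" "y \<in> B v" "(x, y) \<in> E" using B(5) by blast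
    ultimately show "\<exists>u\<in>\<Union>j\<in>A i. B j. \<exists>v\<in>\<Union>k\<in>A j. B k. (u, v) \<in> E" by blast
  qed
qed

section \<open>Contracting the fibres of a vertex map\<close>

definition quot :: "('a \<Rightarrow> 'b) \<Rightarrow> ('a \<times> 'a) set \<Rightarrow> ('b \<times> 'b) set" where
  "quot \<psi> E = {(\<psi> u, \<psi> v) |u v. (u, v) \<in> E \<and> \<psi> u \<noteq> \<psi> v}"

lemma quotI: "(u, v) \<in> E \<Longrightarrow> \<psi> u \<noteq> \<psi> v \<Longrightarrow> (\<psi> u, \<psi> v) \<in> quot \<psi> E"
  unfolding quot_def by blast

lemma minor_of_quot:
  assumes "E \<subseteq> V \<times> V" "\<And>c. conn E {v \<in> V. \<psi> v = c}"
  shows "minor_of (\<psi> ` V) (quot \<psi> E) V E"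
proof (rule minor_ofI[where A = "\<lambda>c. {v \<in> V. \<psi> v = c}"])
  fix i j assume "(i, j) \<in> quot \<psi> E"
  then obtain u v where "(u, v) \<in> E" "\<psi> u = i" "\<psi> v = j" by (auto simp: quot_def)
  then show "\<exists>u\<in>{v \<in> V. \<psi> v = i}. \<exists>v\<in>{v \<in> V. \<psi> v = j}. (u, v) \<in> E" using assms(1) by auto
qed (use assms in \<open>auto simp: quot_def\<close>)

lemma conn_quot: "conn E V \<Longrightarrow> conn (quot \<psi> E) (\<psi> ` V)"
  unfolding quot_def by (rule conn_image, assumption) blast

lemma sym_quot: "sym E \<Longrightarrow> sym (quot \<psi> E)"
proof (rule symI)
  fix a b assume "sym E" "(a, b) \<in> quot \<psi> E"
  then obtain u v where "(v, u) \<in> E" "\<psi> u = a" "\<psi> v = b" "a \<noteq> b" by (auto simp: quot_def dest: symD)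
  then show "(b, a) \<in> quot \<psi> E" unfolding quot_def
    by (intro CollectI exI[of _ v] exI[of _ u]) simp
qed

lemma irrefl_quot: "irrefl (quot \<psi> E)"
  by (auto simp: quot_def irrefl_def)

text \<open>For symmetric \<open>F\<close> both orientations of an edge are counted, so
  \<open>card F\<close> is the degree sum and \<open>r\<close> bounds the average degree of every
  minor. Quantifying over minors makes the property hereditary. Index sets lie in \<open>nat\<close>
  because \<open>kostochka_constant\<close> speaks of graphs on \<open>nat\<close>;
  \<open>sparseD\<close> lifts this to any type.\<close>

definition sparse :: "real \<Rightarrow> nat \<Rightarrow> 'a set \<Rightarrow> ('a \<times> 'a) set \<Rightarrow> bool" where
  "sparse r h V E \<longleftrightarrow> (\<forall>(J :: nat set) F. finite J \<longrightarrow> sym F \<longrightarrow> irrefl F \<longrightarrow> minor_of J F V E \<longrightarrow>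
     real (card F) \<le> r * real (card J) \<and> \<not> (card J = Suc h \<and> F = {(i, j). i \<in> J \<and> j \<in> J \<and> i \<noteq> j}))"

lemma minor_of_bij:
  assumes "inj_on f J" "F \<subseteq> J \<times> J"
  shows "minor_of (f ` J) (map_prod f f ` F) J F"
proof (rule minor_ofI[where A = "\<lambda>n. {the_inv_into J f n}"])
  fix i j assume "(i, j) \<in> map_prod f f ` F"
  then show "\<exists>u\<in>{the_inv_into J f i}. \<exists>v\<in>{the_inv_into J f j}. (u, v) \<in> F"
    using assms by (auto simp: the_inv_into_f_f)
qed (use assms in \<open>auto simp: the_inv_into_f_f conn_singleton\<close>)

lemma sparse_minor:
  assumes "sparse r h V E" "minor_of J F V E"
  shows "sparse r h J F"
  unfolding sparse_def
proof (intro allI impI)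
  fix I :: "nat set" and D
  assume "finite I" "sym D" "irrefl D" "minor_of I D J F"
  then show "real (card D) \<le> r * real (card I)
      \<and> \<not> (card I = Suc h \<and> D = {(i, j). i \<in> I \<and> j \<in> I \<and> i \<noteq> j})"
    using assms(1)[unfolded sparse_def, rule_format, of I D] minor_of_trans[OF _ assms(2), of I D] by simp
qed

lemma sparseD:
  assumes "sparse r h V E" "minor_of J F V E" "finite J" "sym F" "irrefl F"
  shows "real (card F) \<le> r * real (card J)"
    and "\<not> (card J = Suc h \<and> F = {(i, j). i \<in> J \<and> j \<in> J \<and> i \<noteq> j})"
proof -
  obtain f :: "'b \<Rightarrow> nat" where f: "inj_on f J"
    using finite_imp_inj_to_nat_seg[OF assms(3)] by auto
  have F: "F \<subseteq> J \<times> J" using assms(2) by (simp add: minor_of_def)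
  have inj: "inj_on (map_prod f f) F"
    by (rule inj_on_subset[OF map_prod_inj_on[OF f f] F])
  have m: "minor_of (f ` J) (map_prod f f ` F) V E"
    using minor_of_trans[OF minor_of_bij[OF f F] assms(2)] .
  have s: "sym (map_prod f f ` F)" using assms(4) by (auto simp: sym_def)
  have i: "irrefl (map_prod f f ` F)"
    unfolding irrefl_def
  proof (intro allI notI)
    fix x assume "(x, x) \<in> map_prod f f ` F"
    then obtain i j where "(i, j) \<in> F" "f i = f j" by auto
    moreover then have "i \<in> J" "j \<in> J" using F by auto
    ultimately show False using inj_onD[OF f] assms(5) by (auto simp: irrefl_def)
  qed
  note S = assms(1)[unfolded sparse_def, rule_format, OF _ s i m]
  show "real (card F) \<le> r * real (card J)"
    using S assms(3) by (simp add: card_image[OF inj] card_image[OF f])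
  show "\<not> (card J = Suc h \<and> F = {(i, j). i \<in> J \<and> j \<in> J \<and> i \<noteq> j})"
  proof
    assume a: "card J = Suc h \<and> F = {(i, j). i \<in> J \<and> j \<in> J \<and> i \<noteq> j}"
    then have "map_prod f f ` F = {(i, j). i \<in> f ` J \<and> j \<in> f ` J \<and> i \<noteq> j}"
      using f by (force simp: inj_on_def image_iff)
    then show False using S assms(3) a by (auto simp: card_image[OF f])
  qed
qed

section \<open>Group actions on sparse graphs\<close>

text \<open>HOL-Algebra reserves the syntax \<open>inv\<close> for group inverses.\<close>

abbreviation pinv :: "('a \<Rightarrow> 'b) \<Rightarrow> 'b \<Rightarrow> 'a" where
  "pinv \<equiv> inv_into UNIV"

text \<open>Elements are bijections of the whole type under plain composition, unlike the restricted
  functions of \<open>BijGroup\<close>, so calculations with products and inverses carry no domain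
  conditions.\<close>

locale perm_grp =
  fixes \<Gamma> :: "('a \<Rightarrow> 'a) set"
  assumes fin: "finite \<Gamma>"
    and bij: "g \<in> \<Gamma> \<Longrightarrow> bij g"
    and id_mem: "id \<in> \<Gamma>"
    and comp_mem: "g \<in> \<Gamma> \<Longrightarrow> k \<in> \<Gamma> \<Longrightarrow> g \<circ> k \<in> \<Gamma>"
    and inv_mem: "g \<in> \<Gamma> \<Longrightarrow> pinv g \<in> \<Gamma>"

definition stab :: "('a \<Rightarrow> 'a) set \<Rightarrow> 'a \<Rightarrow> ('a \<Rightarrow> 'a) set" where
  "stab \<Gamma> x = {g \<in> \<Gamma>. g x = x}"

definition orb :: "('a \<Rightarrow> 'a) set \<Rightarrow> 'a \<Rightarrow> 'a set" where
  "orb \<Gamma> x = (\<lambda>g. g x) ` \<Gamma>"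

context perm_grp
begin

lemma inv_app [simp]: "g \<in> \<Gamma> \<Longrightarrow> pinv g (g x) = x"
  by (simp add: bij bij_is_inj)

lemma app_inv [simp]: "g \<in> \<Gamma> \<Longrightarrow> g (pinv g x) = x"
  by (simp add: bij bij_is_surj surj_f_inv_f)

lemma app_eq_iff [simp]: "g \<in> \<Gamma> \<Longrightarrow> g x = g y \<longleftrightarrow> x = y"
  by (metis inv_app)

lemma inv_app_eq: "g \<in> \<Gamma> \<Longrightarrow> pinv g x = y \<longleftrightarrow> x = g y"
  by (metis app_inv inv_app)

lemma card_pos: "card \<Gamma> > 0"
  using fin id_mem by (auto simp: card_gt_0_iff)

lemma funpow_mem: "g \<in> \<Gamma> \<Longrightarrow> g ^^ n \<in> \<Gamma>"
  by (induction n) (use id_mem comp_mem in \<open>auto simp: id_def\<close>)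

lemma subgrpI:
  assumes "S \<subseteq> \<Gamma>" "id \<in> S" "\<And>g k. g \<in> S \<Longrightarrow> k \<in> S \<Longrightarrow> g \<circ> k \<in> S" "\<And>g. g \<in> S \<Longrightarrow> pinv g \<in> S"
  shows "perm_grp S"
  using assms bij finite_subset[OF assms(1) fin] by unfold_locales auto

text \<open>The fibres of \<open>e\<close> are the left cosets of \<open>S\<close>. Different
  choices of \<open>e\<close> give Lagrange's theorem, the orbit-stabiliser formula, its version for
  pairs of points, and the order modulo a kernel.\<close>

lemma card_image_cosets:
  assumes "perm_grp S" "S \<subseteq> \<Gamma>"
    and e: "\<And>g k. g \<in> \<Gamma> \<Longrightarrow> k \<in> \<Gamma> \<Longrightarrow> e g = e k \<longleftrightarrow> pinv g \<circ> k \<in> S"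
  shows "card \<Gamma> = card (e ` \<Gamma>) * card S"
proof -
  have fibre: "card {k \<in> \<Gamma>. e k = e g} = card S" if g: "g \<in> \<Gamma>" for g
  proof -
    have "{k \<in> \<Gamma>. e k = e g} = (\<lambda>s. g \<circ> s) ` S"
    proof (intro equalityI subsetI)
      fix k assume "k \<in> {k \<in> \<Gamma>. e k = e g}"
      then have k: "k \<in> \<Gamma>" "pinv g \<circ> k \<in> S" using e[OF g, of k] by auto
      moreover have "k = g \<circ> (pinv g \<circ> k)" using g by (auto simp: fun_eq_iff)
      ultimately show "k \<in> (\<lambda>s. g \<circ> s) ` S" by blast
    next
      fix k assume "k \<in> (\<lambda>s. g \<circ> s) ` S"
      then obtain s where s: "s \<in> S" "k = g \<circ> s" by blast
      then have "pinv g \<circ> k = s" using g by (auto simp: fun_eq_iff)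
      then show "k \<in> {k \<in> \<Gamma>. e k = e g}"
        using e[OF g, of k] s g assms(2) comp_mem by auto
    qed
    moreover have "inj_on (\<lambda>s. g \<circ> s) S"
    proof (rule inj_onI)
      fix s t assume "g \<circ> s = g \<circ> t"
      then have "g (s x) = g (t x)" for x by (metis comp_apply)
      then show "s = t" using g by (auto simp: fun_eq_iff)
    qed
    ultimately show ?thesis by (simp add: card_image)
  qed
  have "card \<Gamma> = (\<Sum>g\<in>\<Gamma>. 1)" by simp
  also have "\<dots> = (\<Sum>y\<in>e ` \<Gamma>. \<Sum>g\<in>{g \<in> \<Gamma>. e g = y}. 1)" by (rule sum.image_gen[OF fin])
  also have "\<dots> = (\<Sum>y\<in>e ` \<Gamma>. card S)" using fibre by (intro sum.cong) auto
  finally show ?thesis by simp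
qed

lemma card_subgrp_dvd:
  assumes "perm_grp S" "S \<subseteq> \<Gamma>"
  shows "card S dvd card \<Gamma>"
proof -
  interpret S: perm_grp S by fact
  have "(\<lambda>s. g \<circ> s) ` S = (\<lambda>s. k \<circ> s) ` S \<longleftrightarrow> pinv g \<circ> k \<in> S" if g: "g \<in> \<Gamma>" and k: "k \<in> \<Gamma>" for g k
  proof
    assume "(\<lambda>s. g \<circ> s) ` S = (\<lambda>s. k \<circ> s) ` S"
    moreover have "k \<circ> id \<in> (\<lambda>s. k \<circ> s) ` S" using S.id_mem by (rule imageI)
    ultimately obtain s where "s \<in> S" "k = g \<circ> s" by auto
    moreover from this have "pinv g \<circ> k = s" using g by (auto simp: fun_eq_iff)
    ultimately show "pinv g \<circ> k \<in> S" by simp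
  next
    assume m: "pinv g \<circ> k \<in> S"
    have eq: "pinv (pinv g \<circ> k) = pinv k \<circ> g"
      by (rule inv_unique_comp) (use g k in \<open>auto simp: fun_eq_iff\<close>)
    show "(\<lambda>s. g \<circ> s) ` S = (\<lambda>s. k \<circ> s) ` S"
    proof (intro equalityI subsetI)
      fix x assume "x \<in> (\<lambda>s. g \<circ> s) ` S"
      then obtain s where s: "s \<in> S" "x = g \<circ> s" by blast
      have "pinv k \<circ> g \<circ> s \<in> S" using S.comp_mem[OF S.inv_mem[OF m] s(1)] eq by simp
      moreover have "x = k \<circ> (pinv k \<circ> g \<circ> s)" using s k by (auto simp: fun_eq_iff)
      ultimately show "x \<in> (\<lambda>s. k \<circ> s) ` S" by blast
    next
      fix x assume "x \<in> (\<lambda>s. k \<circ> s) ` S"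
      then obtain s where s: "s \<in> S" "x = k \<circ> s" by blast
      have "pinv g \<circ> k \<circ> s \<in> S" using S.comp_mem[OF m s(1)] by simp
      moreover have "x = g \<circ> (pinv g \<circ> k \<circ> s)" using s g by (auto simp: fun_eq_iff)
      ultimately show "x \<in> (\<lambda>s. g \<circ> s) ` S" by blast
    qed
  qed
  then have "card \<Gamma> = card ((\<lambda>g. (\<lambda>s. g \<circ> s) ` S) ` \<Gamma>) * card S"
    by (rule card_image_cosets[OF assms])
  then show ?thesis by simp
qed

lemma perm_grp_stab: "perm_grp (stab \<Gamma> x)"
  by (rule subgrpI) (auto simp: stab_def id_mem comp_mem inv_mem inv_app_eq)

lemma orbit_stabilizer: "card \<Gamma> = card (orb \<Gamma> x) * card (stab \<Gamma> x)"
  unfolding orb_def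
  by (rule card_image_cosets[OF perm_grp_stab])
    (auto simp: stab_def inv_app_eq comp_mem inv_mem)

lemma orb_self: "x \<in> orb \<Gamma> x"
  unfolding orb_def using id_mem by (metis id_apply imageI)

lemma finite_orb: "finite (orb \<Gamma> x)"
  by (simp add: orb_def fin)

lemma orb_app: "g \<in> \<Gamma> \<Longrightarrow> g y \<in> orb \<Gamma> x \<longleftrightarrow> y \<in> orb \<Gamma> x"
proof
  assume g: "g \<in> \<Gamma>" and "g y \<in> orb \<Gamma> x"
  then obtain k where k: "k \<in> \<Gamma>" "g y = k x" by (auto simp: orb_def)
  then have "y = (pinv g \<circ> k) x" using g by (metis comp_apply inv_app)
  then show "y \<in> orb \<Gamma> x" using g k comp_mem inv_mem unfolding orb_def by blast
next
  assume g: "g \<in> \<Gamma>" and "y \<in> orb \<Gamma> x"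
  then obtain k where k: "k \<in> \<Gamma>" "y = k x" by (auto simp: orb_def)
  then have "g y = (g \<circ> k) x" by simp
  then show "g y \<in> orb \<Gamma> x" using g k comp_mem unfolding orb_def by blast
qed

lemma orb_eq: "y \<in> orb \<Gamma> x \<Longrightarrow> orb \<Gamma> y = orb \<Gamma> x"
proof -
  assume y: "y \<in> orb \<Gamma> x"
  then obtain k where k: "k \<in> \<Gamma>" "y = k x" by (auto simp: orb_def)
  then have "x = pinv k y" by simp
  then have "x \<in> orb \<Gamma> y" using k inv_mem unfolding orb_def by blast
  have "z \<in> orb \<Gamma> x" if "z \<in> orb \<Gamma> y" for z
    using that y orb_app by (auto simp: orb_def[of \<Gamma> y])
  moreover have "z \<in> orb \<Gamma> y" if "z \<in> orb \<Gamma> x" for z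
    using that \<open>x \<in> orb \<Gamma> y\<close> orb_app by (auto simp: orb_def[of \<Gamma> x])
  ultimately show ?thesis by blast
qed

section \<open>Powers of an element and the lengths of its cycles\<close>

lemma funpow_eq_id:
  assumes g: "g \<in> \<Gamma>"
  obtains n where "n > 0" "g ^^ n = id"
proof -
  have "\<not> inj (\<lambda>i. g ^^ i)"
  proof
    assume "inj (\<lambda>i. g ^^ i)"
    moreover have "finite (range (\<lambda>i. g ^^ i))"
      by (rule finite_subset[OF _ fin]) (use funpow_mem[OF g] in auto)
    ultimately show False using finite_imageD by fastforce
  qed
  then obtain i j where "i < j" "g ^^ i = g ^^ j" unfolding inj_def by (metis linorder_neqE_nat)
  moreover have "(g ^^ (j - i)) x = x" for x
  proof -
    have "(g ^^ j) x = (g ^^ i) ((g ^^ (j - i)) x)"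
      using \<open>i < j\<close> by (metis comp_apply funpow_add le_add_diff_inverse less_imp_le)
    then show ?thesis using \<open>g ^^ i = g ^^ j\<close> funpow_mem[OF g, of i] by (metis app_eq_iff)
  qed
  ultimately show thesis using that[of "j - i"] by (auto simp: fun_eq_iff)
qed

text \<open>In a finite group inverses are powers with natural exponents, so iteration by
  \<open>^^\<close> already produces the cyclic subgroup.\<close>

lemma perm_grp_powers:
  assumes g: "g \<in> \<Gamma>"
  shows "perm_grp (range (\<lambda>i. g ^^ i))"
proof (rule subgrpI)
  show "range (\<lambda>i. g ^^ i) \<subseteq> \<Gamma>" using funpow_mem[OF g] by blast
  show "id \<in> range (\<lambda>i. g ^^ i)" by (metis funpow_0 rangeI eq_id_iff)
  show "k \<circ> l \<in> range (\<lambda>i. g ^^ i)" if kl: "k \<in> range (\<lambda>i. g ^^ i)" "l \<in> range (\<lambda>i. g ^^ i)" for k l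
  proof -
    obtain i j where "k = g ^^ i" "l = g ^^ j" using kl by auto
    then have "k \<circ> l = g ^^ (i + j)" by (simp add: funpow_add)
    then show ?thesis by simp
  qed
  fix k assume "k \<in> range (\<lambda>i. g ^^ i)"
  then obtain i where i: "k = g ^^ i" by blast
  obtain n where n: "n > 0" "k ^^ n = id" using funpow_eq_id[OF funpow_mem[OF g, of i]] i by metis
  have "pinv k = k ^^ (n - 1)"
  proof (rule inv_unique_comp)
    show "k \<circ> k ^^ (n - 1) = id" using n by (metis Suc_pred' funpow.simps(2))
    show "k ^^ (n - 1) \<circ> k = id" using n by (metis Suc_pred' funpow_Suc_right)
  qed
  also have "\<dots> = g ^^ ((n - 1) * i)" unfolding i by (simp add: funpow_mult mult.commute)
  finally show "pinv k \<in> range (\<lambda>i. g ^^ i)" by blast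
qed

text \<open>\<open>n\<close> is the length of the cycle of \<open>g\<close> through
  \<open>x\<close>. It is the size of the orbit of \<open>x\<close> under the powers of
  \<open>g\<close>, and therefore divides the order of that cyclic subgroup and of
  \<open>\<Gamma>\<close>.\<close>

lemma period:
  assumes g: "g \<in> \<Gamma>"
  obtains n where "n > 0" "n dvd card \<Gamma>" "\<And>i. (g ^^ i) x = x \<longleftrightarrow> n dvd i"
    "\<And>i j. i < n \<Longrightarrow> j < n \<Longrightarrow> (g ^^ i) x = (g ^^ j) x \<Longrightarrow> i = j"
proof -
  define n where "n = (LEAST n. n > 0 \<and> (g ^^ n) x = x)"
  obtain m where "m > 0" "g ^^ m = id" using funpow_eq_id[OF g] .
  then have "m > 0 \<and> (g ^^ m) x = x" by simp
  then have "n > 0 \<and> (g ^^ n) x = x" unfolding n_def by (rule LeastI)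
  then have n: "n > 0" "(g ^^ n) x = x" by simp_all
  have small: "i = 0" if "i < n" "(g ^^ i) x = x" for i
    using not_less_Least[of i "\<lambda>n. n > 0 \<and> (g ^^ n) x = x"] that unfolding n_def by auto
  have mod: "(g ^^ (i mod n)) x = (g ^^ i) x" for i by (rule funpow_mod_eq[OF n(2)])
  have iff: "(g ^^ i) x = x \<longleftrightarrow> n dvd i" for i
  proof -
    have "(g ^^ i) x = x \<longleftrightarrow> (g ^^ (i mod n)) x = x" by (simp only: mod)
    also have "\<dots> \<longleftrightarrow> i mod n = 0" using small[of "i mod n"] n(1) by fastforce
    finally show ?thesis by (simp only: dvd_eq_mod_eq_0)
  qed
  have aux: "i = j" if "i \<le> j" "j < n" "(g ^^ i) x = (g ^^ j) x" for i j
  proof -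
    have "(g ^^ j) x = (g ^^ i) ((g ^^ (j - i)) x)"
      using \<open>i \<le> j\<close> by (metis comp_apply funpow_add le_add_diff_inverse)
    then have "(g ^^ (j - i)) x = x" using that(3) funpow_mem[OF g, of i] by (metis app_eq_iff)
    moreover have "j - i < n" using that(2) by simp
    ultimately have "j - i = 0" by (intro small)
    then show ?thesis using that(1) by simp
  qed
  have inj: "i = j" if "i < n" "j < n" "(g ^^ i) x = (g ^^ j) x" for i j
    using aux[of i j] aux[of j i] that by (cases "i \<le> j") auto
  let ?C = "range (\<lambda>i. g ^^ i)"
  interpret C: perm_grp ?C by (rule perm_grp_powers[OF g])
  have "orb ?C x = (\<lambda>i. (g ^^ i) x) ` {..<n}"
    unfolding orb_def
  proof (intro equalityI subsetI)
    fix y assume "y \<in> (\<lambda>g. g x) ` ?C"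
    then obtain i where "y = (g ^^ i) x" by auto
    then have "y = (g ^^ (i mod n)) x" using mod by simp
    then show "y \<in> (\<lambda>i. (g ^^ i) x) ` {..<n}" using n(1) by auto
  qed auto
  then have "card (orb ?C x) = n"
    using inj by (simp add: card_image inj_on_def)
  then have "n dvd card ?C" using C.orbit_stabilizer[of x] by simp
  also have "\<dots> dvd card \<Gamma>"
    by (rule card_subgrp_dvd[OF C.perm_grp_axioms]) (use funpow_mem[OF g] in auto)
  finally show thesis using that n(1) iff inj by blast
qed

end

text \<open>The condition \<open>large\<close> speaks of all divisors because it is applied to orbit
  lengths and cycle lengths, and because in this form it passes to subgroups and quotients, whose
  orders divide \<open>card \<Gamma>\<close>.\<close>

locale sparse_action = perm_grp \<Gamma> for \<Gamma> :: "('a \<Rightarrow> 'a) set" +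
  fixes r :: real and h :: nat and V :: "'a set" and E :: "('a \<times> 'a) set"
  assumes finV: "finite V" and E_sub: "E \<subseteq> V \<times> V" and symE: "sym E" and irreflE: "irrefl E"
    and sparse: "sparse r h V E" and r_nonneg: "r \<ge> 0"
    and E_app: "g \<in> \<Gamma> \<Longrightarrow> (u, v) \<in> E \<Longrightarrow> (g u, g v) \<in> E"
    and V_app: "g \<in> \<Gamma> \<Longrightarrow> v \<in> V \<Longrightarrow> g v \<in> V"
    and large: "d dvd card \<Gamma> \<Longrightarrow> d \<noteq> 1 \<Longrightarrow> r < real d \<and> h < d \<and> 2 < d"
begin

lemma E_app_iff: "g \<in> \<Gamma> \<Longrightarrow> (g u, g v) \<in> E \<longleftrightarrow> (u, v) \<in> E"
  using E_app[of g u v] E_app[of "pinv g" "g u" "g v"] inv_mem by auto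

lemma V_app_iff: "g \<in> \<Gamma> \<Longrightarrow> g v \<in> V \<longleftrightarrow> v \<in> V"
  using V_app[of g v] V_app[of "pinv g" "g v"] inv_mem by auto

lemma orb_sub: "v \<in> V \<Longrightarrow> orb \<Gamma> v \<subseteq> V"
  using V_app by (auto simp: orb_def)

lemma subgrp_action: "perm_grp S \<Longrightarrow> S \<subseteq> \<Gamma> \<Longrightarrow> sparse_action S r h V E"
  unfolding sparse_action_def sparse_action_axioms_def
  using finV E_sub symE irreflE sparse r_nonneg E_app V_app large card_subgrp_dvd dvd_trans
  by (intro conjI allI impI) (assumption | blast)+

lemma minor_action:
  assumes "minor_of J F V E" "finite J" "sym F" "irrefl F"
    and "\<And>g u v. g \<in> \<Gamma> \<Longrightarrow> (u, v) \<in> F \<Longrightarrow> (g u, g v) \<in> F"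
    and "\<And>g v. g \<in> \<Gamma> \<Longrightarrow> v \<in> J \<Longrightarrow> g v \<in> J"
  shows "sparse_action \<Gamma> r h J F"
proof
  show "F \<subseteq> J \<times> J" using assms(1) by (simp add: minor_of_def)
qed (use assms sparse_minor[OF sparse assms(1)] r_nonneg large in auto)

text \<open>The edges in the orbit of \<open>(i, j)\<close> span a minor in which every vertex of the larger orbit
  has as many neighbours as the orbit of \<open>j\<close> under the stabiliser of \<open>i\<close>. By sparseness this number is
  at most \<open>r\<close>, and it divides the group order.\<close>

lemma stab_mono:
  assumes ij: "(i, j) \<in> E" and le: "card (orb \<Gamma> j) \<le> card (orb \<Gamma> i)"
  shows "stab \<Gamma> i \<subseteq> stab \<Gamma> j"
proof -
  let ?S = "stab \<Gamma> i" and ?T = "stab (stab \<Gamma> i) j"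
  interpret S: perm_grp ?S by (rule perm_grp_stab)
  define d where "d = card (orb ?S j)"
  define a where "a = card (orb \<Gamma> i)"
  define P where "P = (\<lambda>g. (g i, g j)) ` \<Gamma>"
  define J where "J = orb \<Gamma> i \<union> orb \<Gamma> j"
  have dvd: "d dvd card \<Gamma>"
    unfolding d_def using S.orbit_stabilizer[of j] orbit_stabilizer[of i] by (metis dvd_mult dvd_triv_left)
  have ST: "card ?S = d * card ?T" unfolding d_def by (rule S.orbit_stabilizer)
  have "card \<Gamma> = card P * card ?T"
    unfolding P_def
    by (rule card_image_cosets[OF S.perm_grp_stab])
      (auto simp: stab_def inv_app_eq comp_mem inv_mem)
  moreover have "card \<Gamma> = a * (d * card ?T)" unfolding a_def ST[symmetric] by (rule orbit_stabilizer)
  moreover have "card \<Gamma> > 0" by (rule card_pos)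
  ultimately have P: "card P = a * d" by auto
  have PE: "P \<subseteq> E" using ij E_app by (auto simp: P_def)
  have finP: "finite P" using fin by (simp add: P_def)
  have PJ: "P \<subseteq> orb \<Gamma> i \<times> orb \<Gamma> j" by (auto simp: P_def orb_def)
  have ijV: "i \<in> V" "j \<in> V" using ij E_sub by auto
  have "minor_of J (P \<union> P\<inverse>) V E"
  proof (rule minor_of_subgraph)
    show "J \<subseteq> V" using ijV orb_sub by (auto simp: J_def)
    show "P \<union> P\<inverse> \<subseteq> E" using PE symE by (auto dest: symD)
    show "P \<union> P\<inverse> \<subseteq> J \<times> J" using PJ by (auto simp: J_def)
  qed
  moreover have "finite J" by (simp add: J_def finite_orb)
  moreover have "sym (P \<union> P\<inverse>)" by (auto simp: sym_def)
  moreover have "irrefl (P \<union> P\<inverse>)" using PE irreflE by (auto simp: irrefl_def)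
  ultimately have bound: "real (card (P \<union> P\<inverse>)) \<le> r * real (card J)"
    by (rule sparseD(1)[OF sparse])
  have apos: "a > 0" using orb_self finite_orb by (auto simp: a_def card_gt_0_iff)
  \<comment> \<open>\<open>P\<close> has \<open>a * d\<close> arcs. If both ends lie in one orbit,
    these sit on \<open>a\<close> vertices; otherwise \<open>P\<close> and its converse are disjoint
    and give \<open>2 * (a * d)\<close> arcs on at most \<open>2 * a\<close> vertices. Either way
    the average degree is at least \<open>d\<close>.\<close>
  have "real d \<le> r"
  proof (cases "j \<in> orb \<Gamma> i")
    case True
    then have "card J = a" by (simp add: J_def a_def orb_eq)
    moreover have "card P \<le> card (P \<union> P\<inverse>)" using finP by (intro card_mono) auto
    ultimately have "real a * real d \<le> real a * r"
      using bound P by (simp add: mult.commute) (metis (mono_tags) of_nat_le_iff of_nat_mult order_trans)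
    then show ?thesis using apos by simp
  next
    case False
    have "orb \<Gamma> i \<inter> orb \<Gamma> j = {}"
    proof (rule ccontr)
      assume "orb \<Gamma> i \<inter> orb \<Gamma> j \<noteq> {}"
      then obtain x where "x \<in> orb \<Gamma> i" "x \<in> orb \<Gamma> j" by blast
      then have "orb \<Gamma> i = orb \<Gamma> j" using orb_eq by metis
      then show False using False orb_self by blast
    qed
    then have "P \<inter> P\<inverse> = {}" using PJ by blast
    then have "card (P \<union> P\<inverse>) = 2 * (a * d)"
      using finP P by (simp add: card_Un_disjoint card_inverse)
    moreover have "card J \<le> 2 * a"
      unfolding J_def using card_Un_le[of "orb \<Gamma> i" "orb \<Gamma> j"] le by (simp add: a_def)
    moreover from this have "r * real (card J) \<le> r * (2 * real a)"
      using r_nonneg by (intro mult_left_mono) auto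
    ultimately have "real a * (2 * real d) \<le> real a * (2 * r)" using bound by (simp add: mult.commute mult.left_commute)
    then show ?thesis using apos by simp
  qed
  then have "d = 1" using large[OF dvd] by fastforce
  then have "orb ?S j = {j}" using S.orb_self[of j] unfolding d_def by (metis card_1_singletonE singletonD)
  then show ?thesis by (auto simp: orb_def stab_def)
qed

text \<open>With a single orbit all orbit lengths agree, so \<open>stab_mono\<close> applies to
  every edge in both directions, and being fixed spreads from \<open>u\<close> over the connected
  graph.\<close>

lemma stab_transitive:
  assumes "conn E V" "\<And>u v. u \<in> V \<Longrightarrow> v \<in> V \<Longrightarrow> v \<in> orb \<Gamma> u" "g \<in> \<Gamma>" "u \<in> V" "g u = u" "v \<in> V"
  shows "g v = v"
proof -
  have "v \<in> {v. g v = v}"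
  proof (rule conn_closed[OF assms(1,4,6)])
    show "u \<in> {v. g v = v}" using assms(5) by simp
    fix x y assume xy: "(x, y) \<in> E" "x \<in> V" "y \<in> V" "x \<in> {v. g v = v}"
    have "orb \<Gamma> x = orb \<Gamma> y" by (rule orb_eq) (use xy assms(2) in auto)
    then have "stab \<Gamma> x \<subseteq> stab \<Gamma> y" by (intro stab_mono xy) simp
    then show "y \<in> {v. g v = v}" using xy assms(3) by (auto simp: stab_def)
  qed
  then show ?thesis by simp
qed

end

section \<open>Equivariant retractions and contraction onto a smallest orbit\<close>

context sparse_action
begin

text \<open>Each branch set is named by one of its own vertices, so the same \<open>\<Gamma>\<close>
  acts on the contracted graph, and the surviving vertices keep their orbits and
  stabilisers.\<close>

definition retract :: "('a \<Rightarrow> 'a) \<Rightarrow> bool" where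
  "retract \<psi> \<longleftrightarrow> \<psi> ` V \<subseteq> V \<and> (\<forall>v\<in>V. \<psi> (\<psi> v) = \<psi> v) \<and> (\<forall>g\<in>\<Gamma>. \<forall>v\<in>V. \<psi> (g v) = g (\<psi> v))
     \<and> (\<forall>c. conn E {v \<in> V. \<psi> v = c})"

lemma retract_action:
  assumes "retract \<psi>"
  shows "sparse_action \<Gamma> r h (\<psi> ` V) (quot \<psi> E)"
proof (rule minor_action)
  show "minor_of (\<psi> ` V) (quot \<psi> E) V E"
    by (rule minor_of_quot[OF E_sub]) (use assms in \<open>simp add: retract_def\<close>)
  show "(g u, g v) \<in> quot \<psi> E" if g: "g \<in> \<Gamma>" and uv: "(u, v) \<in> quot \<psi> E" for g u v
  proof -
    obtain x y where xy: "(x, y) \<in> E" "u = \<psi> x" "v = \<psi> y" "u \<noteq> v" using uv by (auto simp: quot_def)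
    then have "x \<in> V" "y \<in> V" using E_sub by auto
    then have "g u = \<psi> (g x)" "g v = \<psi> (g y)" using assms g xy by (auto simp: retract_def)
    moreover have "(g x, g y) \<in> E" using E_app g xy by blast
    moreover have "g u \<noteq> g v" using g xy(4) by simp
    ultimately show ?thesis using quotI[of "g x" "g y" E \<psi>] by simp
  qed
  show "g v \<in> \<psi> ` V" if g: "g \<in> \<Gamma>" and v: "v \<in> \<psi> ` V" for g v
  proof -
    obtain x where "x \<in> V" "v = \<psi> x" using v by blast
    then have "g v = \<psi> (g x)" "g x \<in> V" using assms g V_app by (auto simp: retract_def)
    then show ?thesis by blast
  qed
qed (use finV symE in \<open>auto simp: sym_quot irrefl_quot\<close>)

text \<open>Two elements taking \<open>a\<close> to the same point differ by an element of
  \<open>stab \<Gamma> a\<close>, which fixes \<open>c\<close> by assumption; so the choice made in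
  \<open>k\<close> does not affect the value of \<open>f\<close>.\<close>

lemma equivariant_map:
  assumes "stab \<Gamma> a \<subseteq> stab \<Gamma> c"
  obtains f where "\<And>g. g \<in> \<Gamma> \<Longrightarrow> f (g a) = g c" "\<And>x. x \<notin> orb \<Gamma> a \<Longrightarrow> f x = x"
proof -
  define k where "k x = (SOME g. g \<in> \<Gamma> \<and> g a = x)" for x
  define f where "f x = (if x \<in> orb \<Gamma> a then k x c else x)" for x
  have "f (g a) = g c" if g: "g \<in> \<Gamma>" for g
  proof -
    have k: "k (g a) \<in> \<Gamma> \<and> k (g a) a = g a"
      unfolding k_def by (rule someI[of _ g]) (use g in simp)
    then have "pinv g \<circ> k (g a) \<in> stab \<Gamma> a" using g by (auto simp: stab_def comp_mem inv_mem)
    then have "pinv g \<circ> k (g a) \<in> stab \<Gamma> c" using assms by blast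
    then have "k (g a) c = g c" using g by (auto simp: stab_def inv_app_eq)
    moreover have "g a \<in> orb \<Gamma> a" using g by (auto simp: orb_def)
    ultimately show ?thesis by (simp add: f_def)
  qed
  then show thesis using that[of f] by (simp add: f_def)
qed

text \<open>Among all equivariant retractions with connected fibres take one with smallest image. Were
  the image larger than the orbit of \<open>b\<close>, its largest further orbit could be merged along edges of
  the contracted graph into an adjacent orbit that is not larger.\<close>

lemma retraction_on_orbit:
  assumes conn: "conn E V" and b: "b \<in> V" and min: "\<And>v. v \<in> V \<Longrightarrow> card (orb \<Gamma> b) \<le> card (orb \<Gamma> v)"
  obtains \<psi> where "retract \<psi>" "\<psi> ` V = orb \<Gamma> b"
proof -
  \<comment> \<open>By equivariance the requirement \<open>\<psi> b = b\<close> keeps the whole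
    orbit of \<open>b\<close> inside the image of every candidate.\<close>
  define Q where "Q \<psi> \<longleftrightarrow> retract \<psi> \<and> \<psi> b = b" for \<psi>
  have "conn E {v \<in> V. id v = c}" for c
  proof -
    have "{v \<in> V. id v = c} = (if c \<in> V then {c} else {})" by auto
    then show ?thesis by (simp add: conn_singleton conn_empty)
  qed
  then have "Q id" by (simp add: Q_def retract_def)
  then obtain \<psi> where \<psi>: "Q \<psi>" and least: "\<And>\<phi>. Q \<phi> \<Longrightarrow> card (\<psi> ` V) \<le> card (\<phi> ` V)"
    using ex_has_least_nat[of Q id "\<lambda>\<psi>. card (\<psi> ` V)"] by blast
  then have ret: "retract \<psi>" and bb: "\<psi> b = b" by (auto simp: Q_def)
  have eqv: "\<psi> (g v) = g (\<psi> v)" if "g \<in> \<Gamma>" "v \<in> V" for g v using ret that by (auto simp: retract_def)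
  have idem: "\<psi> (\<psi> v) = \<psi> v" if "v \<in> V" for v using ret that by (auto simp: retract_def)
  have fib: "conn E {v \<in> V. \<psi> v = c}" for c using ret by (auto simp: retract_def)
  let ?J = "\<psi> ` V"
  have JV: "?J \<subseteq> V" using ret by (auto simp: retract_def)
  interpret Q: sparse_action \<Gamma> r h ?J "quot \<psi> E" by (rule retract_action[OF ret])
  have bJ: "b \<in> ?J" using b bb by force
  have "?J = orb \<Gamma> b"
  proof (rule ccontr)
    assume "?J \<noteq> orb \<Gamma> b"
    moreover have "orb \<Gamma> b \<subseteq> ?J" by (rule Q.orb_sub[OF bJ])
    ultimately obtain a0 where "a0 \<in> ?J - orb \<Gamma> b" by blast
    moreover have "card (orb \<Gamma> x) < Suc (card \<Gamma>)" for x
      using card_image_le[OF fin, of "\<lambda>g. g x"] by (simp add: orb_def)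
    ultimately have "\<exists>a1. a1 \<in> ?J - orb \<Gamma> b \<and> (\<forall>x. x \<in> ?J - orb \<Gamma> b \<longrightarrow> card (orb \<Gamma> x) \<le> card (orb \<Gamma> a1))"
      by (intro ex_has_greatest_nat[where k = a0 and b = "Suc (card \<Gamma>)"]) auto
    then obtain a1 where a1: "a1 \<in> ?J - orb \<Gamma> b"
        and max: "\<And>x. x \<in> ?J - orb \<Gamma> b \<Longrightarrow> card (orb \<Gamma> x) \<le> card (orb \<Gamma> a1)"
      by blast
    have a1b: "b \<notin> orb \<Gamma> a1" using a1 orb_eq orb_self by blast
    have "\<exists>a c. (a, c) \<in> quot \<psi> E \<and> a \<in> orb \<Gamma> a1 \<and> c \<notin> orb \<Gamma> a1"
    proof (rule ccontr)
      assume no: "\<not> ?thesis"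
      have "b \<in> orb \<Gamma> a1"
        by (rule conn_closed[OF conn_quot[OF conn, of \<psi>], of a1 b]) (use a1 bJ orb_self no in auto)
      then show False using a1b by simp
    qed
    then obtain a c where ac: "(a, c) \<in> quot \<psi> E" "a \<in> orb \<Gamma> a1" "c \<notin> orb \<Gamma> a1" by blast
    have orba: "orb \<Gamma> a = orb \<Gamma> a1" by (rule orb_eq[OF ac(2)])
    have aJ: "a \<in> ?J" and cJ: "c \<in> ?J" using ac(1) Q.E_sub by auto
    \<comment> \<open>If \<open>c\<close> lies in the orbit of \<open>b\<close>, this is the
      minimality of that orbit; otherwise it is the maximality of the orbit of
      \<open>a1\<close>.\<close>
    have "card (orb \<Gamma> c) \<le> card (orb \<Gamma> a)"
    proof (cases "c \<in> orb \<Gamma> b")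
      case True
      then show ?thesis using orb_eq[OF True] min[of a] aJ JV by auto
    next
      case False
      then show ?thesis using max[of c] cJ orba by simp
    qed
    then have "stab \<Gamma> a \<subseteq> stab \<Gamma> c" by (rule Q.stab_mono[OF ac(1)])
    then obtain f where f: "\<And>g. g \<in> \<Gamma> \<Longrightarrow> f (g a) = g c" "\<And>x. x \<notin> orb \<Gamma> a \<Longrightarrow> f x = x"
      using equivariant_map by blast
    have co: "c \<notin> orb \<Gamma> a" using ac(3) orba by simp
    have gc: "g c \<notin> orb \<Gamma> a" if "g \<in> \<Gamma>" for g using co orb_app that by simp
    have fJ: "f x \<in> ?J - orb \<Gamma> a" if x: "x \<in> ?J" for x
    proof (cases "x \<in> orb \<Gamma> a")
      case True
      then obtain g where "g \<in> \<Gamma>" "x = g a" by (auto simp: orb_def)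
      then show ?thesis using f(1) gc Q.V_app cJ by auto
    next
      case False then show ?thesis using f(2) x by simp
    qed
    have feq: "f (g x) = g (f x)" if g: "g \<in> \<Gamma>" for g x
    proof (cases "x \<in> orb \<Gamma> a")
      case True
      then obtain k where k: "k \<in> \<Gamma>" "x = k a" by (auto simp: orb_def)
      then have "f (g x) = f ((g \<circ> k) a)" by simp
      also have "\<dots> = (g \<circ> k) c" by (rule f(1)[OF comp_mem[OF g k(1)]])
      finally show ?thesis using f(1) k by simp
    next
      case False then show ?thesis using f(2) orb_app[OF g] by simp
    qed
    have psiJ: "\<psi> x = x" if "x \<in> ?J" for x using that idem by auto
    let ?\<phi> = "f \<circ> \<psi>"
    have "Q ?\<phi>"
      unfolding Q_def retract_def
    proof (intro conjI ballI allI)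
      show "?\<phi> ` V \<subseteq> V" using fJ JV by auto
      show "?\<phi> (?\<phi> v) = ?\<phi> v" if "v \<in> V" for v
      proof -
        have "f (\<psi> v) \<in> ?J - orb \<Gamma> a" using that by (intro fJ imageI)
        then show ?thesis using psiJ[of "f (\<psi> v)"] f(2)[of "f (\<psi> v)"] by simp
      qed
      show "?\<phi> (g v) = g (?\<phi> v)" if "g \<in> \<Gamma>" "v \<in> V" for g v
        using that eqv feq by simp
      show "?\<phi> b = b" using bb f(2) a1b orba by simp
      fix d
      show "conn E {v \<in> V. ?\<phi> v = d}"
      proof (cases "d \<in> ?J - orb \<Gamma> a")
        case False
        have "?\<phi> v \<in> ?J - orb \<Gamma> a" if "v \<in> V" for v using fJ[of "\<psi> v"] that by simp
        then have "{v \<in> V. ?\<phi> v = d} = {}" using False by blast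
        then show ?thesis by (simp only: conn_empty)
      next
        case True
        \<comment> \<open>The fibre of \<open>f\<close> over \<open>d\<close> consists of
          \<open>d\<close> and all \<open>g a\<close> with \<open>g c = d\<close>. Each of these is
          adjacent to \<open>d\<close>, so the fibre is a star in the contracted graph.\<close>
        define S where "S = {j \<in> ?J. f j = d}"
        have "{v \<in> V. ?\<phi> v = d} = (\<Union>j\<in>S. {v \<in> V. \<psi> v = j})" by (auto simp: S_def)
        moreover have "conn E (\<Union>j\<in>S. {v \<in> V. \<psi> v = j})"
        proof (rule conn_UN[OF _ fib])
          show "conn (quot \<psi> E) S"
          proof (rule conn_star[OF Q.symE])
            show "d \<in> S" using True f(2) by (simp add: S_def)
            fix j assume j: "j \<in> S"
            show "j = d \<or> (d, j) \<in> quot \<psi> E"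
            proof (cases "j \<in> orb \<Gamma> a")
              case True
              then obtain g where g: "g \<in> \<Gamma>" "j = g a" by (auto simp: orb_def)
              then have "d = g c" using j f(1) by (simp add: S_def)
              then show ?thesis using Q.E_app[OF g(1) ac(1)] g(2) Q.symE by (auto dest: symD)
            next
              case False then show ?thesis using j f(2) by (simp add: S_def)
            qed
          qed
          show "\<exists>u\<in>{v \<in> V. \<psi> v = i}. \<exists>v\<in>{v \<in> V. \<psi> v = j}. (u, v) \<in> E" if ij: "(i, j) \<in> quot \<psi> E" for i j
          proof -
            obtain u v where "(u, v) \<in> E" "i = \<psi> u" "j = \<psi> v" using ij by (auto simp: quot_def)
            then show ?thesis using E_sub by auto
          qed
        qed
        ultimately show ?thesis by simp
      qed
    qed
    moreover have "card (?\<phi> ` V) < card ?J"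
    proof (rule psubset_card_mono)
      show "finite ?J" using finV by simp
      have "a \<in> ?J" "a \<notin> ?\<phi> ` V" using aJ fJ orb_self[of a] by auto
      moreover have "?\<phi> ` V \<subseteq> ?J" using fJ by auto
      ultimately show "?\<phi> ` V \<subset> ?J" by blast
    qed
    ultimately show False using least[of ?\<phi>] by simp
  qed
  then show thesis using that ret by blast
qed

end

section \<open>Transitive actions are abelian\<close>

lemma funpow_comm: "f \<circ> g = g \<circ> f \<Longrightarrow> f ^^ n \<circ> g = g \<circ> f ^^ n"
  by (induction n) (simp_all add: comp_assoc, metis comp_assoc)

context perm_grp
begin

lemma comp_left_cancel: "g \<in> \<Gamma> \<Longrightarrow> g \<circ> x = g \<circ> y \<longleftrightarrow> x = y"
  by (simp add: fun_eq_iff)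

lemma comp_right_cancel: "g \<in> \<Gamma> \<Longrightarrow> x \<circ> g = y \<circ> g \<longleftrightarrow> x = y"
  by (metis app_inv comp_apply fun_eq_iff)

text \<open>This action on subsets lets \<open>\<Gamma>\<close> move blocks, which have another type
  than vertices. Evaluation at singletons shows that it is faithful (\<open>card_image_grp\<close>),
  so the divisor condition carries over.\<close>

lemma perm_grp_image: "perm_grp (image ` \<Gamma>)"
proof
  show "finite (image ` \<Gamma>)" using fin by simp
  show "bij G" if G: "G \<in> image ` \<Gamma>" for G
  proof -
    obtain g where g: "g \<in> \<Gamma>" "G = image g" using G by blast
    then have "G \<circ> image (pinv g) = id" "image (pinv g) \<circ> G = id"
      by (auto simp: fun_eq_iff image_image)
    then show ?thesis by (intro o_bij)
  qed
  show "id \<in> image ` \<Gamma>" by (rule image_eqI[OF _ id_mem]) (simp add: fun_eq_iff)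
  show "G \<circ> H \<in> image ` \<Gamma>" if GH: "G \<in> image ` \<Gamma>" "H \<in> image ` \<Gamma>" for G H
  proof -
    obtain g k where "g \<in> \<Gamma>" "G = image g" "k \<in> \<Gamma>" "H = image k" using GH by blast
    then show ?thesis by (intro image_eqI[of _ _ "g \<circ> k"]) (auto simp: comp_mem image_comp fun_eq_iff)
  qed
  show "pinv G \<in> image ` \<Gamma>" if G: "G \<in> image ` \<Gamma>" for G
  proof -
    obtain g where g: "g \<in> \<Gamma>" "G = image g" using G by blast
    have "pinv G = image (pinv g)"
      by (rule inv_unique_comp) (use g in \<open>auto simp: fun_eq_iff image_image\<close>)
    then show ?thesis using g inv_mem by blast
  qed
qed

lemma card_image_grp: "card (image ` \<Gamma>) = card \<Gamma>"
proof (rule card_image, rule inj_onI, rule ext)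
  fix g k :: "'a \<Rightarrow> 'a" and x assume "image g = image k"
  then have "g ` {x} = k ` {x}" by (rule arg_cong)
  then show "g x = k x" by simp
qed

end

text \<open>Elements are trivial outside \<open>V\<close>, so agreement at one vertex becomes
  equality of functions (\<open>regular\<close>). The graph is then a connected Cayley graph: any
  vertex \<open>b\<close> plays the identity, and the \<open>s\<close> with
  \<open>(b, s b) \<in> E\<close> form the connection set.\<close>

locale transitive_action = sparse_action +
  assumes conn: "conn E V"
    and transitive: "u \<in> V \<Longrightarrow> v \<in> V \<Longrightarrow> v \<in> orb \<Gamma> u"
    and permutes: "g \<in> \<Gamma> \<Longrightarrow> g permutes V"
begin

lemma regular: "g \<in> \<Gamma> \<Longrightarrow> k \<in> \<Gamma> \<Longrightarrow> v \<in> V \<Longrightarrow> g v = k v \<Longrightarrow> g = k"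
proof (rule ext)
  fix x assume gk: "g \<in> \<Gamma>" "k \<in> \<Gamma>" "v \<in> V" "g v = k v"
  show "g x = k x"
  proof (cases "x \<in> V")
    case True
    have "(pinv g \<circ> k) v = v" using gk by (simp add: inv_app_eq)
    then have "(pinv g \<circ> k) x = x"
      using stab_transitive[of "pinv g \<circ> k" v x] conn transitive comp_mem[OF inv_mem[OF gk(1)] gk(2)] gk(3) True
      by blast
    then show ?thesis using gk by (simp add: inv_app_eq)
  next
    case False
    then show ?thesis using permutes[OF gk(1)] permutes[OF gk(2)] by (simp add: permutes_not_in)
  qed
qed

text \<open>The left cosets of the powers of \<open>s\<close> are connected. Contracting them yields a connected graph on
  which the group still acts transitively, so \<open>s\<close>, which fixes the trivial coset, fixes all cosets.\<close>

lemma powers_normal: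
  assumes b: "b \<in> V" and s: "s \<in> \<Gamma>" and e: "(b, s b) \<in> E" and t: "t \<in> \<Gamma>"
  shows "\<exists>i. s \<circ> t = t \<circ> s ^^ Suc i"
proof -
  \<comment> \<open>By regularity \<open>el v\<close> is the only element taking \<open>b\<close> to
    \<open>v\<close>, and \<open>\<psi> v\<close> is the left coset of the powers of
    \<open>s\<close> through \<open>el v\<close>, read as a set of vertices.\<close>
  define el where "el v = (SOME g. g \<in> \<Gamma> \<and> g b = v)" for v
  define \<psi> where "\<psi> v = range (\<lambda>i. el v ((s ^^ i) b))" for v
  have sp: "s ^^ i \<in> \<Gamma>" for i by (rule funpow_mem[OF s])
  have el: "el (g b) = g" if g: "g \<in> \<Gamma>" for g
  proof -
    have "el (g b) \<in> \<Gamma> \<and> el (g b) b = g b" unfolding el_def by (rule someI[of _ g]) (use g in simp)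
    then show ?thesis using regular[OF _ g b] by blast
  qed
  have psi: "\<psi> (g b) = range (\<lambda>i. g ((s ^^ i) b))" if "g \<in> \<Gamma>" for g
    using el[OF that] by (simp add: \<psi>_def)
  have surj: "\<exists>g\<in>\<Gamma>. v = g b" if "v \<in> V" for v using transitive[OF b that] by (auto simp: orb_def)
  have powb: "(s ^^ i) b \<in> V" for i using V_app[OF sp b] .
  obtain n where n: "n > 0" "s ^^ n = id" using funpow_eq_id[OF s] .
  have mem: "u \<in> \<psi> v \<longleftrightarrow> \<psi> u = \<psi> v" if u: "u \<in> V" and v: "v \<in> V" for u v
  proof -
    obtain g k where g: "g \<in> \<Gamma>" "u = g b" and k: "k \<in> \<Gamma>" "v = k b" using surj u v by blast
    have "u \<in> \<psi> u" using g psi[OF g(1)] by (auto intro: range_eqI[of _ _ 0])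
    moreover have "\<psi> u = \<psi> v" if uv: "u \<in> \<psi> v"
    proof -
      obtain i where "u = k ((s ^^ i) b)" using uv k psi[OF k(1)] by auto
      then have gi: "g = k \<circ> s ^^ i" using g regular[OF g(1) comp_mem[OF k(1) sp] b] by simp
      have sub: "\<psi> u \<subseteq> \<psi> v"
      proof
        fix x assume "x \<in> \<psi> u"
        then obtain j where "x = g ((s ^^ j) b)" using g psi by auto
        then have "x = k ((s ^^ (i + j)) b)" using gi by (simp add: funpow_add)
        then show "x \<in> \<psi> v" using k psi by auto
      qed
      have "\<psi> v \<subseteq> \<psi> u"
      proof
        fix x assume "x \<in> \<psi> v"
        then obtain j where x: "x = k ((s ^^ j) b)" using k psi by auto
        \<comment> \<open>\<open>n * i - i\<close> is a natural exponent for the inverse of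
          \<open>s ^^ i\<close>, since \<open>s ^^ (n * i) = id\<close>.\<close>
        have "i \<le> n * i" using n(1) by simp
        have "(s ^^ (n * i)) = id" using n(2) by (simp add: funpow_mult[symmetric] id_def[symmetric])
        then have "(s ^^ i) ((s ^^ (n * i - i)) y) = y" for y
          using \<open>i \<le> n * i\<close> by (metis comp_apply funpow_add id_apply le_add_diff_inverse)
        then have "x = g ((s ^^ (n * i - i)) ((s ^^ j) b))" using gi x by simp
        also have "\<dots> = g ((s ^^ (n * i - i + j)) b)" by (simp add: funpow_add)
        finally show "x \<in> \<psi> u" using g psi by auto
      qed
      with sub show ?thesis by blast
    qed
    ultimately show ?thesis by blast
  qed
  have sub: "\<psi> v \<subseteq> V" if v: "v \<in> V" for v
  proof -
    obtain k where "k \<in> \<Gamma>" "v = k b" using surj[OF v] by blast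
    then show ?thesis using psi V_app powb by auto
  qed
  have fib: "conn E {v \<in> V. \<psi> v = c}" for c
  proof (cases "\<exists>u\<in>V. \<psi> u = c")
    case False
    then have "{v \<in> V. \<psi> v = c} = {}" by blast
    then show ?thesis by (simp only: conn_empty)
  next
    case True
    then obtain u where u: "u \<in> V" "\<psi> u = c" by blast
    obtain k where k: "k \<in> \<Gamma>" "u = k b" using surj[OF u(1)] by blast
    have step: "(k ((s ^^ i) b), k ((s ^^ Suc i) b)) \<in> E" for i
    proof -
      have "((k \<circ> s ^^ i) b, (k \<circ> s ^^ i) (s b)) \<in> E" by (rule E_app[OF comp_mem[OF k(1) sp] e])
      then show ?thesis by (simp add: funpow_swap1)
    qed
    have "{v \<in> V. \<psi> v = c} = \<psi> u" using mem[OF _ u(1)] u(2) sub[OF u(1)] by blast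
    also have "\<dots> = (\<lambda>i. k ((s ^^ i) b)) ` {..<n}"
    proof -
      have "x \<in> (\<lambda>i. k ((s ^^ i) b)) ` {..<n}" if x: "x \<in> \<psi> u" for x
      proof -
        obtain i where "x = k ((s ^^ i) b)" using x k psi by auto
        moreover have "(s ^^ (i mod n)) b = (s ^^ i) b" using n(2) by (intro funpow_mod_eq) simp
        ultimately have "x = k ((s ^^ (i mod n)) b)" by simp
        then show ?thesis using n(1) by simp
      qed
      then show ?thesis using k psi by auto
    qed
    finally show ?thesis using conn_path[OF symE, of n "\<lambda>i. k ((s ^^ i) b)"] step by simp
  qed
  have eqv: "\<psi> (g v) = g ` \<psi> v" if g: "g \<in> \<Gamma>" and v: "v \<in> V" for g v
  proof -
    obtain k where k: "k \<in> \<Gamma>" "v = k b" using surj[OF v] by blast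
    have "\<psi> (g v) = \<psi> ((g \<circ> k) b)" using k by simp
    then show ?thesis using psi[OF comp_mem[OF g k(1)]] psi[OF k(1)] k(2) by auto
  qed
  interpret I: perm_grp "image ` \<Gamma>" by (rule perm_grp_image)
  have minor: "minor_of (\<psi> ` V) (quot \<psi> E) V E" by (rule minor_of_quot[OF E_sub fib])
  interpret I: sparse_action "image ` \<Gamma>" r h "\<psi> ` V" "quot \<psi> E"
  proof
    show "quot \<psi> E \<subseteq> \<psi> ` V \<times> \<psi> ` V" using minor by (simp add: minor_of_def)
    show "(G u, G v) \<in> quot \<psi> E" if G: "G \<in> image ` \<Gamma>" and uv: "(u, v) \<in> quot \<psi> E" for G u v
    proof -
      obtain g where g: "g \<in> \<Gamma>" "G = image g" using G by blast
      obtain x y where xy: "(x, y) \<in> E" "u = \<psi> x" "v = \<psi> y" "u \<noteq> v" using uv by (auto simp: quot_def)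
      then have "x \<in> V" "y \<in> V" using E_sub by auto
      then have "G u = \<psi> (g x)" "G v = \<psi> (g y)" using eqv g xy by auto
      moreover have "G u \<noteq> G v" using I.app_eq_iff[OF G] xy(4) by simp
      ultimately show ?thesis using quotI[OF E_app[OF g(1) xy(1)], of \<psi>] by simp
    qed
    show "G v \<in> \<psi> ` V" if "G \<in> image ` \<Gamma>" "v \<in> \<psi> ` V" for G v
      using that eqv V_app by (metis (no_types, lifting) imageE imageI)
  qed (use finV symE sparse_minor[OF sparse minor] r_nonneg large in \<open>auto simp: sym_quot irrefl_quot card_image_grp\<close>)
  have "s ` \<psi> (t b) = \<psi> (t b)"
  proof (rule I.stab_transitive[OF conn_quot[OF conn]])
    show "v \<in> orb (image ` \<Gamma>) u" if uv: "u \<in> \<psi> ` V" "v \<in> \<psi> ` V" for u v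
    proof -
      obtain x y where xy: "x \<in> V" "u = \<psi> x" "y \<in> V" "v = \<psi> y" using uv by blast
      obtain g where "g \<in> \<Gamma>" "y = g x" using transitive[OF xy(1,3)] by (auto simp: orb_def)
      then have "v = g ` u" using eqv xy by simp
      then show ?thesis using \<open>g \<in> \<Gamma>\<close> unfolding orb_def by blast
    qed
    show "image s \<in> image ` \<Gamma>" using s by blast
    show "\<psi> b \<in> \<psi> ` V" using b by blast
    show "\<psi> (t b) \<in> \<psi> ` V" using V_app[OF t b] by blast
    have "s b \<in> \<psi> b" using psi[OF id_mem] by (auto intro: range_eqI[of _ _ 1])
    then have "\<psi> (s b) = \<psi> b" using mem[OF V_app[OF s b] b] by simp
    then show "s ` \<psi> b = \<psi> b" using eqv[OF s b] by simp
  qed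
  moreover have "t b \<in> \<psi> (t b)" using mem V_app[OF t b] by blast
  ultimately have "s (t b) \<in> \<psi> (t b)" by blast
  then obtain i where "s (t b) = t ((s ^^ i) b)" using psi[OF t] by auto
  \<comment> \<open>Adding \<open>n\<close> leaves the power unchanged and turns the exponent into a
    successor, so that one factor \<open>s\<close> can be split off; the remaining power of
    \<open>s\<close> is then the commutator of \<open>s\<close> and \<open>t\<close>.\<close>
  moreover have "(s ^^ Suc (i + n - 1)) b = (s ^^ i) b"
    using n by (simp add: funpow_add del: funpow.simps)
  ultimately have "(s \<circ> t) b = (t \<circ> s ^^ Suc (i + n - 1)) b" by (simp del: funpow.simps)
  then have "s \<circ> t = t \<circ> s ^^ Suc (i + n - 1)"
    using regular comp_mem s t sp b by blast
  then show ?thesis by blast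
qed

end

section \<open>Vanishing of commutators\<close>

context transitive_action
begin

text \<open>If \<open>z = [s, t]\<close> had order \<open>n > 1\<close>, the \<open>n\<close> translates under powers of \<open>z\<close> of the two paths
  \<open>b, s b, s\<^sup>2 b, \<dots>\<close> and \<open>t b, t s b, t s\<^sup>2 b, \<dots>\<close> of length \<open>n\<close> would be pairwise adjacent branch
  sets, since \<open>s\<^sup>k t = z\<^sup>k t s\<^sup>k\<close>; but \<open>n > h\<close>.\<close>

lemma central_commutator_trivial:
  assumes b: "b \<in> V" and s: "s \<in> \<Gamma>" "(b, s b) \<in> E" and t: "t \<in> \<Gamma>" "(b, t b) \<in> E" and z: "z \<in> \<Gamma>"
    and st: "s \<circ> t = t \<circ> s \<circ> z" and zs: "z \<circ> s = s \<circ> z" and zt: "z \<circ> t = t \<circ> z"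
  shows "z = id"
proof (rule ccontr)
  assume "z \<noteq> id"
  obtain n where n: "n > 0" "n dvd card \<Gamma>" "\<And>i. (z ^^ i) b = b \<longleftrightarrow> n dvd i"
      "\<And>i j. i < n \<Longrightarrow> j < n \<Longrightarrow> (z ^^ i) b = (z ^^ j) b \<Longrightarrow> i = j"
    using period[OF z, of b] by blast
  have "n \<noteq> 1"
  proof
    assume "n = 1"
    then have "z b = id b" using n(3)[of 1] by simp
    then show False using regular[OF z id_mem b] \<open>z \<noteq> id\<close> by blast
  qed
  then have hn: "h < n" using large[OF n(2)] by simp
  have sp: "s ^^ i \<in> \<Gamma>" and zp: "z ^^ i \<in> \<Gamma>" for i by (simp_all add: funpow_mem s z)
  have zns: "z ^^ i \<circ> s = s \<circ> z ^^ i" and znt: "z ^^ i \<circ> t = t \<circ> z ^^ i" for i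
    by (simp_all add: funpow_comm zs zt)
  have znsm: "s ^^ j \<circ> z ^^ i = z ^^ i \<circ> s ^^ j" for i j by (rule funpow_comm) (simp add: zns)
  have sit: "s ^^ i \<circ> t = t \<circ> s ^^ i \<circ> z ^^ i" for i
  proof (induction i)
    case (Suc i)
    have "s ^^ Suc i \<circ> t = s \<circ> (s ^^ i \<circ> t)" by (simp add: comp_assoc)
    also have "\<dots> = (s \<circ> t) \<circ> (s ^^ i \<circ> z ^^ i)" by (simp only: Suc.IH comp_assoc)
    also have "\<dots> = t \<circ> s \<circ> (z \<circ> s ^^ i) \<circ> z ^^ i" by (simp only: st comp_assoc)
    also have "z \<circ> s ^^ i = s ^^ i \<circ> z" using znsm[of i 1] by simp
    finally show ?case by (simp add: comp_assoc)
  qed simp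
  have ts: "t \<circ> s \<noteq> s \<circ> t"
  proof
    assume "t \<circ> s = s \<circ> t"
    then have "(t \<circ> s) \<circ> id = s \<circ> t" by (simp only: comp_id)
    then have "(t \<circ> s) \<circ> id = (t \<circ> s) \<circ> z" by (rule trans[OF _ st])
    then have "id = z" by (rule iffD1[OF comp_left_cancel[OF comp_mem[OF t(1) s(1)]]])
    then show False using \<open>z \<noteq> id\<close> by simp
  qed
  define p where "p j i = (z ^^ j) ((s ^^ i) b)" for j i
  define q where "q j i = (z ^^ j) (t ((s ^^ i) b))" for j i
  define D where "D j = p j ` {..<n} \<union> q j ` {..<n}" for j
  \<comment> \<open>Moving \<open>z ^^ j \<circ> s ^^ i\<close> past \<open>t\<close> produces the
    extra factor \<open>z ^^ i\<close>, so the element determines \<open>i\<close> among the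
    exponents below \<open>n\<close>; cancelling the power of \<open>s\<close> then determines
    \<open>j\<close>.\<close>
  have pp: "i = i' \<and> j = j'" if eq: "z ^^ j \<circ> s ^^ i = z ^^ j' \<circ> s ^^ i'" and lt: "i < n" "i' < n" "j < n" "j' < n" for i i' j j'
  proof -
    have A: "(z ^^ j \<circ> s ^^ i) \<circ> t = t \<circ> (z ^^ j \<circ> s ^^ i) \<circ> z ^^ i" for i j
    proof -
      have "(z ^^ j \<circ> s ^^ i) \<circ> t = (z ^^ j \<circ> t) \<circ> s ^^ i \<circ> z ^^ i" by (simp add: comp_assoc sit)
      then show ?thesis by (simp add: znt comp_assoc)
    qed
    have "t \<circ> (z ^^ j \<circ> s ^^ i) \<circ> z ^^ i = t \<circ> (z ^^ j \<circ> s ^^ i) \<circ> z ^^ i'"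
      using A[of j i] A[of j' i'] eq by simp
    then have "z ^^ i = z ^^ i'"
      using comp_left_cancel[OF comp_mem[OF t(1) comp_mem[OF zp sp]]] by blast
    then have i: "i = i'" using n(4) lt by metis
    then have "z ^^ j = z ^^ j'" using eq comp_right_cancel[OF sp] by blast
    then show ?thesis using i n(4) lt by metis
  qed
  have pV: "p j i \<in> V" and qV: "q j i \<in> V" for j i
    by (simp_all add: p_def q_def V_app b sp zp t)
  have ppb: "i = i' \<and> j = j'" if eq: "p j i = p j' i'" and lt: "i < n" "i' < n" "j < n" "j' < n" for i i' j j'
  proof -
    have "z ^^ j \<circ> s ^^ i = z ^^ j' \<circ> s ^^ i'"
      by (rule regular[OF comp_mem[OF zp sp] comp_mem[OF zp sp] b]) (use eq in \<open>simp add: p_def\<close>)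
    then show ?thesis using pp lt by blast
  qed
  have qp: "q j i = t (p j i)" for i j
  proof -
    have "(z ^^ j \<circ> t) ((s ^^ i) b) = (t \<circ> z ^^ j) ((s ^^ i) b)" by (simp only: znt)
    then show ?thesis by (simp add: p_def q_def)
  qed
  \<comment> \<open>A common vertex would make \<open>t\<close> a product of powers of
    \<open>z\<close> and \<open>s\<close>, which all commute with \<open>s\<close>; but
    \<open>s\<close> and \<open>t\<close> do not commute.\<close>
  have pq: "p j i \<noteq> q j' i'" for i i' j j'
  proof
    assume "p j i = q j' i'"
    then have eq: "z ^^ j \<circ> s ^^ i = z ^^ j' \<circ> (t \<circ> s ^^ i')"
      by (intro regular[OF comp_mem[OF zp sp] comp_mem[OF zp comp_mem[OF t(1) sp]] b]) (simp add: p_def q_def)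
    have ss: "s ^^ k \<circ> s = s \<circ> s ^^ k" for k by (rule funpow_comm) simp
    have "z ^^ j' \<circ> ((t \<circ> s) \<circ> s ^^ i') = (z ^^ j' \<circ> (t \<circ> s ^^ i')) \<circ> s"
      by (simp add: comp_assoc ss)
    also have "\<dots> = (z ^^ j \<circ> s) \<circ> s ^^ i" by (simp add: eq[symmetric] comp_assoc ss)
    also have "\<dots> = s \<circ> (z ^^ j \<circ> s ^^ i)" by (simp add: zns comp_assoc)
    also have "\<dots> = (s \<circ> z ^^ j') \<circ> t \<circ> s ^^ i'" by (simp add: eq comp_assoc)
    also have "\<dots> = z ^^ j' \<circ> ((s \<circ> t) \<circ> s ^^ i')" by (simp add: zns[symmetric] comp_assoc)
    finally have "t \<circ> s = s \<circ> t"
      using comp_left_cancel[OF zp] comp_right_cancel[OF sp] by blast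
    then show False using ts by simp
  qed
  have pE: "(p j i, p j (Suc i)) \<in> E" for i j
  proof -
    have "((z ^^ j \<circ> s ^^ i) b, (z ^^ j \<circ> s ^^ i) (s b)) \<in> E" by (rule E_app[OF comp_mem[OF zp sp] s(2)])
    then show ?thesis by (simp add: p_def funpow_swap1)
  qed
  have qE: "(q j i, q j (Suc i)) \<in> E" for i j
    unfolding qp by (rule E_app[OF t(1) pE])
  have pqE: "(p j k, q (j + k) k) \<in> E" for j k
  proof -
    have "((z ^^ j \<circ> s ^^ k) b, (z ^^ j \<circ> s ^^ k) (t b)) \<in> E" by (rule E_app[OF comp_mem[OF zp sp] t(2)])
    moreover have "z ^^ j \<circ> s ^^ k \<circ> t = z ^^ (j + k) \<circ> (t \<circ> s ^^ k)"
    proof -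
      have "z ^^ j \<circ> s ^^ k \<circ> t = z ^^ j \<circ> (t \<circ> (s ^^ k \<circ> z ^^ k))" by (simp add: comp_assoc sit)
      also have "\<dots> = z ^^ j \<circ> ((t \<circ> z ^^ k) \<circ> s ^^ k)" by (simp only: znsm comp_assoc)
      finally show ?thesis by (simp add: znt[symmetric] comp_assoc funpow_add)
    qed
    then have "(z ^^ j \<circ> s ^^ k) (t b) = q (j + k) k" by (simp add: q_def fun_eq_iff)
    ultimately show ?thesis by (simp add: p_def)
  qed
  have D_adj: "\<exists>u\<in>D j. \<exists>v\<in>D j'. (u, v) \<in> E" if j: "j < n" "j' < n" for j j'
  proof -
    \<comment> \<open>\<open>k\<close> is the residue of \<open>j' - j\<close> modulo
      \<open>n\<close>; adding \<open>n\<close> avoids truncated subtraction. The arc of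
      \<open>pqE\<close> leaving \<open>D j\<close> at position \<open>k\<close> ends at level
      \<open>j + k\<close>, which is \<open>j'\<close> modulo \<open>n\<close>.\<close>
    define k where "k = (j' + n - j) mod n"
    have k: "k < n" using n(1) by (simp add: k_def)
    have "(j + k) mod n = j'"
      using j by (simp add: k_def mod_add_right_eq)
    then have "(z ^^ (j + k)) b = (z ^^ j') b"
      using funpow_mod_eq[of n z b "j + k"] n(3)[of n] by simp
    then have "z ^^ (j + k) = z ^^ j'" using regular[OF zp zp b] by blast
    then have "q (j + k) k = q j' k" by (simp add: q_def)
    then have "(p j k, q j' k) \<in> E" using pqE[of j k] by simp
    moreover have "p j k \<in> D j" "q j' k \<in> D j'" using k by (auto simp: D_def)
    ultimately show ?thesis by blast
  qed
  \<comment> \<open>Only \<open>Suc h\<close> of the \<open>n\<close> branch sets are kept, to meet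
    the excluded complete minor exactly; \<open>h < n\<close> makes this possible.\<close>
  define F where "F = {(i, j). i \<in> {..<Suc h} \<and> j \<in> {..<Suc h} \<and> i \<noteq> j}"
  have "minor_of {..<Suc h} F V E"
  proof (rule minor_ofI[where A = D])
    show "F \<subseteq> {..<Suc h} \<times> {..<Suc h}" by (auto simp: F_def)
    fix j assume j: "j \<in> {..<Suc h}"
    show "D j \<subseteq> V" using pV qV by (auto simp: D_def)
    show "D j \<noteq> {}" using n(1) by (auto simp: D_def)
    show "conn E (D j)"
      unfolding D_def
    proof (rule conn_Un[OF symE])
      show "conn E (p j ` {..<n})" by (rule conn_path[OF symE]) (rule pE)
      show "conn E (q j ` {..<n})" by (rule conn_path[OF symE]) (rule qE)
      show "p j 0 \<in> p j ` {..<n}" "q j 0 \<in> q j ` {..<n}" using n(1) by auto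
      have "((z ^^ j) b, (z ^^ j) (t b)) \<in> E" by (rule E_app[OF zp t(2)])
      then show "(p j 0, q j 0) \<in> E" by (simp add: p_def q_def)
    qed
  next
    fix j j' x assume j: "j \<in> {..<Suc h}" "j' \<in> {..<Suc h}" and x: "x \<in> D j" "x \<in> D j'"
    have lt: "j < n" "j' < n" using j hn by auto
    have D: "\<exists>i<n. x = p k i \<or> x = q k i" if "x \<in> D k" for k using that by (auto simp: D_def)
    obtain i i' where i: "i < n" "x = p j i \<or> x = q j i" "i' < n" "x = p j' i' \<or> x = q j' i'"
      using D[OF x(1)] D[OF x(2)] by blast
    have "p j i = p j' i'"
      using i(2,4) pq[of j i j' i'] pq[of j' i' j i] app_eq_iff[OF t(1)] by (auto simp: qp)
    then show "j = j'" using ppb lt i by blast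
  next
    fix i j assume "(i, j) \<in> F"
    then show "\<exists>u\<in>D i. \<exists>v\<in>D j. (u, v) \<in> E" using hn by (intro D_adj) (auto simp: F_def)
  qed
  moreover have "sym F" "irrefl F" by (auto simp: F_def sym_def irrefl_def)
  ultimately show False using sparseD(2)[OF sparse, of "{..<Suc h}" F] unfolding F_def by simp
qed

text \<open>Both cyclic subgroups are normal, so the commutator of \<open>s\<close> and
  \<open>t\<close> lies in both. It appears as \<open>z\<close>, a power of \<open>s\<close>, with
  inverse \<open>w\<close>, a power of \<open>t\<close>; hence it commutes with \<open>s\<close> and
  with \<open>t\<close>, as \<open>central_commutator_trivial\<close> requires.\<close>

lemma neighbours_commute:
  assumes b: "b \<in> V" and s: "s \<in> \<Gamma>" "(b, s b) \<in> E" and t: "t \<in> \<Gamma>" "(b, t b) \<in> E"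
  shows "s \<circ> t = t \<circ> s"
proof -
  obtain k where k: "s \<circ> t = t \<circ> s ^^ Suc k" using powers_normal[OF b s t(1)] by blast
  obtain l where l: "t \<circ> s = s \<circ> t ^^ Suc l" using powers_normal[OF b t s(1)] by blast
  define z where "z = s ^^ k"
  define w where "w = t ^^ l"
  have z: "z \<in> \<Gamma>" and w: "w \<in> \<Gamma>" unfolding z_def w_def by (simp_all add: funpow_mem s t)
  have st: "s \<circ> t = t \<circ> s \<circ> z" using k by (simp add: z_def comp_assoc)
  have ts: "t \<circ> s = s \<circ> t \<circ> w" using l by (simp add: w_def comp_assoc)
  have zs: "z \<circ> s = s \<circ> z" unfolding z_def by (rule funpow_comm) simp
  have wt: "w \<circ> t = t \<circ> w" unfolding w_def by (rule funpow_comm) simp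
  have "(t \<circ> s) \<circ> (z \<circ> w) = (t \<circ> s \<circ> z) \<circ> w" by (simp only: comp_assoc)
  also have "\<dots> = (t \<circ> s) \<circ> id" by (simp only: st[symmetric] ts[symmetric] comp_id)
  finally have "(t \<circ> s) \<circ> (z \<circ> w) = (t \<circ> s) \<circ> id" .
  then have zw: "z \<circ> w = id" using comp_left_cancel[OF comp_mem[OF t(1) s(1)]] by blast
  then have "z \<circ> (w \<circ> z) = z \<circ> id" by (simp add: comp_assoc[symmetric])
  then have wz: "w \<circ> z = id" using comp_left_cancel[OF z] by blast
  have "w \<circ> (z \<circ> t) = w \<circ> (t \<circ> z)"
  proof -
    have "w \<circ> (z \<circ> t) = t" using wz by (simp add: comp_assoc[symmetric])
    moreover have "w \<circ> (t \<circ> z) = t \<circ> (w \<circ> z)" using wt by (simp add: comp_assoc[symmetric])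
    ultimately show ?thesis using wz by simp
  qed
  then have zt: "z \<circ> t = t \<circ> z" using comp_left_cancel[OF w] by blast
  have "z = id" by (rule central_commutator_trivial[OF b s t z st zs zt])
  then show ?thesis using st by simp
qed

text \<open>By connectedness the connection set at \<open>b\<close> generates
  \<open>\<Gamma>\<close>, so an element commuting with that set is central. This is used twice:
  first for members of the connection set, then for an arbitrary element.\<close>

lemma commutative:
  assumes "b \<in> V" "g \<in> \<Gamma>" "k \<in> \<Gamma>"
  shows "g \<circ> k = k \<circ> g"
proof -
  have ext: "x \<circ> y = y \<circ> x"
    if x: "x \<in> \<Gamma>" and nb: "\<And>s. s \<in> \<Gamma> \<Longrightarrow> (b, s b) \<in> E \<Longrightarrow> x \<circ> s = s \<circ> x" and y: "y \<in> \<Gamma>" for x y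
  proof -
    have "y b \<in> {v. \<forall>g\<in>\<Gamma>. g b = v \<longrightarrow> x \<circ> g = g \<circ> x}"
    proof (rule conn_closed[OF conn assms(1) V_app[OF y assms(1)]])
      show "b \<in> {v. \<forall>g\<in>\<Gamma>. g b = v \<longrightarrow> x \<circ> g = g \<circ> x}"
        using regular[OF _ id_mem assms(1)] by fastforce
      fix u v assume uv: "(u, v) \<in> E" "u \<in> V" "v \<in> V" "u \<in> {v. \<forall>g\<in>\<Gamma>. g b = v \<longrightarrow> x \<circ> g = g \<circ> x}"
      obtain f where f: "f \<in> \<Gamma>" "u = f b" using transitive[OF assms(1) uv(2)] by (auto simp: orb_def)
      have fx: "x \<circ> f = f \<circ> x" using uv(4) f by blast
      show "v \<in> {v. \<forall>g\<in>\<Gamma>. g b = v \<longrightarrow> x \<circ> g = g \<circ> x}"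
      proof (intro CollectI ballI impI)
        fix g assume g: "g \<in> \<Gamma>" "g b = v"
        define s where "s = pinv f \<circ> g"
        have s: "s \<in> \<Gamma>" unfolding s_def using f g by (simp add: comp_mem inv_mem)
        have gs: "g = f \<circ> s" unfolding s_def using f by (simp add: fun_eq_iff)
        have "(f b, f (s b)) \<in> E" using uv(1) f g gs by simp
        then have "(b, s b) \<in> E" using E_app_iff[OF f(1)] by simp
        then have xs: "x \<circ> s = s \<circ> x" by (rule nb[OF s])
        have "x \<circ> g = (x \<circ> f) \<circ> s" by (simp add: gs comp_assoc)
        also have "\<dots> = f \<circ> (x \<circ> s)" by (simp add: fx comp_assoc)
        also have "\<dots> = g \<circ> x" by (simp add: xs gs comp_assoc)
        finally show "x \<circ> g = g \<circ> x" .
      qed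
    qed
    then show ?thesis using y by blast
  qed
  have "s \<circ> y = y \<circ> s" if "s \<in> \<Gamma>" "(b, s b) \<in> E" "y \<in> \<Gamma>" for s y
    using ext[of s y] neighbours_commute[OF assms(1)] that by blast
  then show ?thesis using ext[OF assms(2) _ assms(3)] assms(2) by metis
qed

end

section \<open>Stabilisers of components\<close>

text \<open>Unlike \<open>restrict\<close>, the result is the identity off \<open>X\<close>, so a
  permutation preserving \<open>X\<close> again yields a permutation of the whole type.\<close>

definition restr :: "'a set \<Rightarrow> ('a \<Rightarrow> 'a) \<Rightarrow> 'a \<Rightarrow> 'a" where
  "restr X g x = (if x \<in> X then g x else x)"

lemma (in perm_grp) perm_grp_setstab: "perm_grp {g \<in> \<Gamma>. g ` K = K}"
proof (rule subgrpI)
  show "g \<circ> k \<in> {g \<in> \<Gamma>. g ` K = K}" if "g \<in> {g \<in> \<Gamma>. g ` K = K}" "k \<in> {g \<in> \<Gamma>. g ` K = K}" for g k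
    using that comp_mem[of g k] image_comp[of g k K] by simp
  show "pinv g \<in> {g \<in> \<Gamma>. g ` K = K}" if "g \<in> {g \<in> \<Gamma>. g ` K = K}" for g
  proof -
    have g: "g \<in> \<Gamma>" "g ` K = K" using that by auto
    have "pinv g ` (g ` K) = K" using g(1) by (simp add: image_image)
    then show ?thesis using g inv_mem by simp
  qed
qed (use id_mem in auto)

context sparse_action
begin

text \<open>The restrictions form the quotient by the kernel of the action on \<open>V\<close>. The
  order of the quotient divides \<open>card \<Gamma>\<close>, which preserves the divisor
  condition.\<close>

lemma restr_action:
  assumes "conn E V" "\<And>u v. u \<in> V \<Longrightarrow> v \<in> V \<Longrightarrow> v \<in> orb \<Gamma> u"
  shows "transitive_action (restr V ` \<Gamma>) r h V E"
proof -
  let ?S = "{g \<in> \<Gamma>. \<forall>x\<in>V. g x = x}"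
  have perm: "restr V g permutes V" if g: "g \<in> \<Gamma>" for g
  proof (rule inj_imp_permutes[OF _ finV])
    show "inj_on (restr V g) V" using g by (auto simp: restr_def inj_on_def)
  qed (use g V_app in \<open>auto simp: restr_def\<close>)
  have comp: "restr V g \<circ> restr V k = restr V (g \<circ> k)" if "k \<in> \<Gamma>" for g k
    using that V_app by (auto simp: restr_def fun_eq_iff)
  have inv: "pinv (restr V g) = restr V (pinv g)" if g: "g \<in> \<Gamma>" for g
    by (rule inv_unique_comp) (use g V_app[OF g] V_app[OF inv_mem[OF g]] in \<open>auto simp: restr_def fun_eq_iff\<close>)
  have S: "perm_grp ?S"
    by (rule subgrpI) (auto simp: id_mem comp_mem inv_mem inv_app_eq)
  have "card \<Gamma> = card (restr V ` \<Gamma>) * card ?S"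
  proof (rule card_image_cosets[OF S])
    fix g k assume gk: "g \<in> \<Gamma>" "k \<in> \<Gamma>"
    have "restr V g = restr V k \<longleftrightarrow> (\<forall>x\<in>V. g x = k x)"
      by (auto simp: restr_def fun_eq_iff)
    also have "\<dots> \<longleftrightarrow> pinv g \<circ> k \<in> ?S" using gk by (auto simp: comp_mem inv_mem inv_app_eq)
    finally show "restr V g = restr V k \<longleftrightarrow> pinv g \<circ> k \<in> ?S" .
  qed auto
  then have dvd: "card (restr V ` \<Gamma>) dvd card \<Gamma>" by simp
  show ?thesis
  proof
    show "finite (restr V ` \<Gamma>)" using fin by simp
    show "id \<in> restr V ` \<Gamma>" by (rule image_eqI[OF _ id_mem]) (simp add: restr_def fun_eq_iff)
    show "bij G" if "G \<in> restr V ` \<Gamma>" for G using that perm permutes_bij by blast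
    show "G permutes V" if "G \<in> restr V ` \<Gamma>" for G using that perm by blast
    show "G \<circ> H \<in> restr V ` \<Gamma>" if GH: "G \<in> restr V ` \<Gamma>" "H \<in> restr V ` \<Gamma>" for G H
    proof -
      obtain g k where "g \<in> \<Gamma>" "k \<in> \<Gamma>" "G = restr V g" "H = restr V k" using GH by blast
      then show ?thesis using comp comp_mem by auto
    qed
    show "pinv G \<in> restr V ` \<Gamma>" if "G \<in> restr V ` \<Gamma>" for G
      using that inv inv_mem by auto
    show "(G u, G v) \<in> E" if "G \<in> restr V ` \<Gamma>" "(u, v) \<in> E" for G u v
    proof -
      have "u \<in> V" "v \<in> V" using that(2) E_sub by auto
      then show ?thesis using that E_app by (auto simp: restr_def)
    qed
    show "G v \<in> V" if "G \<in> restr V ` \<Gamma>" "v \<in> V" for G v using that V_app by (auto simp: restr_def)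
    show "r < real d \<and> h < d \<and> 2 < d" if "d dvd card (restr V ` \<Gamma>)" "d \<noteq> 1" for d
      using large[of d] that dvd dvd_trans by blast
    show "v \<in> orb (restr V ` \<Gamma>) u" if uv: "u \<in> V" "v \<in> V" for u v
    proof -
      obtain g where "g \<in> \<Gamma>" "v = g u" using assms(2)[OF uv] by (auto simp: orb_def)
      then have "v = restr V g u" using uv by (simp add: restr_def)
      then show ?thesis using \<open>g \<in> \<Gamma>\<close> unfolding orb_def by blast
    qed
  qed (use finV E_sub symE irreflE sparse r_nonneg assms(1) in auto)
qed

text \<open>Elements may move points outside \<open>V\<close> here. The lemma serves for an orbit
  inside a larger graph, where commutation can be expected on the orbit only.\<close>

lemma commute_on:
  assumes "conn E V" "\<And>u v. u \<in> V \<Longrightarrow> v \<in> V \<Longrightarrow> v \<in> orb \<Gamma> u" "g \<in> \<Gamma>" "k \<in> \<Gamma>" "v \<in> V"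
  shows "g (k v) = k (g v)"
proof -
  interpret R: transitive_action "restr V ` \<Gamma>" r h V E by (rule restr_action[OF assms(1,2)])
  have "restr V g \<circ> restr V k = restr V k \<circ> restr V g"
    using R.commutative[OF assms(5)] assms(3,4) by blast
  then have "restr V g (restr V k v) = restr V k (restr V g v)" by (metis comp_apply)
  then show ?thesis using assms V_app by (simp add: restr_def)
qed

text \<open>Contract \<open>K\<close> equivariantly onto an orbit \<open>C\<close> of its setwise stabiliser \<open>M\<close>; some \<open>c\<^sub>0 \<in> C\<close> is
  then adjacent to \<open>w\<close>. If \<open>M\<close> were larger than \<open>N\<close>, some edge of the contracted graph would join
  \<open>c\<^sub>0\<close> to \<open>t c\<^sub>0\<close> with \<open>t \<notin> N\<close>. The \<open>N\<close>-translates of the path \<open>c\<^sub>0, t c\<^sub>0, t\<^sup>2 c\<^sub>0, \<dots>\<close> and the points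
  \<open>w, t w, t\<^sup>2 w, \<dots>\<close>, fixed by \<open>N\<close>, would then form a complete bipartite minor with both sides
  larger than \<open>r\<close>.\<close>

lemma component_stabiliser:
  assumes N: "perm_grp N" "N \<subseteq> \<Gamma>" and normal: "\<And>g n. g \<in> \<Gamma> \<Longrightarrow> n \<in> N \<Longrightarrow> pinv g \<circ> n \<circ> g \<in> N"
    and W: "W = {v \<in> V. \<forall>n\<in>N. n v = v}" and free: "\<And>g w. g \<in> \<Gamma> \<Longrightarrow> w \<in> W \<Longrightarrow> g w = w \<Longrightarrow> g \<in> N"
    and K: "K \<subseteq> V - W" "conn E K" and NK: "\<And>n. n \<in> N \<Longrightarrow> n ` K = K"
    and xw: "(x, w) \<in> E" "x \<in> K" "w \<in> W" and g: "g \<in> \<Gamma>" "g ` K = K"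
  shows "g \<in> N"
proof (rule ccontr)
  assume gN: "g \<notin> N"
  interpret N: perm_grp N by fact
  define M where "M = {g \<in> \<Gamma>. g ` K = K}"
  interpret MG: perm_grp M unfolding M_def by (rule perm_grp_setstab)
  have MS: "M \<subseteq> \<Gamma>" by (auto simp: M_def)
  have NM: "N \<subseteq> M" using N(2) NK by (auto simp: M_def)
  have gM: "g \<in> M" using g by (simp add: M_def)
  have KV: "K \<subseteq> V" using K by blast
  have M_K: "m v \<in> K" if "m \<in> M" "v \<in> K" for m v using that by (auto simp: M_def)
  have W_app: "m v \<in> W" if "m \<in> \<Gamma>" "v \<in> W" for m v
  proof -
    have "n (m v) = m v" if n: "n \<in> N" for n
    proof -
      have "(pinv m \<circ> n \<circ> m) v = v" using normal[OF \<open>m \<in> \<Gamma>\<close> n] \<open>v \<in> W\<close> W by blast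
      then show ?thesis using \<open>m \<in> \<Gamma>\<close> by (simp add: inv_app_eq)
    qed
    then show ?thesis using that V_app by (auto simp: W)
  qed
  have NW: "n v = v" if "n \<in> N" "v \<in> W" for n v using that W by blast
  interpret MV: sparse_action M r h V E by (rule subgrp_action[OF MG.perm_grp_axioms MS])
  have sub_action: "sparse_action M r h X (E \<inter> X \<times> X)" if "X \<subseteq> V" "\<And>m v. m \<in> M \<Longrightarrow> v \<in> X \<Longrightarrow> m v \<in> X" for X
  proof (rule MV.minor_action)
    show "minor_of X (E \<inter> X \<times> X) V E" by (rule minor_of_subgraph) (use that in auto)
    show "finite X" using that finV finite_subset by blast
    show "sym (E \<inter> X \<times> X)" using symE by (auto simp: sym_def)
    show "irrefl (E \<inter> X \<times> X)" using irreflE by (auto simp: irrefl_def)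
  qed (use that MV.E_app in auto)
  let ?EK = "E \<inter> K \<times> K"
  interpret MK: sparse_action M r h K ?EK by (rule sub_action[OF KV]) (rule M_K)
  have connK: "conn ?EK K" by (rule conn_mono[OF K(2)]) simp
  obtain c where c: "c \<in> K" "\<And>v. v \<in> K \<Longrightarrow> card (orb M c) \<le> card (orb M v)"
    using ex_has_least_nat[of "\<lambda>v. v \<in> K" x "\<lambda>v. card (orb M v)"] xw(2) by blast
  obtain \<psi> where ret: "MK.retract \<psi>" and im: "\<psi> ` K = orb M c"
    using MK.retraction_on_orbit[OF connK c] by blast
  have eqv: "\<psi> (m v) = m (\<psi> v)" if "m \<in> M" "v \<in> K" for m v using ret that by (auto simp: MK.retract_def)
  have idem: "\<psi> (\<psi> v) = \<psi> v" if "v \<in> K" for v using ret that by (auto simp: MK.retract_def)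
  have psiK: "\<psi> v \<in> K" if "v \<in> K" for v using ret that by (auto simp: MK.retract_def)
  have fib: "conn ?EK {v \<in> K. \<psi> v = d}" for d using ret by (auto simp: MK.retract_def)
  define c0 where "c0 = \<psi> x"
  have c0: "c0 \<in> K" "c0 \<in> orb M c" using psiK im xw(2) by (auto simp: c0_def)
  have C: "\<psi> ` K = orb M c0" using im MG.orb_eq[OF c0(2)] by simp
  interpret MC: sparse_action M r h "\<psi> ` K" "quot \<psi> ?EK" by (rule MK.retract_action[OF ret])
  have connC: "conn (quot \<psi> ?EK) (\<psi> ` K)" by (rule conn_quot[OF connK])
  have transC: "v \<in> orb M u" if "u \<in> \<psi> ` K" "v \<in> \<psi> ` K" for u v
    using that MG.orb_eq unfolding C by blast
  have stabC: "m v = v" if "m \<in> M" "u \<in> \<psi> ` K" "m u = u" "v \<in> \<psi> ` K" for m u v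
    using MC.stab_transitive[OF connC, of m u v] transC that by blast
  have c0N: "\<exists>n\<in>N. n c0 \<noteq> c0" using c0(1) K W by blast

  \<comment> \<open>The orbit \<open>D\<close> of \<open>w\<close> joins the contracted graph as
    single points. Along the edge between \<open>c0\<close> and \<open>w\<close> one stabiliser
    contains the other. That of \<open>w\<close> is not inside that of \<open>c0\<close>, since
    \<open>N\<close> fixes \<open>w\<close> but moves \<open>c0\<close>; so \<open>m\<close> fixes
    \<open>w\<close>, and \<open>free\<close> puts it into \<open>N\<close>.\<close>
  have stab_c0: "m \<in> N" if m: "m \<in> M" "m c0 = c0" for m
  proof -
    define D where "D = orb M w"
    have DW: "D \<subseteq> W" using W_app xw(3) MS by (auto simp: D_def orb_def)
    have dis: "K \<inter> D = {}" using DW K by blast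
    let ?V = "K \<union> D"
    let ?E = "E \<inter> ?V \<times> ?V"
    have V: "?V \<subseteq> V" using KV DW W by blast
    have M_V: "m v \<in> ?V" if "m \<in> M" "v \<in> ?V" for m v
      using that M_K MG.orb_app by (auto simp: D_def)
    interpret MD: sparse_action M r h ?V ?E by (rule sub_action[OF V]) (rule M_V)
    define \<phi> where "\<phi> v = (if v \<in> K then \<psi> v else v)" for v
    have "MD.retract \<phi>"
      unfolding MD.retract_def
    proof (intro conjI ballI allI)
      show "\<phi> ` ?V \<subseteq> ?V" using psiK by (auto simp: \<phi>_def)
      show "\<phi> (\<phi> v) = \<phi> v" if "v \<in> ?V" for v using that psiK idem by (auto simp: \<phi>_def)
      show "\<phi> (m v) = m (\<phi> v)" if "m \<in> M" "v \<in> ?V" for m v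
      proof (cases "v \<in> K")
        case True then show ?thesis using that M_K eqv by (simp add: \<phi>_def)
      next
        case False
        then have "m v \<in> D" using that MG.orb_app by (simp add: D_def)
        then show ?thesis using False dis by (auto simp: \<phi>_def)
      qed
      fix d
      show "conn ?E {v \<in> ?V. \<phi> v = d}"
      proof (cases "d \<in> D")
        case True
        then have "{v \<in> ?V. \<phi> v = d} = {d}" using dis psiK by (auto simp: \<phi>_def)
        then show ?thesis by (simp only: conn_singleton)
      next
        case False
        then have "{v \<in> ?V. \<phi> v = d} = {v \<in> K. \<psi> v = d}" by (auto simp: \<phi>_def)
        then show ?thesis using conn_mono[OF fib[of d], of ?E] by auto
      qed
    qed
    then interpret MQ: sparse_action M r h "\<phi> ` ?V" "quot \<phi> ?E" by (rule MD.retract_action)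
    have wD: "w \<in> D" unfolding D_def by (rule MG.orb_self)
    then have wK: "w \<notin> K" using dis by blast
    have "(\<phi> x, \<phi> w) \<in> quot \<phi> ?E"
    proof (rule quotI)
      show "(x, w) \<in> ?E" using xw wD by auto
      show "\<phi> x \<noteq> \<phi> w" using wK psiK xw(2) by (auto simp: \<phi>_def)
    qed
    then have edge: "(c0, w) \<in> quot \<phi> ?E" using wK xw(2) by (simp add: \<phi>_def c0_def)
    have not_le: "\<not> stab M w \<subseteq> stab M c0"
      using c0N NM NW xw(3) unfolding stab_def by blast
    have "stab M c0 \<subseteq> stab M w"
    proof (cases "card (orb M w) \<le> card (orb M c0)")
      case True
      then show ?thesis by (rule MQ.stab_mono[OF edge])
    next
      case False
      have "stab M w \<subseteq> stab M c0"
        by (rule MQ.stab_mono) (use edge MQ.symE False in \<open>auto dest: symD\<close>)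
      then show ?thesis using not_le by blast
    qed
    then have "m w = w" using m by (auto simp: stab_def)
    then show ?thesis using free m MS xw(3) by blast
  qed

  obtain t where t: "t \<in> M" "t \<notin> N" "(c0, t c0) \<in> quot \<psi> ?EK"
  proof -
    have "\<exists>t. t \<in> M \<and> t \<notin> N \<and> (c0, t c0) \<in> quot \<psi> ?EK"
    proof (rule ccontr)
      \<comment> \<open>Then the orbit of \<open>c0\<close> under \<open>N\<close> is closed under
        adjacency in the connected contracted graph and contains \<open>g c0\<close>, so that
        \<open>stab_c0\<close> puts \<open>g\<close> into \<open>N\<close>.\<close>
      assume no: "\<not> ?thesis"
      have "g c0 \<in> orb N c0"
      proof (rule conn_closed[OF connC])
        show "c0 \<in> \<psi> ` K" "g c0 \<in> \<psi> ` K" unfolding C using MG.orb_self gM by (auto simp: orb_def)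
        show "c0 \<in> orb N c0" by (rule N.orb_self)
        fix u v assume uv: "(u, v) \<in> quot \<psi> ?EK" "v \<in> \<psi> ` K" "u \<in> orb N c0"
        obtain n where n: "n \<in> N" "u = n c0" using uv(3) by (auto simp: orb_def)
        obtain m where m: "m \<in> M" "v = m c0" using uv(2) unfolding C by (auto simp: orb_def)
        have nM: "n \<in> M" using n NM by blast
        let ?t = "pinv n \<circ> m"
        have "(pinv n u, pinv n v) \<in> quot \<psi> ?EK" by (rule MC.E_app[OF MG.inv_mem[OF nM] uv(1)])
        then have "(c0, ?t c0) \<in> quot \<psi> ?EK" using n m nM by simp
        moreover have "?t \<in> M" using nM m MG.comp_mem MG.inv_mem by blast
        ultimately have tN: "?t \<in> N" using no by blast
        have "v = n (?t c0)" using m nM by simp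
        moreover have "?t c0 \<in> orb N c0" using tN unfolding orb_def by blast
        ultimately show "v \<in> orb N c0" using N.orb_app[OF n(1)] by simp
      qed
      then obtain n where n: "n \<in> N" "g c0 = n c0" by (auto simp: orb_def)
      then have nM: "n \<in> M" using NM by blast
      have "(pinv n \<circ> g) c0 = c0" using n nM by simp
      then have "pinv n \<circ> g \<in> N" using stab_c0[OF MG.comp_mem[OF MG.inv_mem[OF nM] gM]] by blast
      then have "n \<circ> (pinv n \<circ> g) \<in> N" by (rule N.comp_mem[OF n(1)])
      moreover have "n \<circ> (pinv n \<circ> g) = g" using nM by (simp add: fun_eq_iff)
      ultimately show False using gN by simp
    qed
    then show thesis using that by blast
  qed
  have tG: "t \<in> \<Gamma>" using t MS by blast
  have tp: "t ^^ i \<in> M" for i by (rule MG.funpow_mem[OF t(1)])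
  obtain n where n: "n > 0" "n dvd card \<Gamma>" "\<And>i. (t ^^ i) w = w \<longleftrightarrow> n dvd i"
      "\<And>i j. i < n \<Longrightarrow> j < n \<Longrightarrow> (t ^^ i) w = (t ^^ j) w \<Longrightarrow> i = j"
    using period[OF tG, of w] by blast
  have "n \<noteq> 1" using n(3)[of 1] free[OF tG xw(3)] t(2) by auto
  then have rn: "r < real n" using large[OF n(2)] by blast
  define Q where "Q = orb N c0"
  define R where "R = (\<lambda>i. (t ^^ i) w) ` {..<n}"
  have "card Q dvd card N" using N.orbit_stabilizer[of c0] by (simp add: Q_def)
  then have "card Q dvd card \<Gamma>" using card_subgrp_dvd[OF N] dvd_trans by blast
  moreover have "card Q \<noteq> 1"
  proof
    assume "card Q = 1"
    then have "Q = {c0}" using N.orb_self[of c0] unfolding Q_def by (metis card_1_singletonE singletonD)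
    then show False using c0N by (auto simp: Q_def orb_def)
  qed
  ultimately have rk: "r < real (card Q)" using large by blast
  have card_R: "card R = n" unfolding R_def using n(4) by (simp add: card_image inj_on_def)
  have twW: "(t ^^ i) w \<in> W" for i using W_app[of "t ^^ i" w] tp MS xw(3) by blast
  have QK: "Q \<subseteq> K" using NM M_K c0(1) by (auto simp: Q_def orb_def)
  have RW: "R \<subseteq> W" using twW by (auto simp: R_def)
  have QR: "Q \<inter> R = {}" using QK RW K by blast
  define \<nu> where "\<nu> q = (SOME n. n \<in> N \<and> n c0 = q)" for q
  have \<nu>: "\<nu> q \<in> N" "\<nu> q c0 = q" if q: "q \<in> Q" for q
  proof -
    obtain k where "k \<in> N \<and> k c0 = q" using q by (auto simp: Q_def orb_def)
    then have "\<nu> q \<in> N \<and> \<nu> q c0 = q" unfolding \<nu>_def by (rule someI[of _ k])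
    then show "\<nu> q \<in> N" "\<nu> q c0 = q" by auto
  qed
  have \<nu>M: "\<nu> q \<in> M" if "q \<in> Q" for q using \<nu>(1)[OF that] NM by blast
  define P where "P q = (\<lambda>i. \<nu> q ((t ^^ i) c0)) ` {..<n}" for q
  define A where "A j = (if j \<in> Q then (\<Union>c\<in>P j. {v \<in> K. \<psi> v = c}) else {j})" for j
  define F where "F = Q \<times> R \<union> R \<times> Q"
  have adj: "\<exists>u\<in>A q. (u, y) \<in> E" if q: "q \<in> Q" and y: "y \<in> R" for q y
  proof -
    obtain i where i: "i < n" "y = (t ^^ i) w" using y by (auto simp: R_def)
    let ?m = "\<nu> q \<circ> t ^^ i"
    have m: "?m \<in> M" using \<nu>M[OF q] tp MG.comp_mem by blast
    have "(?m x, ?m w) \<in> E" by (rule MV.E_app[OF m xw(1)])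
    moreover have "?m w = y" using NW[OF \<nu>(1)[OF q] twW] i by simp
    moreover have "\<psi> (?m x) = \<nu> q ((t ^^ i) c0)" using eqv[OF m xw(2)] by (simp add: c0_def)
    then have "?m x \<in> A q" using M_K[OF m xw(2)] q i by (auto simp: A_def P_def)
    ultimately show ?thesis by auto
  qed
  have "minor_of (Q \<union> R) F V E"
  proof (rule minor_ofI[where A = A])
    show "F \<subseteq> (Q \<union> R) \<times> (Q \<union> R)" by (auto simp: F_def)
    fix j assume j: "j \<in> Q \<union> R"
    show "A j \<subseteq> V" using j KV RW W by (auto simp: A_def)
    show "A j \<noteq> {}"
    proof (cases "j \<in> Q")
      case True
      have "(t ^^ 0) w \<in> R" unfolding R_def using n(1) by (intro imageI) simp
      then show ?thesis using adj[OF True] by blast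
    qed (simp add: A_def)
    show "conn E (A j)"
    proof (cases "j \<in> Q")
      case False then show ?thesis by (simp add: A_def conn_singleton)
    next
      case True
      have "conn E (\<Union>c\<in>P j. {v \<in> K. \<psi> v = c})"
      proof (rule conn_UN)
        show "conn (quot \<psi> ?EK) (P j)"
          unfolding P_def
        proof (rule conn_path[OF MC.symE])
          fix i
          have "((\<nu> j \<circ> t ^^ i) c0, (\<nu> j \<circ> t ^^ i) (t c0)) \<in> quot \<psi> ?EK"
            by (rule MC.E_app[OF MG.comp_mem[OF \<nu>M[OF True] tp] t(3)])
          then show "(\<nu> j ((t ^^ i) c0), \<nu> j ((t ^^ Suc i) c0)) \<in> quot \<psi> ?EK"
            by (simp add: funpow_swap1)
        qed
        show "conn E {v \<in> K. \<psi> v = c}" for c by (rule conn_mono[OF fib]) auto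
        show "\<exists>u\<in>{v \<in> K. \<psi> v = i}. \<exists>v\<in>{v \<in> K. \<psi> v = j}. (u, v) \<in> E" if ij: "(i, j) \<in> quot \<psi> ?EK" for i j
        proof -
          obtain u v where "(u, v) \<in> E" "u \<in> K" "v \<in> K" "i = \<psi> u" "j = \<psi> v" using ij by (auto simp: quot_def)
          then show ?thesis by auto
        qed
      qed
      then show ?thesis using True by (simp add: A_def)
    qed
  next
    \<comment> \<open>If two branch sets meet, then \<open>\<nu> q \<circ> t ^^ i\<close> and
      \<open>\<nu> q' \<circ> t ^^ j\<close> agree at \<open>c0\<close>. They differ by an element
      of \<open>N\<close>, hence also agree at \<open>w\<close>, which forces \<open>i = j\<close>.
      As a fixed point on the contracted graph means fixing all of it, \<open>\<nu> q\<close> and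
      \<open>\<nu> q'\<close> agree at \<open>c0\<close>.\<close>
    have same: "q = q'" if q: "q \<in> Q" "q' \<in> Q" and v: "v \<in> A q" "v \<in> A q'" for q q' v
    proof -
      obtain i j where ij: "i < n" "j < n" "\<psi> v = \<nu> q ((t ^^ i) c0)" "\<psi> v = \<nu> q' ((t ^^ j) c0)"
        using q v by (auto simp: A_def P_def)
      let ?m = "\<nu> q \<circ> t ^^ i" and ?m' = "\<nu> q' \<circ> t ^^ j"
      have m: "?m \<in> M" "?m' \<in> M" using \<nu>M q tp MG.comp_mem by blast+
      have "(pinv ?m' \<circ> ?m) c0 = c0" using ij m MG.inv_app_eq[OF m(2)] by simp
      then have "pinv ?m' \<circ> ?m \<in> N"
        using stab_c0[OF MG.comp_mem[OF MG.inv_mem[OF m(2)] m(1)]] by blast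
      then have "(pinv ?m' \<circ> ?m) w = w" using NW xw(3) by blast
      then have "?m w = ?m' w" using MG.inv_app_eq[OF m(2)] by simp
      then have "(t ^^ i) w = (t ^^ j) w" using NW[OF \<nu>(1) twW] q by simp
      then have eq: "i = j" using n(4) ij by blast
      have tC: "(t ^^ i) c0 \<in> \<psi> ` K" unfolding C orb_def using tp by blast
      have "(pinv (\<nu> q') \<circ> \<nu> q) ((t ^^ i) c0) = (t ^^ i) c0"
        using ij eq MG.inv_app_eq[OF \<nu>M[OF q(2)]] by simp
      moreover have "c0 \<in> \<psi> ` K" unfolding C by (rule MG.orb_self)
      ultimately have "(pinv (\<nu> q') \<circ> \<nu> q) c0 = c0"
        using stabC[OF MG.comp_mem[OF MG.inv_mem[OF \<nu>M[OF q(2)]] \<nu>M[OF q(1)]] tC] by blast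
      then show "q = q'" using MG.inv_app_eq[OF \<nu>M[OF q(2)]] \<nu>(2) q by simp
    qed
    have AK: "A q \<subseteq> K" if "q \<in> Q" for q using that by (auto simp: A_def)
    have AR: "A q = {q}" "q \<notin> K" if "q \<in> R" for q using that QR RW K by (auto simp: A_def)
    fix i j v assume ij: "i \<in> Q \<union> R" "j \<in> Q \<union> R" "v \<in> A i" "v \<in> A j"
    then show "i = j" using same AK AR by (metis Un_iff singletonD subsetD)
  next
    fix i j assume "(i, j) \<in> F"
    then consider "i \<in> Q" "j \<in> R" | "i \<in> R" "j \<in> Q" by (auto simp: F_def)
    then show "\<exists>u\<in>A i. \<exists>v\<in>A j. (u, v) \<in> E"
    proof cases
      case 1
      then have "j \<notin> Q" using QR by blast
      then show ?thesis using adj[OF 1] by (simp add: A_def)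
    next
      case 2
      then have "i \<notin> Q" using QR by blast
      then show ?thesis using adj[OF 2(2,1)] symE by (auto simp: A_def[of i] dest: symD)
    qed
  qed
  moreover have fQ: "finite Q" "finite R" by (simp_all add: Q_def R_def N.finite_orb)
  moreover have "sym F" by (auto simp: F_def sym_def)
  moreover have "irrefl F" using QR by (auto simp: F_def irrefl_def)
  ultimately have "real (card F) \<le> r * real (card (Q \<union> R))"
    by (intro sparseD(1)[OF sparse]) auto
  moreover have "card F = 2 * (card Q * n)"
  proof -
    have "(Q \<times> R) \<inter> (R \<times> Q) = {}" using QR by blast
    then show ?thesis unfolding F_def using fQ card_R by (simp add: card_Un_disjoint card_cartesian_product)
  qed
  moreover have "card (Q \<union> R) = card Q + n" using fQ QR card_R by (simp add: card_Un_disjoint)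
  \<comment> \<open>The left side counts the arcs of the complete bipartite graph in both
    orientations. As both sides have more than \<open>r\<close> vertices, it exceeds the right
    side.\<close>
  ultimately have "2 * (real (card Q) * real n) \<le> r * real (card Q) + r * real n" by (simp add: algebra_simps)
  moreover have "r * real (card Q) < real n * real (card Q)"
    using rn rk r_nonneg by (intro mult_strict_right_mono) auto
  moreover have "r * real n < real (card Q) * real n"
    using rk n(1) by (intro mult_strict_right_mono) auto
  ultimately show False by (simp add: algebra_simps)
qed

end

section \<open>Closure properties of the class\<close>

lemma abelian_wreath_class_group: "abelian_wreath_class K \<Longrightarrow> group K"
  by (cases rule: abelian_wreath_class.cases) (auto simp: comm_group_def)

text \<open>\<open>abelian_wreath_class\<close> lives on \<open>nat\<close>, so the result of each
  construction on finite groups is transported along an injection into \<open>nat\<close>.\<close>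

lemma ex_nat_copy:
  assumes "group H" "finite (carrier H)"
  obtains K :: "nat monoid" where "group K" "H \<cong> K"
proof -
  obtain f :: "'a \<Rightarrow> nat" where f: "inj_on f (carrier H)"
    using finite_imp_inj_to_nat_seg[OF assms(2)] by auto
  let ?g = "the_inv_into (carrier H) f"
  define K where "K = \<lparr>carrier = f ` carrier H, monoid.mult = \<lambda>x y. f (?g x \<otimes>\<^bsub>H\<^esub> ?g y), one = f \<one>\<^bsub>H\<^esub>\<rparr>"
  have "f \<in> hom H K"
    by (rule homI) (simp_all add: K_def the_inv_into_f_f[OF f])
  then have iso: "f \<in> iso H K" by (rule isoI) (simp add: K_def f bij_betw_def)
  then have "group (K \<lparr>one := f \<one>\<^bsub>H\<^esub>\<rparr>)" using group.iso_imp_img_group[OF assms(1)] by blast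
  then have "group K" by (simp add: K_def)
  then show thesis using that is_isoI[OF iso] by blast
qed

lemma built_from_abelian_iso: "G \<cong> H \<Longrightarrow> built_from_abelian H \<Longrightarrow> built_from_abelian G"
  unfolding built_from_abelian_def using iso_trans by blast

lemma built_from_abelian_comm:
  assumes "comm_group H" "finite (carrier H)"
  shows "built_from_abelian H"
proof -
  have H: "group H" using assms(1) by (simp add: comm_group_def)
  then obtain K :: "nat monoid" where K: "group K" "H \<cong> K" using ex_nat_copy assms(2) by blast
  have "comm_group K"
    by (rule comm_group.iso_imp_comm_group[OF assms(1) K(2)]) (use K(1) group.is_monoid in blast)
  then show ?thesis using K(2) abelian_wreath_class.abelian unfolding built_from_abelian_def by blast
qed

lemma built_from_abelian_DirProd:
  assumes "group A" "group B" "finite (carrier A)" "finite (carrier B)"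
    and "built_from_abelian A" "built_from_abelian B"
  shows "built_from_abelian (A \<times>\<times> B)"
proof -
  obtain A' where A': "abelian_wreath_class A'" "A \<cong> A'" using assms(5) by (auto simp: built_from_abelian_def)
  obtain B' where B': "abelian_wreath_class B'" "B \<cong> B'" using assms(6) by (auto simp: built_from_abelian_def)
  have iso: "A \<times>\<times> B \<cong> A' \<times>\<times> B'" by (rule group.DirProd_iso_trans[OF assms(1) A'(2) B'(2)])
  have "finite (carrier (A' \<times>\<times> B'))"
    using iso_finite[OF iso] assms(3,4) by simp
  moreover have "group (A' \<times>\<times> B')"
    using A'(1) B'(1) abelian_wreath_class_group DirProd_group by blast
  ultimately obtain K :: "nat monoid" where "group K" "A' \<times>\<times> B' \<cong> K" using ex_nat_copy by blast
  then have "abelian_wreath_class K" "A \<times>\<times> B \<cong> K"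
    using abelian_wreath_class.direct[OF A'(1) B'(1)] iso iso_trans by blast+
  then show ?thesis unfolding built_from_abelian_def by blast
qed

lemma wreath_iso:
  fixes D :: "('d, 'm) monoid_scheme" and D' :: "('e, 'n) monoid_scheme" and \<Omega> :: "'w set"
  assumes "D \<cong> D'" "subgroup \<Phi> (BijGroup \<Omega>)"
  shows "wreath D \<Omega> \<Phi> \<cong> wreath D' \<Omega> \<Phi>"
proof -
  obtain h where h: "h \<in> hom D D'" and bij: "bij_betw h (carrier D) (carrier D')"
    using assms(1) by (auto simp: is_iso_def iso_def)
  define H where "H x = ((\<lambda>\<omega>\<in>\<Omega>. h (fst x \<omega>)), snd x)" for x :: "('w \<Rightarrow> 'd) \<times> ('w \<Rightarrow> 'w)"
  have inv_mem: "inv_into \<Omega> \<pi> \<omega> \<in> \<Omega>" if "\<pi> \<in> \<Phi>" "\<omega> \<in> \<Omega>" for \<pi> \<omega>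
    using Bij_inv_into_mem[of \<pi> \<Omega> \<omega>] subgroup.subset[OF assms(2)] that by (auto simp: BijGroup_def)
  have hD: "h x \<in> carrier D'" if "x \<in> carrier D" for x using bij that by (auto simp: bij_betw_def)
  have hm: "h (x \<otimes>\<^bsub>D\<^esub> y) = h x \<otimes>\<^bsub>D'\<^esub> h y" if "x \<in> carrier D" "y \<in> carrier D" for x y
    using h that by (simp add: hom_mult)
  have mem: "f \<omega> \<in> carrier D" if "f \<in> \<Omega> \<rightarrow>\<^sub>E carrier D" "\<omega> \<in> \<Omega>" for f \<omega> using that by (rule PiE_mem)
  have "H \<in> hom (wreath D \<Omega> \<Phi>) (wreath D' \<Omega> \<Phi>)"
  proof (rule homI)
    fix x assume "x \<in> carrier (wreath D \<Omega> \<Phi>)"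
    then show "H x \<in> carrier (wreath D' \<Omega> \<Phi>)"
      by (auto simp: H_def wreath_def hD mem)
  next
    fix x y assume "x \<in> carrier (wreath D \<Omega> \<Phi>)" "y \<in> carrier (wreath D \<Omega> \<Phi>)"
    then show "H (x \<otimes>\<^bsub>wreath D \<Omega> \<Phi>\<^esub> y) = H x \<otimes>\<^bsub>wreath D' \<Omega> \<Phi>\<^esub> H y"
      by (auto simp: H_def wreath_def hm mem inv_mem intro!: restrict_ext)
  qed
  moreover have "bij_betw H (carrier (wreath D \<Omega> \<Phi>)) (carrier (wreath D' \<Omega> \<Phi>))"
  proof -
    let ?k = "the_inv_into (carrier D) h"
    have k: "?k (h x) = x" if "x \<in> carrier D" for x
      using bij that by (auto simp: bij_betw_def the_inv_into_f_f)
    have k': "h (?k y) = y" "?k y \<in> carrier D" if "y \<in> carrier D'" for y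
      using bij that f_the_inv_into_f[of h "carrier D" y] the_inv_into_into[of h "carrier D" y "carrier D"]
      by (auto simp: bij_betw_def)
    show ?thesis
    proof (rule bij_betw_byWitness[where f' = "\<lambda>x. ((\<lambda>\<omega>\<in>\<Omega>. ?k (fst x \<omega>)), snd x)"])
      show "\<forall>x\<in>carrier (wreath D \<Omega> \<Phi>). ((\<lambda>\<omega>\<in>\<Omega>. ?k (fst (H x) \<omega>)), snd (H x)) = x"
      proof
        fix x assume "x \<in> carrier (wreath D \<Omega> \<Phi>)"
        then obtain f \<pi> where x: "x = (f, \<pi>)" "f \<in> \<Omega> \<rightarrow>\<^sub>E carrier D" by (auto simp: wreath_def)
        have "(\<lambda>\<omega>\<in>\<Omega>. ?k (fst (H x) \<omega>)) = restrict f \<Omega>"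
          using x by (intro restrict_ext) (simp add: H_def k mem)
        then show "((\<lambda>\<omega>\<in>\<Omega>. ?k (fst (H x) \<omega>)), snd (H x)) = x"
          using x by (simp add: H_def PiE_restrict)
      qed
      show "\<forall>y\<in>carrier (wreath D' \<Omega> \<Phi>). H ((\<lambda>\<omega>\<in>\<Omega>. ?k (fst y \<omega>)), snd y) = y"
      proof
        fix y assume "y \<in> carrier (wreath D' \<Omega> \<Phi>)"
        then obtain f \<pi> where y: "y = (f, \<pi>)" "f \<in> \<Omega> \<rightarrow>\<^sub>E carrier D'" by (auto simp: wreath_def)
        have "(\<lambda>\<omega>\<in>\<Omega>. h ((\<lambda>\<omega>\<in>\<Omega>. ?k (f \<omega>)) \<omega>)) = restrict f \<Omega>"
          using PiE_mem[OF y(2)] by (intro restrict_ext) (simp add: k')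
        then show "H ((\<lambda>\<omega>\<in>\<Omega>. ?k (fst y \<omega>)), snd y) = y"
          using y by (simp add: H_def PiE_restrict)
      qed
      show "H ` carrier (wreath D \<Omega> \<Phi>) \<subseteq> carrier (wreath D' \<Omega> \<Phi>)"
        by (auto simp: H_def wreath_def hD mem)
      show "(\<lambda>x. ((\<lambda>\<omega>\<in>\<Omega>. ?k (fst x \<omega>)), snd x)) ` carrier (wreath D' \<Omega> \<Phi>) \<subseteq> carrier (wreath D \<Omega> \<Phi>)"
        using k'(2) PiE_mem[of _ \<Omega> "\<lambda>_. carrier D'"] by (auto simp: wreath_def)
    qed
  qed
  ultimately show ?thesis by (intro is_isoI isoI)
qed

lemma built_from_abelian_wreath:
  assumes "finite (carrier D)" "built_from_abelian D"
    and "finite (\<Omega> :: nat set)" "finite \<Phi>" "subgroup \<Phi> (BijGroup \<Omega>)" "comm_group (perm_group \<Omega> \<Phi>)"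
  shows "built_from_abelian (wreath D \<Omega> \<Phi>)"
proof -
  obtain D' where D': "abelian_wreath_class D'" "D \<cong> D'" using assms(2) by (auto simp: built_from_abelian_def)
  have iso: "wreath D \<Omega> \<Phi> \<cong> wreath D' \<Omega> \<Phi>" by (rule wreath_iso[OF D'(2) assms(5)])
  have "finite (carrier D')" using iso_finite[OF D'(2)] assms(1) by simp
  then have "finite (carrier (wreath D' \<Omega> \<Phi>))"
    using assms(3,4) by (auto simp: wreath_def intro!: finite_PiE)
  moreover have "group (wreath D' \<Omega> \<Phi>)"
    using group_wreath[OF abelian_wreath_class_group[OF D'(1)] assms(5)] .
  ultimately obtain K :: "nat monoid" where "group K" "wreath D' \<Omega> \<Phi> \<cong> K" using ex_nat_copy by blast
  then have "abelian_wreath_class K" "wreath D \<Omega> \<Phi> \<cong> K"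
    using abelian_wreath_class.wreath[OF D'(1) assms(5,6)] iso iso_trans by blast+
  then show ?thesis unfolding built_from_abelian_def by blast
qed

definition grp_of :: "('a \<Rightarrow> 'a) set \<Rightarrow> ('a \<Rightarrow> 'a) monoid" where
  "grp_of \<Gamma> = \<lparr>carrier = \<Gamma>, monoid.mult = (\<circ>), one = id\<rparr>"

lemma grp_of_simps [simp]:
  "carrier (grp_of \<Gamma>) = \<Gamma>" "x \<otimes>\<^bsub>grp_of \<Gamma>\<^esub> y = x \<circ> y" "\<one>\<^bsub>grp_of \<Gamma>\<^esub> = id"
  by (simp_all add: grp_of_def)

lemma (in perm_grp) group_grp_of: "group (grp_of \<Gamma>)"
proof (rule groupI)
  fix x assume x: "x \<in> carrier (grp_of \<Gamma>)"
  then have "pinv x \<in> carrier (grp_of \<Gamma>)" "pinv x \<otimes>\<^bsub>grp_of \<Gamma>\<^esub> x = \<one>\<^bsub>grp_of \<Gamma>\<^esub>"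
    by (simp_all add: inv_mem fun_eq_iff)
  then show "\<exists>y\<in>carrier (grp_of \<Gamma>). y \<otimes>\<^bsub>grp_of \<Gamma>\<^esub> x = \<one>\<^bsub>grp_of \<Gamma>\<^esub>" by blast
qed (simp_all add: comp_mem id_mem comp_assoc)

section \<open>Decomposition into smaller graphs\<close>

text \<open>Closure is asked only towards \<open>U\<close>: this is a component of the subgraph
  induced on \<open>U\<close>, while edges of \<open>E\<close> may leave \<open>U\<close>.\<close>

definition component :: "('a \<times> 'a) set \<Rightarrow> 'a set \<Rightarrow> 'a set \<Rightarrow> bool" where
  "component E U K \<longleftrightarrow> K \<subseteq> U \<and> K \<noteq> {} \<and> conn E K \<and> (\<forall>u v. (u, v) \<in> E \<longrightarrow> u \<in> K \<longrightarrow> v \<in> U \<longrightarrow> v \<in> K)"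

lemma component_closed: "component E U K \<Longrightarrow> (u, v) \<in> E \<Longrightarrow> u \<in> K \<Longrightarrow> v \<in> U \<Longrightarrow> v \<in> K"
  by (simp add: component_def)

lemma component_subset:
  assumes "component E U K" "component E U L" "x \<in> K" "x \<in> L"
  shows "K \<subseteq> L"
proof
  fix y assume y: "y \<in> K"
  have K: "conn E K" "K \<subseteq> U" using assms(1) by (auto simp: component_def)
  show "y \<in> L"
  proof (rule conn_closed[OF K(1) assms(3) y assms(4)])
    fix u v assume "(u, v) \<in> E" "u \<in> K" "v \<in> K" "u \<in> L"
    then show "v \<in> L" using component_closed[OF assms(2), of u v] K(2) by blast
  qed
qed

lemma component_eq:
  "component E U K \<Longrightarrow> component E U L \<Longrightarrow> x \<in> K \<Longrightarrow> x \<in> L \<Longrightarrow> K = L"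
  using component_subset[of E U K L x] component_subset[of E U L K x] by simp

lemma ex_component:
  assumes "sym E" "x \<in> U"
  obtains K where "component E U K" "x \<in> K"
proof -
  let ?R = "E \<inter> U \<times> U"
  define K where "K = ?R\<^sup>* `` {x}"
  have KU: "y \<in> U" if "(x, y) \<in> ?R\<^sup>*" for y
    using that by (induction rule: rtrancl_induct) (use assms(2) in auto)
  have xK: "x \<in> K" by (simp add: K_def)
  have symR: "sym (?R)" using assms(1) by (auto simp: sym_def)
  have path: "(x, y) \<in> (E \<inter> K \<times> K)\<^sup>*" if "(x, y) \<in> ?R\<^sup>*" for y
    using that
  proof (induction rule: rtrancl_induct)
    case (step y z)
    then have "(x, z) \<in> ?R\<^sup>*" by (meson rtrancl_into_rtrancl)
    then have "(y, z) \<in> E \<inter> K \<times> K" using step.hyps by (auto simp: K_def)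
    then show ?case using step.IH by (rule rtrancl_into_rtrancl[rotated])
  qed simp
  have symK: "sym ((E \<inter> K \<times> K)\<^sup>*)"
    by (rule sym_rtrancl) (use assms(1) in \<open>auto simp: sym_def\<close>)
  have "conn E K"
    unfolding conn_def
  proof (intro ballI)
    fix y z assume "y \<in> K" "z \<in> K"
    then have "(x, y) \<in> (E \<inter> K \<times> K)\<^sup>*" "(x, z) \<in> (E \<inter> K \<times> K)\<^sup>*" using path by (auto simp: K_def)
    then show "(y, z) \<in> (E \<inter> K \<times> K)\<^sup>*" using symD[OF symK] rtrancl_trans by fast
  qed
  moreover have "v \<in> K" if "(u, v) \<in> E" "u \<in> K" "v \<in> U" for u v
  proof -
    have "(x, u) \<in> ?R\<^sup>*" using that(2) by (simp add: K_def)
    moreover have "(u, v) \<in> ?R" using that KU[OF calculation] by simp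
    ultimately have "(x, v) \<in> ?R\<^sup>*" by (rule rtrancl_into_rtrancl)
    then show ?thesis by (simp add: K_def)
  qed
  moreover have "K \<subseteq> U" using KU by (auto simp: K_def)
  ultimately have "component E U K" using xK unfolding component_def by blast
  then show thesis using that xK by blast
qed

text \<open>Closedness replaces vertex colours in the induction: unlike being the full automorphism group,
  it passes to the pointwise stabiliser of the complement of a vertex set.\<close>

locale closed_action = sparse_action +
  assumes permutes: "g \<in> \<Gamma> \<Longrightarrow> g permutes V"
    and closed: "\<pi> permutes V \<Longrightarrow> (\<And>v. v \<in> V \<Longrightarrow> \<exists>g\<in>\<Gamma>. g v = \<pi> v) \<Longrightarrow>
      (\<And>u v. (u, v) \<in> E \<Longrightarrow> \<exists>g\<in>\<Gamma>. g u = \<pi> u \<and> g v = \<pi> v) \<Longrightarrow> \<pi> \<in> \<Gamma>"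
begin

lemma component_image:
  assumes "g \<in> \<Gamma>" "\<And>v. g v \<in> U \<longleftrightarrow> v \<in> U" "component E U K"
  shows "component E U (g ` K)"
  unfolding component_def
proof (intro conjI allI impI)
  have K: "K \<subseteq> U" "K \<noteq> {}" "conn E K" using assms(3) by (auto simp: component_def)
  show "g ` K \<subseteq> U" "g ` K \<noteq> {}" using K assms(2) by auto
  show "conn E (g ` K)" by (rule conn_image[OF K(3)]) (use E_app[OF assms(1)] in auto)
  fix u v assume uv: "(u, v) \<in> E" "u \<in> g ` K" "v \<in> U"
  then obtain x where x: "x \<in> K" "u = g x" by blast
  have v: "v = g (pinv g v)" using assms(1) by simp
  have "(g x, g (pinv g v)) \<in> E" using uv(1) x v by simp
  then have "(x, pinv g v) \<in> E" using E_app_iff[OF assms(1)] by blast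
  moreover have "pinv g v \<in> U" using uv(3) v assms(2) by metis
  ultimately have "pinv g v \<in> K" using component_closed[OF assms(3)] x by blast
  then show "v \<in> g ` K" using v by blast
qed

text \<open>The new group fixes the complement of \<open>X\<close> pointwise. Closedness survives
  because the outer end of an edge leaving \<open>X\<close> is fixed by \<open>\<pi>\<close> and by
  the whole new group, so an element matching \<open>\<pi>\<close> at the inner end matches it at
  both.\<close>

lemma subset_action:
  assumes X: "X \<subseteq> V"
  shows "closed_action {g \<in> \<Gamma>. g permutes X} r h X (E \<inter> X \<times> X)"
proof -
  let ?D = "{g \<in> \<Gamma>. g permutes X}"
  have D: "perm_grp ?D"
    by (rule subgrpI) (auto simp: id_mem comp_mem inv_mem permutes_id[folded id_def] permutes_compose permutes_inv)
  interpret D: sparse_action ?D r h V E by (rule subgrp_action[OF D]) blast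
  interpret DX: sparse_action ?D r h X "E \<inter> X \<times> X"
  proof (rule D.minor_action)
    show "minor_of X (E \<inter> X \<times> X) V E" by (rule minor_of_subgraph) (use X in auto)
    show "finite X" using X finV finite_subset by blast
    show "sym (E \<inter> X \<times> X)" using symE by (auto simp: sym_def)
    show "irrefl (E \<inter> X \<times> X)" using irreflE by (auto simp: irrefl_def)
    show "g v \<in> X" if "g \<in> ?D" "v \<in> X" for g v using that permutes_in_image by fastforce
    then show "(g u, g v) \<in> E \<inter> X \<times> X" if "g \<in> ?D" "(u, v) \<in> E \<inter> X \<times> X" for g u v
      using that E_app by auto
  qed
  show ?thesis
  proof
    show "g permutes X" if "g \<in> ?D" for g using that by blast
    fix \<pi> assume p: "\<pi> permutes X" and vx: "\<And>v. v \<in> X \<Longrightarrow> \<exists>g\<in>?D. g v = \<pi> v"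
      and ed: "\<And>u v. (u, v) \<in> E \<inter> X \<times> X \<Longrightarrow> \<exists>g\<in>?D. g u = \<pi> u \<and> g v = \<pi> v"
    have out: "g v = v" if "g permutes X" "v \<notin> X" for g v using that by (rule permutes_not_in)
    have "\<pi> \<in> \<Gamma>"
    proof (rule closed)
      show "\<pi> permutes V" by (rule permutes_subset[OF p X])
      show "\<exists>g\<in>\<Gamma>. g v = \<pi> v" for v
        using vx[of v] out[OF p, of v] id_mem by (cases "v \<in> X") (auto intro: bexI[of _ id])
      fix u v assume uv: "(u, v) \<in> E"
      consider "u \<in> X" "v \<in> X" | "u \<in> X" "v \<notin> X" | "u \<notin> X" "v \<in> X" | "u \<notin> X" "v \<notin> X" by blast
      then show "\<exists>g\<in>\<Gamma>. g u = \<pi> u \<and> g v = \<pi> v"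
      proof cases
        case 1 then show ?thesis using ed[of u v] uv by blast
      next
        case 2
        obtain g where "g \<in> ?D" "g u = \<pi> u" using vx[OF 2(1)] by blast
        then show ?thesis using out[of g v] out[OF p, of v] 2 by auto
      next
        case 3
        obtain g where "g \<in> ?D" "g v = \<pi> v" using vx[OF 3(2)] by blast
        then show ?thesis using out[of g u] out[OF p, of u] 3 by auto
      next
        case 4 then show ?thesis using out[OF p] id_mem by (intro bexI[of _ id]) auto
      qed
    qed
    then show "\<pi> \<in> ?D" using p by blast
  qed
qed

text \<open>On an edge meeting \<open>X\<close> both ends lie in \<open>X \<union> W\<close>, where
  \<open>restr X g\<close> agrees with \<open>g\<close>; on every other edge it agrees with
  \<open>id\<close>. Closedness does the rest.\<close>

lemma restr_mem:
  assumes g: "g \<in> \<Gamma>" "\<And>w. w \<in> W \<Longrightarrow> g w = w" and X: "X \<subseteq> V" "g ` X = X"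
    and XW: "\<And>u v. (u, v) \<in> E \<Longrightarrow> u \<in> X \<Longrightarrow> v \<in> X \<union> W"
  shows "restr X g \<in> \<Gamma>" "restr X g permutes X"
proof -
  have finX: "finite X" using X(1) finV finite_subset by blast
  show p: "restr X g permutes X"
  proof (rule inj_imp_permutes[OF _ finX])
    show "inj_on (restr X g) X" using g by (auto simp: restr_def inj_on_def)
  qed (use X in \<open>auto simp: restr_def\<close>)
  show "restr X g \<in> \<Gamma>"
  proof (rule closed)
    show "restr X g permutes V" by (rule permutes_subset[OF p X(1)])
    show "\<exists>k\<in>\<Gamma>. k v = restr X g v" for v
      using g(1) id_mem by (cases "v \<in> X") (auto simp: restr_def intro: bexI[of _ id])
    fix u v assume uv: "(u, v) \<in> E"
    show "\<exists>k\<in>\<Gamma>. k u = restr X g u \<and> k v = restr X g v"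
    proof (cases "u \<in> X \<or> v \<in> X")
      case True
      have "v \<in> X \<union> W" if "u \<in> X" using XW uv that by blast
      moreover have "u \<in> X \<union> W" if "v \<in> X" using XW[OF symD[OF symE uv]] that by blast
      ultimately show ?thesis using True g by (intro bexI[of _ g]) (auto simp: restr_def)
    next
      case False then show ?thesis using id_mem by (intro bexI[of _ id]) (auto simp: restr_def)
    qed
  qed
qed

text \<open>Otherwise exchanging \<open>K\<close> with its image would be an involution in the group.\<close>

lemma component_fixed:
  assumes W: "W \<subseteq> V" and g: "g \<in> \<Gamma>" "\<And>w. w \<in> W \<Longrightarrow> g w = w" and K: "component E (V - W) K"
  shows "g ` K = K"
proof (rule ccontr)
  assume ne: "g ` K \<noteq> K"
  define L where "L = g ` K"
  have gU: "g v \<in> V - W \<longleftrightarrow> v \<in> V - W" for v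
    using V_app_iff[OF g(1)] g W by (metis DiffD1 DiffD2 DiffI app_eq_iff subsetD)
  have L: "component E (V - W) L" unfolding L_def by (rule component_image[OF g(1) gU K])
  have KL: "K \<inter> L = {}" using component_eq[OF K L] ne L_def by blast
  have KU: "K \<subseteq> V - W" "K \<noteq> {}" and LU: "L \<subseteq> V - W" using K L by (auto simp: component_def)
  define \<sigma> where "\<sigma> x = (if x \<in> K then g x else if x \<in> L then pinv g x else x)" for x
  have sK: "\<sigma> x = g x" "g x \<in> L" if "x \<in> K" for x using that by (auto simp: \<sigma>_def L_def)
  have sL: "\<sigma> x = pinv g x" "pinv g x \<in> K" if "x \<in> L" for x
  proof -
    show "\<sigma> x = pinv g x" using that KL by (auto simp: \<sigma>_def)
    show "pinv g x \<in> K" using that g(1) by (auto simp: L_def)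
  qed
  have so: "\<sigma> x = x" if "x \<notin> K" "x \<notin> L" for x using that by (simp add: \<sigma>_def)
  have inv: "\<sigma> (\<sigma> x) = x" for x
  proof -
    consider "x \<in> K" | "x \<in> L" | "x \<notin> K" "x \<notin> L" by blast
    then show ?thesis
      by cases (use sK sL so g(1) in auto)
  qed
  have perm: "\<sigma> permutes V"
    unfolding permutes_def
  proof (intro conjI allI impI)
    show "\<sigma> x = x" if "x \<notin> V" for x using that KU LU by (intro so) auto
    show "\<exists>!x. \<sigma> x = y" for y using inv by metis
  qed
  have "\<sigma> \<in> \<Gamma>"
  proof (rule closed[OF perm])
    have ig: "pinv g \<in> \<Gamma>" using g inv_mem by blast
    show "\<exists>k\<in>\<Gamma>. k v = \<sigma> v" for v
    proof -
      consider "v \<in> K" | "v \<in> L" | "v \<notin> K" "v \<notin> L" by blast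
      then show ?thesis
      proof cases
        case 1 then show ?thesis using sK g by auto
      next
        case 2 then show ?thesis using sL ig by auto
      next
        case 3 then show ?thesis using so id_mem by (intro bexI[of _ id]) auto
      qed
    qed
    \<comment> \<open>An edge leaving \<open>K\<close> or \<open>L\<close> ends in \<open>W\<close>,
      which \<open>g\<close> fixes; so \<open>\<sigma>\<close> agrees with \<open>g\<close> on every
      edge at \<open>K\<close> and with \<open>pinv g\<close> on every edge at
      \<open>L\<close>.\<close>
    have main: "\<exists>k\<in>\<Gamma>. k u = \<sigma> u \<and> k v = \<sigma> v" if uv: "(u, v) \<in> E" and u: "u \<in> K \<union> L" for u v
    proof -
      have vV: "v \<in> V" using uv E_sub by blast
      show ?thesis
      proof (cases "u \<in> K")
        case True
        have "v \<in> K \<or> v \<in> W" using component_closed[OF K uv True] vV by blast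
        then have "g v = \<sigma> v" using sK g(2) so KU LU by (metis DiffD2 subsetD)
        then show ?thesis using sK True g by auto
      next
        case False
        then have uL: "u \<in> L" using u by blast
        have "v \<in> L \<or> v \<in> W" using component_closed[OF L uv uL] vV by blast
        then have "pinv g v = \<sigma> v"
        proof
          assume w: "v \<in> W"
          then have "pinv g v = v" using g inv_app_eq by metis
          moreover have "\<sigma> v = v" using w KU LU by (intro so) auto
          ultimately show ?thesis by simp
        qed (simp add: sL)
        then show ?thesis using sL uL ig by auto
      qed
    qed
    fix u v assume uv: "(u, v) \<in> E"
    consider "u \<in> K \<union> L" | "v \<in> K \<union> L" | "u \<notin> K \<union> L" "v \<notin> K \<union> L" by blast
    then show "\<exists>k\<in>\<Gamma>. k u = \<sigma> u \<and> k v = \<sigma> v"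
    proof cases
      case 1 then show ?thesis using main uv by blast
    next
      case 2 then show ?thesis using main[OF symD[OF symE uv]] by blast
    next
      case 3 then show ?thesis using so id_mem by (intro bexI[of _ id]) auto
    qed
  qed
  have inv': "pinv \<sigma> = \<sigma>" by (rule inv_unique_comp) (simp_all add: fun_eq_iff inv)
  have ss: "\<sigma> \<circ> \<sigma> = id" by (simp add: fun_eq_iff inv)
  have "perm_grp {id, \<sigma>}"
  proof (rule subgrpI)
    show "x \<circ> y \<in> {id, \<sigma>}" if "x \<in> {id, \<sigma>}" "y \<in> {id, \<sigma>}" for x y using that ss by auto
    show "pinv x \<in> {id, \<sigma>}" if "x \<in> {id, \<sigma>}" for x using that inv' inv_id by auto
  qed (use \<open>\<sigma> \<in> \<Gamma>\<close> id_mem in auto)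
  then have "card {id, \<sigma>} dvd card \<Gamma>"
    by (rule card_subgrp_dvd) (use \<open>\<sigma> \<in> \<Gamma>\<close> id_mem in auto)
  moreover have "id \<noteq> \<sigma>"
  proof
    assume id: "id = \<sigma>"
    obtain x where x: "x \<in> K" using KU by blast
    then have "\<sigma> x \<in> L" using sK by simp
    then show False using x KL id by (metis IntI empty_iff id_apply)
  qed
  then have "card {id, \<sigma>} = 2" by simp
  ultimately have "2 dvd card \<Gamma>" by metis
  then show False using large[of 2] by simp
qed

text \<open>By \<open>component_fixed\<close> with empty \<open>W\<close> every element preserves
  \<open>K\<close>, hence also \<open>V - K\<close>. No edge joins the two sets, so
  \<open>restr_mem\<close> shows that both restrictions of an element belong to
  \<open>\<Gamma>\<close>.\<close>

lemma direct_product: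
  assumes K: "component E V K"
  shows "grp_of \<Gamma> \<cong> grp_of {g \<in> \<Gamma>. g permutes K} \<times>\<times> grp_of {g \<in> \<Gamma>. g permutes (V - K)}"
proof -
  let ?A = "{g \<in> \<Gamma>. g permutes K}" and ?B = "{g \<in> \<Gamma>. g permutes (V - K)}"
  have KV: "K \<subseteq> V" using K by (auto simp: component_def)
  interpret A: closed_action ?A r h K "E \<inter> K \<times> K" by (rule subset_action[OF KV])
  interpret B: closed_action ?B r h "V - K" "E \<inter> (V - K) \<times> (V - K)" by (rule subset_action) blast
  have A_out: "a v = v" if "a \<in> ?A" "v \<notin> K" for a v using that permutes_not_in by fastforce
  have B_out: "b v = v" if "b \<in> ?B" "v \<in> K" for b v using that permutes_not_in[of b "V - K" v] by simp
  have A_in: "a v \<in> K \<longleftrightarrow> v \<in> K" if "a \<in> ?A" for a v using that permutes_in_image by fastforce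
  have B_in: "b v \<in> K \<longleftrightarrow> v \<in> K" if "b \<in> ?B" for b v
    using that permutes_in_image[of b "V - K" v] permutes_not_in[of b "V - K" v] KV by (cases "v \<in> V - K") auto
  have comm: "a \<circ> b = b \<circ> a" if "a \<in> ?A" "b \<in> ?B" for a b
  proof
    fix v show "(a \<circ> b) v = (b \<circ> a) v"
      using A_out[OF that(1)] B_out[OF that(2)] A_in[OF that(1)] B_in[OF that(2)] by (cases "v \<in> K") auto
  qed
  define \<theta> where "\<theta> x = fst x \<circ> snd x" for x :: "('a \<Rightarrow> 'a) \<times> ('a \<Rightarrow> 'a)"
  have "\<theta> \<in> hom (grp_of ?A \<times>\<times> grp_of ?B) (grp_of \<Gamma>)"
  proof (rule homI)
    fix x assume "x \<in> carrier (grp_of ?A \<times>\<times> grp_of ?B)"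
    then show "\<theta> x \<in> carrier (grp_of \<Gamma>)" by (auto simp: \<theta>_def comp_mem)
  next
    fix x y assume "x \<in> carrier (grp_of ?A \<times>\<times> grp_of ?B)" "y \<in> carrier (grp_of ?A \<times>\<times> grp_of ?B)"
    then obtain a b c d where xy: "x = (a, b)" "y = (c, d)" "a \<in> ?A" "b \<in> ?B" "c \<in> ?A" "d \<in> ?B" by auto
    have "(a \<circ> c) \<circ> (b \<circ> d) = a \<circ> (c \<circ> b) \<circ> d" by (simp only: comp_assoc)
    also have "\<dots> = (a \<circ> b) \<circ> (c \<circ> d)" by (simp only: comm[OF xy(5,4)] comp_assoc)
    finally show "\<theta> (x \<otimes>\<^bsub>grp_of ?A \<times>\<times> grp_of ?B\<^esub> y) = \<theta> x \<otimes>\<^bsub>grp_of \<Gamma>\<^esub> \<theta> y"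
      using xy(1,2) by (simp add: \<theta>_def)
  qed
  moreover have "bij_betw \<theta> (carrier (grp_of ?A \<times>\<times> grp_of ?B)) (carrier (grp_of \<Gamma>))"
  proof (rule bij_betw_imageI)
    show "inj_on \<theta> (carrier (grp_of ?A \<times>\<times> grp_of ?B))"
    proof (rule inj_onI)
      fix x y assume "x \<in> carrier (grp_of ?A \<times>\<times> grp_of ?B)" "y \<in> carrier (grp_of ?A \<times>\<times> grp_of ?B)" "\<theta> x = \<theta> y"
      then obtain a b c d where xy: "x = (a, b)" "y = (c, d)" "a \<in> ?A" "b \<in> ?B" "c \<in> ?A" "d \<in> ?B"
        and "a \<circ> b = c \<circ> d" by (auto simp: \<theta>_def)
      then have eq: "a (b v) = c (d v)" for v by (metis comp_apply)
      have "a v = c v" for v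
        using eq[of v] B_out[OF xy(4)] B_out[OF xy(6)] A_out[OF xy(3)] A_out[OF xy(5)] by (cases "v \<in> K") auto
      moreover have "b v = d v" for v
        using eq[of v] B_out[OF xy(4)] B_out[OF xy(6)] A_out[OF xy(3)] A_out[OF xy(5)] B_in[OF xy(4)] B_in[OF xy(6)]
        by (cases "v \<in> K") auto
      ultimately show "x = y" using xy(1,2) by (simp add: fun_eq_iff)
    qed
    show "\<theta> ` carrier (grp_of ?A \<times>\<times> grp_of ?B) = carrier (grp_of \<Gamma>)"
    proof (intro equalityI subsetI)
      fix g assume "g \<in> carrier (grp_of \<Gamma>)"
      then have g: "g \<in> \<Gamma>" by simp
      have gK: "g ` K = K" by (rule component_fixed[of "{}"]) (use g K in auto)
      then have gK': "g ` (V - K) = V - K"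
        using permutes_image[OF permutes[OF g]] bij_is_inj[OF bij[OF g]] by (simp add: image_set_diff)
      have E1: "v \<in> K \<union> {}" if "(u, v) \<in> E" "u \<in> K" for u v
        using component_closed[OF K that] that(1) E_sub by blast
      have E2: "v \<in> (V - K) \<union> {}" if "(u, v) \<in> E" "u \<in> V - K" for u v
        using component_closed[OF K symD[OF symE that(1)]] that E_sub by blast
      have "restr K g \<in> \<Gamma>" "restr K g permutes K"
        by (rule restr_mem[OF g _ KV gK, of "{}"]; use E1 in blast)+
      then have "restr K g \<in> ?A" by blast
      moreover have "restr (V - K) g \<in> \<Gamma>" "restr (V - K) g permutes (V - K)"
        by (rule restr_mem[OF g _ _ gK', of "{}"]; use E2 in blast)+
      then have "restr (V - K) g \<in> ?B" by blast
      moreover have "g = restr K g \<circ> restr (V - K) g"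
      proof
        fix v show "g v = (restr K g \<circ> restr (V - K) g) v"
          using gK gK' permutes_not_in[OF permutes[OF g], of v] KV by (auto simp: restr_def)
      qed
      ultimately show "g \<in> \<theta> ` carrier (grp_of ?A \<times>\<times> grp_of ?B)"
        by (intro image_eqI[of _ _ "(restr K g, restr (V - K) g)"]) (auto simp: \<theta>_def)
    qed (auto simp: \<theta>_def comp_mem)
  qed
  ultimately have "grp_of ?A \<times>\<times> grp_of ?B \<cong> grp_of \<Gamma>" by (intro is_isoI isoI)
  then show ?thesis
    by (rule group.iso_sym[OF DirProd_group[OF A.group_grp_of B.group_grp_of]])
qed

end

text \<open>The data extracted from a connected graph. \<open>\<Gamma>\<close> acts on the orbit of
  \<open>b\<close> as a regular abelian group with kernel \<open>stab \<Gamma> b\<close>. The kernel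
  fixes \<open>W\<close> pointwise and preserves \<open>X\<close>; the translates of
  \<open>X\<close>, one for each coset of the kernel, partition \<open>V - W\<close>, and no edge
  joins two of them.\<close>

locale wreath_action = closed_action +
  fixes b :: 'a and W X :: "'a set"
  assumes b: "b \<in> V"
    and regular: "g \<in> \<Gamma> \<Longrightarrow> y \<in> orb \<Gamma> b \<Longrightarrow> g y = y \<Longrightarrow> z \<in> orb \<Gamma> b \<Longrightarrow> g z = z"
    and commute: "g \<in> \<Gamma> \<Longrightarrow> k \<in> \<Gamma> \<Longrightarrow> y \<in> orb \<Gamma> b \<Longrightarrow> g (k y) = k (g y)"
    and W_def: "W = {v \<in> V. \<forall>n\<in>stab \<Gamma> b. n v = v}"
    and W_app: "g \<in> \<Gamma> \<Longrightarrow> v \<in> W \<Longrightarrow> g v \<in> W"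
    and X_sub: "X \<subseteq> V - W"
    and X_stab: "n \<in> stab \<Gamma> b \<Longrightarrow> n ` X = X"
    and X_disj: "g \<in> \<Gamma> \<Longrightarrow> x \<in> X \<Longrightarrow> g x \<in> X \<Longrightarrow> g \<in> stab \<Gamma> b"
    and X_cover: "u \<in> V - W \<Longrightarrow> \<exists>g\<in>\<Gamma>. \<exists>x\<in>X. u = g x"
    and X_edge: "(u, v) \<in> E \<Longrightarrow> u \<in> X \<Longrightarrow> v \<in> X \<union> W"
begin

abbreviation "B \<equiv> orb \<Gamma> b"
abbreviation "N \<equiv> stab \<Gamma> b"

definition \<Delta> where "\<Delta> = {g \<in> \<Gamma>. g permutes X}"
definition \<Phi> where "\<Phi> = (\<lambda>g. restrict g B) ` \<Gamma>"
definition \<tau> where "\<tau> y = (SOME g. g \<in> \<Gamma> \<and> g b = y)"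
text \<open>The cocycle of the standard embedding of an extension into a wreath product, for the
  transversal \<open>\<tau>\<close> of \<open>N\<close>. It records how \<open>g\<close> carries the
  translate of \<open>X\<close> at \<open>pinv g y\<close> to the one at \<open>y\<close>, both
  identified with \<open>X\<close>.\<close>

definition cocycle where "cocycle g y = pinv (\<tau> y) \<circ> g \<circ> \<tau> (pinv g y)"
definition \<theta> where "\<theta> g = ((\<lambda>y\<in>B. restr X (cocycle g y)), restrict g B)"

lemma N_sub: "n \<in> N \<Longrightarrow> n \<in> \<Gamma>" by (simp add: stab_def)

lemma in_N: "g \<in> \<Gamma> \<Longrightarrow> y \<in> B \<Longrightarrow> g y = y \<Longrightarrow> g \<in> N"
  using regular[OF _ _ _ orb_self] by (auto simp: stab_def)

lemma N_B: "n \<in> N \<Longrightarrow> y \<in> B \<Longrightarrow> n y = y"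
  using regular[OF _ orb_self] by (auto simp: stab_def)

lemma N_W: "n \<in> N \<Longrightarrow> w \<in> W \<Longrightarrow> n w = w"
  by (auto simp: W_def)

lemma B_W: "B \<subseteq> W"
  using orb_sub[OF b] N_B by (auto simp: W_def)

lemma B_app: "g \<in> \<Gamma> \<Longrightarrow> y \<in> B \<Longrightarrow> g y \<in> B"
  by (simp add: orb_app)

lemma N_iff: "g \<in> \<Gamma> \<Longrightarrow> k \<in> \<Gamma> \<Longrightarrow> y \<in> B \<Longrightarrow> g y = k y \<Longrightarrow> pinv g \<circ> k \<in> N"
  by (rule in_N) (auto simp: comp_mem inv_mem inv_app_eq)

text \<open>Elements agreeing at a point of \<open>B\<close> differ by an element of
  \<open>N\<close>, which is trivial on \<open>W\<close>. Hence the action on \<open>B\<close>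
  controls the action on \<open>W\<close>.\<close>

lemma agree_W: "g \<in> \<Gamma> \<Longrightarrow> k \<in> \<Gamma> \<Longrightarrow> y \<in> B \<Longrightarrow> g y = k y \<Longrightarrow> w \<in> W \<Longrightarrow> g w = k w"
  using N_W[OF N_iff[of g k y]] by (metis comp_apply inv_app_eq)

lemma tau: "y \<in> B \<Longrightarrow> \<tau> y \<in> \<Gamma>" "y \<in> B \<Longrightarrow> \<tau> y b = y"
proof -
  assume "y \<in> B"
  then obtain g where "g \<in> \<Gamma> \<and> g b = y" by (auto simp: orb_def)
  then have "\<tau> y \<in> \<Gamma> \<and> \<tau> y b = y" unfolding \<tau>_def by (rule someI[of _ g])
  then show "\<tau> y \<in> \<Gamma>" "\<tau> y b = y" by auto
qed

lemma cocycle_N: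
  assumes "g \<in> \<Gamma>" "y \<in> B"
  shows "cocycle g y \<in> N"
proof -
  have y: "pinv g y \<in> B" by (rule B_app[OF inv_mem[OF assms(1)] assms(2)])
  have "cocycle g y b = b"
    using tau(2)[OF assms(2)] tau(2)[OF y] assms inv_app_eq[OF tau(1)[OF assms(2)]] by (simp add: cocycle_def)
  moreover have "cocycle g y \<in> \<Gamma>"
    unfolding cocycle_def by (intro comp_mem inv_mem tau assms y)
  ultimately show ?thesis by (simp add: stab_def)
qed

lemma restr_N:
  assumes "n \<in> N"
  shows "restr X n \<in> \<Delta>"
proof -
  have XV: "X \<subseteq> V" using X_sub by blast
  have "restr X n \<in> \<Gamma>"
    by (rule restr_mem(1)[OF N_sub[OF assms] _ XV X_stab[OF assms], of W]) (use N_W[OF assms] X_edge in blast)+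
  moreover have "restr X n permutes X"
    by (rule restr_mem(2)[OF N_sub[OF assms] _ XV X_stab[OF assms], of W]) (use N_W[OF assms] X_edge in blast)+
  ultimately show ?thesis by (simp add: \<Delta>_def)
qed

lemma Delta_N: "d \<in> \<Delta> \<Longrightarrow> d \<in> N"
proof -
  assume d: "d \<in> \<Delta>"
  have "b \<notin> X" using B_W orb_self X_sub by blast
  then have "d b = b" using d permutes_not_in by (fastforce simp: \<Delta>_def)
  then show ?thesis using d by (simp add: \<Delta>_def stab_def)
qed

lemma N_X: "n \<in> N \<Longrightarrow> n x \<in> X \<longleftrightarrow> x \<in> X"
  using X_stab[of n] N_sub[of n] by (metis app_eq_iff image_iff)

lemma restr_comp: "k \<in> N \<Longrightarrow> restr X (n \<circ> k) = restr X n \<circ> restr X k"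
  using N_X[of k] by (auto simp: restr_def fun_eq_iff)

lemma Bij_restrict: "g \<in> \<Gamma> \<Longrightarrow> restrict g B \<in> Bij B"
proof -
  assume g: "g \<in> \<Gamma>"
  have "bij_betw g B B"
  proof (rule bij_betw_imageI)
    show "inj_on g B" using g by (simp add: inj_on_def)
    show "g ` B = B"
    proof (intro equalityI subsetI)
      fix y assume "y \<in> B"
      then have "y = g (pinv g y)" "pinv g y \<in> B" using g B_app inv_mem by auto
      then show "y \<in> g ` B" by blast
    qed (use B_app g in auto)
  qed
  then show ?thesis by (auto simp: Bij_def intro: bij_betw_cong[THEN iffD1, rotated])
qed

lemma inv_into_restrict: "g \<in> \<Gamma> \<Longrightarrow> y \<in> B \<Longrightarrow> inv_into B (restrict g B) y = pinv g y"
proof (rule inv_into_f_eq)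
  assume g: "g \<in> \<Gamma>" "y \<in> B"
  show "inj_on (restrict g B) B" using Bij_restrict[OF g(1)] by (simp add: Bij_def bij_betw_def)
  show "pinv g y \<in> B" using g B_app inv_mem by blast
  then show "restrict g B (pinv g y) = y" using g by simp
qed

lemma restrict_comp: "g \<in> \<Gamma> \<Longrightarrow> k \<in> \<Gamma> \<Longrightarrow> restrict g B \<otimes>\<^bsub>BijGroup B\<^esub> restrict k B = restrict (g \<circ> k) B"
  using Bij_restrict[of g] Bij_restrict[of k] B_app[of k]
  by (auto simp: BijGroup_def compose_def fun_eq_iff restrict_def)

lemma subgroup_Phi: "subgroup \<Phi> (BijGroup B)"
proof -
  interpret G: group "BijGroup B" by (rule group_BijGroup)
  show ?thesis
  proof (rule G.subgroupI)
    show "\<Phi> \<subseteq> carrier (BijGroup B)" using Bij_restrict by (auto simp: \<Phi>_def BijGroup_def)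
    show "\<Phi> \<noteq> {}" using id_mem by (auto simp: \<Phi>_def)
    fix \<pi> assume "\<pi> \<in> \<Phi>"
    then obtain g where g: "g \<in> \<Gamma>" "\<pi> = restrict g B" by (auto simp: \<Phi>_def)
    have "inv\<^bsub>BijGroup B\<^esub> \<pi> = (\<lambda>y\<in>B. inv_into B (restrict g B) y)"
      unfolding g(2) by (rule inv_BijGroup[OF Bij_restrict[OF g(1)]])
    also have "\<dots> = restrict (pinv g) B"
      by (rule restrict_ext) (rule inv_into_restrict[OF g(1)])
    finally show "inv\<^bsub>BijGroup B\<^esub> \<pi> \<in> \<Phi>" using inv_mem[OF g(1)] by (simp add: \<Phi>_def)
  next
    fix \<pi> \<rho> assume "\<pi> \<in> \<Phi>" "\<rho> \<in> \<Phi>"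
    then obtain g k where "g \<in> \<Gamma>" "\<pi> = restrict g B" "k \<in> \<Gamma>" "\<rho> = restrict k B" by (auto simp: \<Phi>_def)
    then show "\<pi> \<otimes>\<^bsub>BijGroup B\<^esub> \<rho> \<in> \<Phi>"
      using restrict_comp comp_mem by (auto simp: \<Phi>_def)
  qed
qed

lemma comm_group_Phi: "comm_group (perm_group B \<Phi>)"
proof (rule group.group_comm_groupI)
  show "group (perm_group B \<Phi>)"
    unfolding perm_group_def by (rule subgroup.subgroup_is_group[OF subgroup_Phi group_BijGroup])
  fix \<pi> \<rho> assume "\<pi> \<in> carrier (perm_group B \<Phi>)" "\<rho> \<in> carrier (perm_group B \<Phi>)"
  then obtain g k where gk: "g \<in> \<Gamma>" "\<pi> = restrict g B" "k \<in> \<Gamma>" "\<rho> = restrict k B"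
    by (auto simp: \<Phi>_def perm_group_def)
  then have "restrict (g \<circ> k) B = restrict (k \<circ> g) B"
    using commute by (intro restrict_ext) simp
  then show "\<pi> \<otimes>\<^bsub>perm_group B \<Phi>\<^esub> \<rho> = \<rho> \<otimes>\<^bsub>perm_group B \<Phi>\<^esub> \<pi>"
    using gk restrict_comp by (simp add: perm_group_def)
qed

text \<open>The cocycle identity \<open>cocycle (g \<circ> k) y = cocycle g y \<circ> cocycle k
  (pinv g y)\<close> is the coordinate shift in the multiplication of \<open>wreath\<close>.\<close>

lemma hom_theta: "\<theta> \<in> hom (grp_of \<Gamma>) (wreath (grp_of \<Delta>) B \<Phi>)"
proof (rule homI)
  fix g assume "g \<in> carrier (grp_of \<Gamma>)"
  then show "\<theta> g \<in> carrier (wreath (grp_of \<Delta>) B \<Phi>)"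
    using restr_N cocycle_N by (auto simp: \<theta>_def wreath_def \<Phi>_def)
next
  fix g k assume "g \<in> carrier (grp_of \<Gamma>)" "k \<in> carrier (grp_of \<Gamma>)"
  then have g: "g \<in> \<Gamma>" and k: "k \<in> \<Gamma>" by simp_all
  have "restr X (cocycle (g \<circ> k) y) = restr X (cocycle g y) \<circ> restr X (cocycle k (pinv g y))" if y: "y \<in> B" for y
  proof -
    have y': "pinv g y \<in> B" by (rule B_app[OF inv_mem[OF g] y])
    have "pinv (g \<circ> k) = pinv k \<circ> pinv g" using bij g k o_inv_distrib by blast
    then have "cocycle (g \<circ> k) y = cocycle g y \<circ> cocycle k (pinv g y)"
      using tau(1)[OF y'] by (simp add: cocycle_def fun_eq_iff)
    then show ?thesis using restr_comp[OF cocycle_N[OF k y']] by simp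
  qed
  then show "\<theta> (g \<otimes>\<^bsub>grp_of \<Gamma>\<^esub> k) = \<theta> g \<otimes>\<^bsub>wreath (grp_of \<Delta>) B \<Phi>\<^esub> \<theta> k"
    using restrict_comp[OF g k] B_app[OF inv_mem[OF g]]
    by (auto simp: \<theta>_def wreath_def inv_into_restrict[OF g] intro!: restrict_ext)
qed

text \<open>\<open>g\<close> and \<open>\<tau> (g b)\<close> differ by an element of
  \<open>N\<close>, which preserves \<open>X\<close>. Together with \<open>block_unique\<close> this
  makes the translates of \<open>X\<close> by the \<open>\<tau> y\<close> a partition of
  \<open>V - W\<close> indexed by \<open>B\<close>.\<close>

lemma block:
  assumes "u \<in> V - W"
  shows "\<exists>y\<in>B. \<exists>x\<in>X. u = \<tau> y x"
proof -
  obtain g x where g: "g \<in> \<Gamma>" "x \<in> X" "u = g x" using X_cover[OF assms] by blast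
  have y: "g b \<in> B" using g by (simp add: orb_def)
  have "pinv (\<tau> (g b)) \<circ> g \<in> N" by (rule N_iff[OF tau(1)[OF y] g(1) orb_self]) (simp add: tau(2)[OF y])
  then have "(pinv (\<tau> (g b)) \<circ> g) x \<in> X" using N_X g by blast
  moreover have "u = \<tau> (g b) ((pinv (\<tau> (g b)) \<circ> g) x)" using g tau(1)[OF y] by simp
  ultimately show ?thesis using y by blast
qed

lemma block_unique:
  assumes "y \<in> B" "z \<in> B" "x \<in> X" "x' \<in> X" "\<tau> y x = \<tau> z x'"
  shows "y = z"
proof -
  have "(pinv (\<tau> z) \<circ> \<tau> y) x = x'" using assms tau(1)[OF assms(2)] by simp
  moreover have "pinv (\<tau> z) \<circ> \<tau> y \<in> \<Gamma>" by (intro comp_mem inv_mem tau assms)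
  ultimately have "pinv (\<tau> z) \<circ> \<tau> y \<in> N" using X_disj assms by blast
  then have "pinv (\<tau> z) y = b" using tau(2)[OF assms(1)] by (simp add: stab_def)
  then show ?thesis using inv_app_eq[OF tau(1)[OF assms(2)]] tau(2)[OF assms(2)] by simp
qed

text \<open>The second component determines \<open>g\<close> on \<open>B\<close>, hence on
  \<open>W\<close>; the coordinate at \<open>g y\<close> determines \<open>g\<close> on the
  translate of \<open>X\<close> by \<open>\<tau> y\<close>; outside \<open>V\<close> every element
  is trivial.\<close>

lemma inj_theta: "inj_on \<theta> \<Gamma>"
proof (rule inj_onI, rule ext)
  fix g k v assume g: "g \<in> \<Gamma>" and k: "k \<in> \<Gamma>" and eq: "\<theta> g = \<theta> k"
  have gk: "g y = k y" if "y \<in> B" for y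
  proof -
    have "restrict g B = restrict k B" using eq by (simp add: \<theta>_def)
    then show ?thesis using that by (metis restrict_apply')
  qed
  consider "v \<in> W" | "v \<in> V - W" | "v \<notin> V" by blast
  then show "g v = k v"
  proof cases
    case 1 then show ?thesis using agree_W[OF g k orb_self gk[OF orb_self]] by blast
  next
    case 2
    obtain y x where y: "y \<in> B" "x \<in> X" "v = \<tau> y x" using block[OF 2] by blast
    have gy: "g y \<in> B" by (rule B_app[OF g y(1)])
    have p: "pinv g (g y) = y" "pinv k (g y) = y" using inv_app[OF g, of y] inv_app[OF k, of y] gk[OF y(1)] by metis+
    have "restr X (cocycle g (g y)) = restr X (cocycle k (g y))"
      using eq gy unfolding \<theta>_def by (metis (no_types, lifting) fst_conv restrict_apply')
    then have "cocycle g (g y) x = cocycle k (g y) x" using y(2) unfolding restr_def by metis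
    then show ?thesis using p y(3) inv_mem[OF tau(1)[OF gy]] by (simp add: cocycle_def)
  next
    case 3 then show ?thesis using permutes_not_in permutes g k by metis
  qed
qed

text \<open>Given \<open>\<delta> \<in> \<Gamma>\<close> and \<open>f y \<in> \<Delta>\<close> for all \<open>y\<close>, patch the elements \<open>\<tau> (\<delta> y) \<circ> f (\<delta> y) \<circ> (\<tau> y)\<^sup>-\<^sup>1\<close>, which all
  agree with \<open>\<delta>\<close> on \<open>W\<close>, along the translates \<open>\<tau> y ` X\<close>.\<close>

lemma surj_theta:
  assumes f: "f \<in> B \<rightarrow>\<^sub>E \<Delta>" and d: "\<delta> \<in> \<Gamma>"
  shows "\<exists>\<pi>\<in>\<Gamma>. \<theta> \<pi> = (f, restrict \<delta> B)"
proof -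
  define \<gamma> where "\<gamma> y = \<tau> (\<delta> y) \<circ> f (\<delta> y) \<circ> pinv (\<tau> y)" for y
  have dy: "\<delta> y \<in> B" if "y \<in> B" for y by (rule B_app[OF d that])
  have fD: "f y \<in> \<Delta>" if "y \<in> B" for y using f that by (rule PiE_mem)
  have fN: "f y \<in> N" if "y \<in> B" for y using Delta_N[OF fD[OF that]] .
  have gam: "\<gamma> y \<in> \<Gamma>" if y: "y \<in> B" for y
    unfolding \<gamma>_def by (intro comp_mem inv_mem tau N_sub fN dy y)
  have gy: "\<gamma> y y = \<delta> y" if y: "y \<in> B" for y
  proof -
    have "pinv (\<tau> y) y = b" using inv_app_eq[OF tau(1)[OF y]] tau(2)[OF y] by simp
    moreover have "f (\<delta> y) b = b" using fN[OF dy[OF y]] by (simp add: stab_def)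
    ultimately show ?thesis using tau(2)[OF dy[OF y]] by (simp add: \<gamma>_def)
  qed
  have gW: "\<gamma> y w = \<delta> w" if "y \<in> B" "w \<in> W" for y w
    using agree_W[OF gam[OF that(1)] d that(1) gy[OF that(1)] that(2)] .
  define blk where "blk u = (SOME y. y \<in> B \<and> (\<exists>x\<in>X. u = \<tau> y x))" for u
  have blk: "blk u \<in> B \<and> (\<exists>x\<in>X. u = \<tau> (blk u) x)" if u: "u \<in> V - W" for u
  proof -
    obtain y where "y \<in> B \<and> (\<exists>x\<in>X. u = \<tau> y x)" using block[OF u] by blast
    then show ?thesis unfolding blk_def by (rule someI)
  qed
  have U_app: "g v \<in> V - W \<longleftrightarrow> v \<in> V - W" if "g \<in> \<Gamma>" for g v
    using V_app_iff[OF that] W_app[OF that, of v] W_app[OF inv_mem[OF that], of "g v"] that by auto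
  have tX: "\<tau> y x \<in> V - W" if "y \<in> B" "x \<in> X" for y x
    using U_app[OF tau(1)[OF that(1)]] that X_sub by blast
  have blk_eq: "blk (\<tau> y x) = y" if "y \<in> B" "x \<in> X" for y x
    using blk[OF tX[OF that]] block_unique that by metis
  have fX: "f y x \<in> X" if "y \<in> B" "x \<in> X" for y x using N_X[OF fN[OF that(1)]] that by blast
  have g_tau: "\<gamma> y (\<tau> y x) = \<tau> (\<delta> y) (f (\<delta> y) x)" if "y \<in> B" for y x
    using tau(1)[OF that] by (simp add: \<gamma>_def)
  define \<pi> where "\<pi> u = (if u \<in> V - W then \<gamma> (blk u) u else \<delta> u)" for u
  have piU: "\<pi> (\<tau> y x) = \<tau> (\<delta> y) (f (\<delta> y) x)" if "y \<in> B" "x \<in> X" for y x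
    using tX[OF that] blk_eq[OF that] g_tau[OF that(1)] by (simp add: \<pi>_def)
  have piW: "\<pi> w = \<delta> w" if "w \<in> W" for w using that by (simp add: \<pi>_def)
  have local: "\<exists>g\<in>\<Gamma>. g v = \<pi> v" for v
    using gam[of "blk v"] blk[of v] d by (cases "v \<in> V - W") (auto simp: \<pi>_def)
  have pV: "\<pi> v \<in> V" if "v \<in> V" for v using local[of v] V_app that by metis
  have pU: "\<pi> v \<in> V - W \<longleftrightarrow> v \<in> V - W" for v using local[of v] U_app by metis
  have inj: "inj_on \<pi> V"
  proof (rule inj_onI)
    fix u v assume uv: "u \<in> V" "v \<in> V" "\<pi> u = \<pi> v"
    show "u = v"
    proof (cases "u \<in> V - W")
      case True
      then have v: "v \<in> V - W" using pU uv(3) by metis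
      obtain y x where u': "y \<in> B" "x \<in> X" "u = \<tau> y x" using block[OF True] by blast
      obtain z x' where v': "z \<in> B" "x' \<in> X" "v = \<tau> z x'" using block[OF v] by blast
      have eq: "\<tau> (\<delta> y) (f (\<delta> y) x) = \<tau> (\<delta> z) (f (\<delta> z) x')" using uv(3) piU u' v' by simp
      then have "\<delta> y = \<delta> z"
        using block_unique[OF dy[OF u'(1)] dy[OF v'(1)] fX[OF dy[OF u'(1)] u'(2)] fX[OF dy[OF v'(1)] v'(2)]] by blast
      then have yz: "y = z" using d by simp
      then have "x = x'" using eq tau(1)[OF dy[OF v'(1)]] N_sub[OF fN[OF dy[OF v'(1)]]] by simp
      then show ?thesis using yz u' v' by simp
    next
      case False
      then have v: "v \<notin> V - W" using pU uv(3) by metis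
      have "\<delta> u = \<delta> v" using uv(3) unfolding \<pi>_def if_not_P[OF False] if_not_P[OF v] .
      then show ?thesis using d by simp
    qed
  qed
  have "\<pi> permutes V"
  proof (rule inj_imp_permutes[OF inj finV pV])
    show "\<pi> v = v" if "v \<notin> V" for v
      using that permutes_not_in[OF permutes[OF d]] by (simp add: \<pi>_def)
  qed
  then have "\<pi> \<in> \<Gamma>"
  proof (rule closed)
    show "\<exists>g\<in>\<Gamma>. g v = \<pi> v" for v by (rule local)
    \<comment> \<open>An edge at the translate of \<open>X\<close> by \<open>\<tau> y\<close> ends
      in the same translate or in \<open>W\<close>, and \<open>\<gamma> y\<close> agrees with
      \<open>\<pi>\<close> on both. This is why the coordinates of \<open>f\<close> can be chosen
      independently.\<close>
    have main: "\<exists>g\<in>\<Gamma>. g u = \<pi> u \<and> g v = \<pi> v" if uv: "(u, v) \<in> E" and u: "u \<in> V - W" for u v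
    proof -
      obtain y x where y: "y \<in> B" "x \<in> X" "u = \<tau> y x" using block[OF u] by blast
      have vV: "v \<in> V" using uv E_sub by blast
      have "(\<tau> y x, \<tau> y (pinv (\<tau> y) v)) \<in> E" using uv y tau(1)[OF y(1)] by simp
      then have "(x, pinv (\<tau> y) v) \<in> E" using E_app_iff[OF tau(1)[OF y(1)]] by blast
      then have "pinv (\<tau> y) v \<in> X \<union> W" by (rule X_edge[OF _ y(2)])
      moreover have "v = \<tau> y (pinv (\<tau> y) v)" using tau(1)[OF y(1)] by simp
      ultimately have "(\<exists>x'\<in>X. v = \<tau> y x') \<or> v \<in> W"
        using W_app[OF tau(1)[OF y(1)]] by (metis Un_iff)
      then have "\<gamma> y v = \<pi> v"
        using y piU g_tau gW piW by auto
      moreover have "\<gamma> y u = \<pi> u" using y piU g_tau by simp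
      ultimately show ?thesis using gam[OF y(1)] by blast
    qed
    fix u v assume uv: "(u, v) \<in> E"
    then have V: "u \<in> V" "v \<in> V" using E_sub by auto
    consider "u \<in> V - W" | "v \<in> V - W" | "u \<in> W" "v \<in> W" using V by blast
    then show "\<exists>g\<in>\<Gamma>. g u = \<pi> u \<and> g v = \<pi> v"
    proof cases
      case 1 then show ?thesis using main uv by blast
    next
      case 2 then show ?thesis using main[OF symD[OF symE uv]] by blast
    next
      case 3 then show ?thesis using piW d by auto
    qed
  qed
  moreover have "\<theta> \<pi> = (f, restrict \<delta> B)"
  proof -
    have piB: "\<pi> y = \<delta> y" if "y \<in> B" for y using piW B_W that by blast
    then have 1: "restrict \<pi> B = restrict \<delta> B" by (intro restrict_ext)
    have "restr X (cocycle \<pi> y) = f y" if y: "y \<in> B" for y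
    proof
      fix x
      define y' where "y' = pinv \<delta> y"
      have y': "y' \<in> B" "\<delta> y' = y" using B_app[OF inv_mem[OF d] y] d by (simp_all add: y'_def)
      have p: "pinv \<pi> y = y'" using inv_app_eq[OF \<open>\<pi> \<in> \<Gamma>\<close>] piB y' by simp
      show "restr X (cocycle \<pi> y) x = f y x"
      proof (cases "x \<in> X")
        case True
        then show ?thesis using piU[OF y'(1) True] y'(2) tau(1)[OF y] by (simp add: restr_def cocycle_def p)
      next
        case False
        have "f y permutes X" using fD[OF y] by (simp add: \<Delta>_def)
        then show ?thesis using False by (simp add: restr_def permutes_not_in)
      qed
    qed
    then have "(\<lambda>y\<in>B. restr X (cocycle \<pi> y)) = restrict f B" by (intro restrict_ext)
    then show ?thesis using 1 PiE_restrict[OF f] by (simp add: \<theta>_def)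
  qed
  ultimately show ?thesis by blast
qed

lemma wreath_decomposition: "grp_of \<Gamma> \<cong> wreath (grp_of \<Delta>) B \<Phi>"
proof (rule is_isoI, rule isoI[OF hom_theta], rule bij_betw_imageI)
  show "inj_on \<theta> (carrier (grp_of \<Gamma>))" using inj_theta by simp
  show "\<theta> ` carrier (grp_of \<Gamma>) = carrier (wreath (grp_of \<Delta>) B \<Phi>)"
  proof (intro equalityI subsetI)
    fix x assume "x \<in> carrier (wreath (grp_of \<Delta>) B \<Phi>)"
    then obtain f \<delta> where "x = (f, restrict \<delta> B)" "f \<in> B \<rightarrow>\<^sub>E \<Delta>" "\<delta> \<in> \<Gamma>"
      by (auto simp: wreath_def \<Phi>_def)
    then show "x \<in> \<theta> ` carrier (grp_of \<Gamma>)" using surj_theta[of f \<delta>] by force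
  qed (use hom_theta in \<open>auto simp: hom_def\<close>)
qed

end

section \<open>The wreath data of a connected graph\<close>

context closed_action
begin

lemma connected_wreath:
  assumes conn: "conn E V" and ne: "V \<noteq> {}"
  shows "\<exists>b W X. wreath_action \<Gamma> r h V E b W X"
proof -
  obtain v0 where "v0 \<in> V" using ne by blast
  then obtain b where b: "b \<in> V" and min: "\<And>v. v \<in> V \<Longrightarrow> card (orb \<Gamma> b) \<le> card (orb \<Gamma> v)"
    using ex_has_least_nat[of "\<lambda>v. v \<in> V" v0 "\<lambda>v. card (orb \<Gamma> v)"] by blast
  obtain \<psi> where ret: "retract \<psi>" and im: "\<psi> ` V = orb \<Gamma> b"
    using retraction_on_orbit[OF conn b min] by blast
  interpret Q: sparse_action \<Gamma> r h "orb \<Gamma> b" "quot \<psi> E"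
    using retract_action[OF ret] unfolding im .
  have connQ: "conn (quot \<psi> E) (orb \<Gamma> b)" using conn_quot[OF conn, of \<psi>] unfolding im .
  have transQ: "v \<in> orb \<Gamma> u" if "u \<in> orb \<Gamma> b" "v \<in> orb \<Gamma> b" for u v using that orb_eq by blast
  have regular: "g z = z" if "g \<in> \<Gamma>" "y \<in> orb \<Gamma> b" "g y = y" "z \<in> orb \<Gamma> b" for g y z
    using Q.stab_transitive[OF connQ, of g y z] transQ that by blast
  have commute: "g (k y) = k (g y)" if "g \<in> \<Gamma>" "k \<in> \<Gamma>" "y \<in> orb \<Gamma> b" for g k y
    using Q.commute_on[OF connQ, of g k y] transQ that by blast
  let ?N = "stab \<Gamma> b"
  define W where "W = {v \<in> V. \<forall>n\<in>?N. n v = v}"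
  define U where "U = V - W"
  have NG: "?N \<subseteq> \<Gamma>" by (auto simp: stab_def)
  have in_N: "g \<in> ?N" if "g \<in> \<Gamma>" "y \<in> orb \<Gamma> b" "g y = y" for g y
    using regular[OF that orb_self] that(1) by (simp add: stab_def)
  have N_B: "n y = y" if "n \<in> ?N" "y \<in> orb \<Gamma> b" for n y
    using regular[of n b y] that orb_self by (auto simp: stab_def)
  have normal: "pinv g \<circ> n \<circ> g \<in> ?N" if g: "g \<in> \<Gamma>" and n: "n \<in> ?N" for g n
  proof -
    have "g b \<in> orb \<Gamma> b" using g unfolding orb_def by (rule imageI)
    then have "n (g b) = g b" by (rule N_B[OF n])
    moreover have "pinv g \<circ> n \<circ> g \<in> \<Gamma>" by (intro comp_mem inv_mem g subsetD[OF NG n])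
    ultimately show ?thesis using g by (simp add: stab_def)
  qed
  have W_app: "g v \<in> W" if g: "g \<in> \<Gamma>" and v: "v \<in> W" for g v
  proof -
    have "n (g v) = g v" if n: "n \<in> ?N" for n
    proof -
      have "(pinv g \<circ> n \<circ> g) v = v" using normal[OF g n] v W_def by blast
      then show ?thesis using g by (simp add: inv_app_eq)
    qed
    then show ?thesis using g v V_app by (auto simp: W_def)
  qed
  have U_app: "g v \<in> U \<longleftrightarrow> v \<in> U" if g: "g \<in> \<Gamma>" for g v
    using V_app_iff[OF g] W_app[OF g, of v] W_app[OF inv_mem[OF g], of "g v"] g by (auto simp: U_def)
  \<comment> \<open>The equivariant \<open>\<psi>\<close> carries a fixed point of \<open>g\<close>
    to a fixed point in the orbit of \<open>b\<close>, where the action is regular.\<close>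
  have free: "g \<in> ?N" if g: "g \<in> \<Gamma>" "w \<in> W" "g w = w" for g w
  proof -
    have w: "w \<in> V" using g by (simp add: W_def)
    then have "g (\<psi> w) = \<psi> w" using ret g by (metis retract_def)
    moreover have "\<psi> w \<in> orb \<Gamma> b" using w im by blast
    ultimately show ?thesis using in_N g by blast
  qed
  have bW: "b \<in> W" using b by (auto simp: W_def stab_def)
  have WV: "W \<subseteq> V" by (auto simp: W_def)
  have NK: "n ` K = K" if n: "n \<in> ?N" and K: "component E U K" for n K
    by (rule component_fixed[OF WV]) (use n K NG in \<open>auto simp: W_def U_def\<close>)
  have stab_K: "g \<in> ?N" if K: "component E U K" and g: "g \<in> \<Gamma>" "g ` K = K" for g K
  proof -
    have K': "K \<subseteq> V - W" "conn E K" "K \<noteq> {}" using K by (auto simp: component_def U_def)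
    \<comment> \<open>Otherwise no edge leaves \<open>K\<close>, and connectedness would put
      \<open>b\<close> into \<open>K\<close>, although \<open>b\<close> lies in
      \<open>W\<close>.\<close>
    have "\<exists>x w. (x, w) \<in> E \<and> x \<in> K \<and> w \<in> W"
    proof (rule ccontr)
      assume no: "\<not> ?thesis"
      obtain x where x: "x \<in> K" using K' by blast
      have "b \<in> K"
      proof (rule conn_closed[OF conn _ b x])
        show "x \<in> V" using x K' by blast
        fix u v assume "(u, v) \<in> E" "v \<in> V" "u \<in> K"
        then show "v \<in> K" using no component_closed[OF K, of u v] by (auto simp: U_def)
      qed
      then show False using bW K' by blast
    qed
    then obtain x w where xw: "(x, w) \<in> E" "x \<in> K" "w \<in> W" by blast
    show ?thesis
    proof (rule component_stabiliser[OF perm_grp_stab NG _ W_def _ K'(1,2) _ xw g])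
      show "pinv k \<circ> n \<circ> k \<in> ?N" if "k \<in> \<Gamma>" "n \<in> ?N" for k n using that by (rule normal)
      show "k \<in> ?N" if "k \<in> \<Gamma>" "v \<in> W" "k v = v" for k v using that by (rule free)
      show "n ` K = K" if "n \<in> ?N" for n using that K by (rule NK)
    qed
  qed
  define Orb where "Orb K = (\<lambda>g. g ` K) ` \<Gamma>" for K
  \<comment> \<open>The choice depends on \<open>Orb K\<close> alone, so all components in one orbit
    get the same representative, and \<open>rep\<close> is idempotent.\<close>
  define rep where "rep K = (SOME L. L \<in> Orb K)" for K :: "'a set"
  have rep: "\<exists>g\<in>\<Gamma>. rep K = g ` K" for K
  proof -
    have "id ` K \<in> Orb K" unfolding Orb_def using id_mem by (rule imageI)
    then have "rep K \<in> Orb K" unfolding rep_def by (rule someI)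
    then show ?thesis by (auto simp: Orb_def)
  qed
  have Orb_sub: "Orb (g ` K) \<subseteq> Orb K" if g: "g \<in> \<Gamma>" for g K
  proof
    fix L assume "L \<in> Orb (g ` K)"
    then obtain k where "k \<in> \<Gamma>" "L = k ` (g ` K)" by (auto simp: Orb_def)
    then have "L = (k \<circ> g) ` K" "k \<circ> g \<in> \<Gamma>" using g comp_mem by (auto simp: image_comp)
    then show "L \<in> Orb K" unfolding Orb_def by blast
  qed
  have Orb_eq: "Orb (g ` K) = Orb K" if g: "g \<in> \<Gamma>" for g K
  proof -
    have "pinv g ` (g ` K) = K" using g by (simp add: image_image)
    then show ?thesis using Orb_sub[OF g, of K] Orb_sub[OF inv_mem[OF g], of "g ` K"] by simp
  qed
  have rep_eq: "rep (g ` K) = rep K" if "g \<in> \<Gamma>" for g K using Orb_eq[OF that] by (simp add: rep_def)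
  have rep_rep: "rep (rep K) = rep K" for K using rep[of K] rep_eq by metis
  have rep_comp: "component E U (rep K)" if K: "component E U K" for K
  proof -
    obtain g where g: "g \<in> \<Gamma>" "rep K = g ` K" using rep by blast
    show ?thesis unfolding g(2) by (rule component_image[OF g(1) U_app[OF g(1)] K])
  qed
  define X where "X = (\<Union>K\<in>{K. component E U K}. rep K)"
  have X: "\<exists>L. component E U L \<and> rep L = L \<and> L \<subseteq> X \<and> x \<in> L" if x: "x \<in> X" for x
  proof -
    obtain K where "component E U K" "x \<in> rep K" using x by (auto simp: X_def)
    then show ?thesis using rep_comp rep_rep unfolding X_def by blast
  qed
  have "wreath_action \<Gamma> r h V E b W X"
  proof
    show "W = {v \<in> V. \<forall>n\<in>?N. n v = v}" by (rule W_def)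
    show "X \<subseteq> V - W"
    proof
      fix x assume "x \<in> X"
      then show "x \<in> V - W" using X[of x] by (auto simp: component_def U_def)
    qed
    show "n ` X = X" if n: "n \<in> ?N" for n
    proof -
      have "n ` rep K = rep K" if "component E U K" for K using NK[OF n rep_comp[OF that]] .
      then show ?thesis unfolding X_def by (simp add: image_UN)
    qed
    show "g \<in> ?N" if g: "g \<in> \<Gamma>" and x: "x \<in> X" "g x \<in> X" for g x
    proof -
      obtain L where L: "component E U L" "rep L = L" "x \<in> L" using X[OF x(1)] by blast
      obtain M where M: "component E U M" "rep M = M" "g x \<in> M" using X[OF x(2)] by blast
      have "component E U (g ` L)" by (rule component_image[OF g U_app[OF g] L(1)])
      then have eq: "g ` L = M" using component_eq[OF _ M(1), of "g ` L" "g x"] L M by blast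
      then have "M = L" using rep_eq[OF g, of L] L(2) M(2) by simp
      then show ?thesis using stab_K[OF L(1) g] eq by simp
    qed
    show "\<exists>g\<in>\<Gamma>. \<exists>x\<in>X. u = g x" if u: "u \<in> V - W" for u
    proof -
      obtain K where K: "component E U K" "u \<in> K" using ex_component[OF symE, of u U] u by (auto simp: U_def)
      obtain g where g: "g \<in> \<Gamma>" "rep K = g ` K" using rep by blast
      have "g u \<in> X" using g K unfolding X_def by blast
      moreover have "u = pinv g (g u)" using g by simp
      ultimately show ?thesis using inv_mem[OF g(1)] by blast
    qed
    show "v \<in> X \<union> W" if uv: "(u, v) \<in> E" and u: "u \<in> X" for u v
    proof -
      obtain L where L: "component E U L" "L \<subseteq> X" "u \<in> L" using X[OF u] by blast
      have "v \<in> V" using uv E_sub by blast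
      then show ?thesis using component_closed[OF L(1) uv L(3)] L(2) by (auto simp: U_def)
    qed
  qed (fact b regular commute W_app)+
  then show ?thesis by blast
qed

end

text \<open>The group, the graph and the vertex set vary in the induction, while \<open>r\<close>
  and \<open>h\<close> stay. The vertex set shrinks to \<open>X\<close>, which misses
  \<open>b\<close>, in the connected case, and to \<open>K\<close> and \<open>V - K\<close> in the
  disconnected case.\<close>

lemma closed_action_built_from_abelian:
  fixes V :: "nat set"
  assumes "closed_action \<Gamma> r h V E"
  shows "built_from_abelian (grp_of \<Gamma>)"
  using assms
proof (induction "card V" arbitrary: V \<Gamma> E rule: less_induct)
  case less
  interpret closed_action \<Gamma> r h V E by (rule less.prems)
  have smaller: "built_from_abelian (grp_of {g \<in> \<Gamma>. g permutes X})" if X: "X \<subset> V" for X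
    by (rule less.hyps[OF psubset_card_mono[OF finV X] subset_action]) (use X in blast)
  have fin_sub: "finite {g \<in> \<Gamma>. g permutes X}" for X using fin by simp
  show ?case
  proof (cases "V = {}")
    case True
    have "g = id" if "g \<in> \<Gamma>" for g using permutes[OF that] True by simp
    then have "comm_group (grp_of \<Gamma>)"
      by (intro group.group_comm_groupI[OF group_grp_of]) auto
    then show ?thesis by (rule built_from_abelian_comm) (simp add: fin)
  next
    case ne: False
    show ?thesis
    proof (cases "conn E V")
      case True
      then obtain b W X where "wreath_action \<Gamma> r h V E b W X" using connected_wreath ne by blast
      then interpret W: wreath_action \<Gamma> r h V E b W X .
      have "b \<notin> X" using W.X_sub W.B_W orb_self by blast
      then have "X \<subset> V" using W.X_sub W.b by blast
      then have "built_from_abelian (grp_of W.\<Delta>)" unfolding W.\<Delta>_def by (rule smaller)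
      then have "built_from_abelian (wreath (grp_of W.\<Delta>) W.B W.\<Phi>)"
        by (intro built_from_abelian_wreath W.subgroup_Phi W.comm_group_Phi finite_orb)
          (simp_all add: W.\<Delta>_def W.\<Phi>_def fin)
      then show ?thesis using W.wreath_decomposition built_from_abelian_iso by blast
    next
      case False
      obtain v where "v \<in> V" using ne by blast
      then obtain K where K: "component E V K" "v \<in> K" using ex_component[OF symE] by blast
      then have "K \<noteq> V" using False by (auto simp: component_def)
      then have sub: "K \<subset> V" "V - K \<subset> V" using K \<open>v \<in> V\<close> by (auto simp: component_def)
      have grp: "group (grp_of {g \<in> \<Gamma>. g permutes X})" if "X \<subseteq> V" for X
      proof -
        interpret X: closed_action "{g \<in> \<Gamma>. g permutes X}" r h X "E \<inter> X \<times> X" by (rule subset_action[OF that])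
        show ?thesis by (rule X.group_grp_of)
      qed
      have "built_from_abelian (grp_of {g \<in> \<Gamma>. g permutes K} \<times>\<times> grp_of {g \<in> \<Gamma>. g permutes (V - K)})"
        by (intro built_from_abelian_DirProd grp smaller sub) (use sub fin in auto)
      then show ?thesis using direct_product[OF K(1)] built_from_abelian_iso by blast
    qed
  qed
qed

section \<open>Automorphism groups of graphs\<close>

lemma rtrancl_on_iff: "(x, y) \<in> rtrancl_on A R \<longleftrightarrow> x \<in> A \<and> (x, y) \<in> (R \<inter> A \<times> A)\<^sup>*"
proof
  assume "(x, y) \<in> rtrancl_on A R"
  then show "x \<in> A \<and> (x, y) \<in> (R \<inter> A \<times> A)\<^sup>*"
  proof (induction rule: rtrancl_on_induct)
    case (step y z)
    then have "(y, z) \<in> R \<inter> A \<times> A" by blast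
    then show ?case using step.IH by (auto intro: rtrancl_into_rtrancl)
  qed simp
next
  assume a: "x \<in> A \<and> (x, y) \<in> (R \<inter> A \<times> A)\<^sup>*"
  then have "(x, y) \<in> (R \<inter> A \<times> A)\<^sup>*" by simp
  then show "(x, y) \<in> rtrancl_on A R"
  proof (induction rule: rtrancl_induct)
    case base then show ?case using a by simp
  next
    case (step y z) then show ?case by (auto intro: rtrancl_on_into_rtrancl_on)
  qed
qed

lemma connected_induce_iff:
  assumes "sym (parcs G)"
  shows "Digraph_Component.connected (with_proj G \<restriction> A) \<longleftrightarrow> A \<noteq> {} \<and> conn (parcs G) A"
proof -
  let ?R = "parcs (mk_symmetric (with_proj G \<restriction> A))"
  have "?R = parcs G \<inter> A \<times> A"
    using assms by (auto simp: mk_symmetric_def dest: symD)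
  moreover have "pverts (mk_symmetric (with_proj G \<restriction> A)) = A" by (simp add: mk_symmetric_def)
  moreover have "parcs G \<inter> A \<times> A \<inter> A \<times> A = parcs G \<inter> A \<times> A" by blast
  ultimately show ?thesis
    by (auto simp: Digraph_Component.connected_def strongly_connected_def reachable_def rtrancl_on_iff conn_def)
qed

section \<open>Complete minors in the two formulations\<close>

definition off_diag :: "nat \<Rightarrow> (nat \<times> nat) set" where
  "off_diag n = {(i, j). i \<in> {..<n} \<and> j \<in> {..<n} \<and> i \<noteq> j}"

lemma minor_of_if_is_minor:
  assumes "sym (parcs G)" "is_minor (complete_graph n) G"
  shows "minor_of {..<n} (off_diag n) (pverts G) (parcs G)"
proof -
  obtain P S where P: "partition_on (pverts G) P"
    and con: "\<forall>A\<in>P. Digraph_Component.connected (with_proj G \<restriction> A)"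
    and S: "subgraph S (with_proj (contraction G P))" and iso: "digraph_iso (with_proj (complete_graph n)) S"
    using assms(2) unfolding is_minor_def by (elim exE conjE)
  obtain f where f: "pre_digraph.digraph_isomorphism (with_proj (complete_graph n)) f"
    and Sf: "S = app_iso f (with_proj (complete_graph n))"
    using iso unfolding digraph_iso_def by (elim exE conjE)
  let ?A = "iso_verts f"
  have inj: "inj_on ?A {..<n}"
    using f unfolding pre_digraph.digraph_isomorphism_def by (simp add: complete_graph_def)
  have mem: "?A j \<in> P" if "j < n" for j
  proof -
    have "verts S \<subseteq> P" using S by (simp add: subgraph_def contraction_def)
    moreover have "?A j \<in> verts S" using that unfolding Sf by (simp add: complete_graph_def)
    ultimately show ?thesis by blast
  qed
  \<comment> \<open>Compatibility with the contraction forces the tail and head maps of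
    \<open>S\<close> to be \<open>fst\<close> and \<open>snd\<close>, so the image of an arc is the
    pair of images of its ends.\<close>
  have tail: "iso_tail f = fst" "iso_head f = snd"
    using S unfolding subgraph_def compatible_def Sf by simp_all
  have arc: "(?A i, ?A j) \<in> parcs (contraction G P)" if "(i, j) \<in> off_diag n" for i j
  proof -
    let ?e = "iso_arcs f (i, j)"
    have e: "(i, j) \<in> parcs (complete_graph n)" using that by (simp add: complete_graph_def off_diag_def)
    then have "?e \<in> arcs S" unfolding Sf by simp
    moreover have "arcs S \<subseteq> parcs (contraction G P)" using S by (simp add: subgraph_def)
    ultimately have "?e \<in> parcs (contraction G P)" by blast
    moreover have "fst ?e = ?A i" "snd ?e = ?A j"
      using f e unfolding pre_digraph.digraph_isomorphism_def by (auto simp: tail)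
    ultimately show ?thesis by (metis prod.collapse)
  qed
  show ?thesis
  proof (rule minor_ofI[where A = ?A])
    show "off_diag n \<subseteq> {..<n} \<times> {..<n}" by (auto simp: off_diag_def)
    fix j assume j: "j \<in> {..<n}"
    then have "?A j \<in> P" using mem by simp
    then show "?A j \<subseteq> pverts G" using P by (auto simp: partition_on_def)
    show "?A j \<noteq> {}" "conn (parcs G) (?A j)"
      using con \<open>?A j \<in> P\<close> connected_induce_iff[OF assms(1), of "?A j"] by auto
  next
    fix i j x assume ij: "i \<in> {..<n}" "j \<in> {..<n}" "x \<in> ?A i" "x \<in> ?A j"
    have "?A i = ?A j"
      using partition_onD2[OF P] mem[of i] mem[of j] ij by (auto simp: disjoint_def)
    then show "i = j" using inj ij by (auto dest: inj_onD)
  next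
    fix i j assume "(i, j) \<in> off_diag n"
    then show "\<exists>u\<in>?A i. \<exists>v\<in>?A j. (u, v) \<in> parcs G" using arc by (auto simp: contraction_def)
  qed
qed

lemma is_minor_if_minor_of:
  assumes "sym (parcs G)" "minor_of {..<n} (off_diag n) (pverts G) (parcs G)"
  shows "is_minor (complete_graph n) G"
proof -
  let ?V = "pverts G" and ?E = "parcs G"
  obtain A where A: "\<forall>i\<in>{..<n}. A i \<subseteq> ?V" "\<forall>i\<in>{..<n}. A i \<noteq> {}" "\<forall>i\<in>{..<n}. conn ?E (A i)"
      "\<forall>i\<in>{..<n}. \<forall>j\<in>{..<n}. \<forall>x. x \<in> A i \<longrightarrow> x \<in> A j \<longrightarrow> i = j"
      "\<forall>i j. (i, j) \<in> off_diag n \<longrightarrow> (\<exists>u\<in>A i. \<exists>v\<in>A j. (u, v) \<in> ?E)"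
    using minor_ofD[OF assms(2)] by (elim conjE exE)
  have inj: "i = j" if "A i = A j" "i < n" "j < n" for i j
  proof -
    obtain x where "x \<in> A i" using A(2) \<open>i < n\<close> by blast
    then show ?thesis using A(4) that by (metis lessThan_iff)
  qed
  \<comment> \<open>Vertices outside all branch sets become singleton parts. A minor is only a
    subgraph of the contraction, so the copy of the complete graph may leave them out.\<close>
  define R where "R = ?V - (\<Union>i\<in>{..<n}. A i)"
  define P where "P = A ` {..<n} \<union> (\<lambda>v. {v}) ` R"
  have part: "partition_on ?V P"
  proof (rule partition_onI)
    show "\<Union>P = ?V" using A(1) by (auto simp: P_def R_def)
    show "{} \<notin> P" using A(2) by (auto simp: P_def)
    fix p q assume pq: "p \<in> P" "q \<in> P" "p \<noteq> q"
    have "p = q" if x: "x \<in> p" "x \<in> q" for x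
    proof (cases "x \<in> R")
      case True
      then show ?thesis using pq x by (auto simp: P_def R_def)
    next
      case False
      then obtain i j where "i < n" "p = A i" "j < n" "q = A j" using pq x by (auto simp: P_def)
      then show ?thesis using A(4) x by (metis lessThan_iff)
    qed
    then show "disjnt p q" using pq by (auto simp: disjnt_def)
  qed
  have con: "Digraph_Component.connected (with_proj G \<restriction> p)" if "p \<in> P" for p
    using that A(2,3) unfolding connected_induce_iff[OF assms(1)] P_def by (auto simp: conn_singleton)
  define f where "f = \<lparr>iso_verts = A, iso_arcs = map_prod A A, iso_head = snd, iso_tail = fst\<rparr>"
  let ?K = "with_proj (complete_graph n)"
  have wfK: "wf_digraph ?K" by unfold_locales (auto simp: complete_graph_def)
  have "pre_digraph.digraph_isomorphism ?K f"
    unfolding pre_digraph.digraph_isomorphism_def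
  proof (intro conjI ballI)
    show "wf_digraph ?K" by (rule wfK)
    show "inj_on (iso_verts f) (verts ?K)" using inj by (auto simp: f_def complete_graph_def inj_on_def)
    show "inj_on (iso_arcs f) (arcs ?K)" using inj by (auto simp: f_def complete_graph_def inj_on_def)
  qed (auto simp: f_def)
  then have iso: "digraph_iso ?K (app_iso f ?K)" unfolding digraph_iso_def by blast
  have arcs: "map_prod A A ` parcs (complete_graph n) \<subseteq> parcs (contraction G P)"
  proof
    fix e assume "e \<in> map_prod A A ` parcs (complete_graph n)"
    then obtain i j where e: "e = (A i, A j)" and ij: "i < n" "j < n" "i \<noteq> j"
      by (auto simp: complete_graph_def)
    then have "(i, j) \<in> off_diag n" by (simp add: off_diag_def)
    then have "\<exists>u\<in>A i. \<exists>v\<in>A j. (u, v) \<in> ?E" using A(5) by blast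
    moreover have "A i \<noteq> A j" using inj ij by blast
    ultimately show "e \<in> parcs (contraction G P)" using e ij by (auto simp: contraction_def P_def)
  qed
  have "subgraph (app_iso f ?K) (with_proj (contraction G P))"
    unfolding subgraph_def
  proof (intro conjI)
    show "verts (app_iso f ?K) \<subseteq> verts (with_proj (contraction G P))"
      by (auto simp: f_def complete_graph_def contraction_def P_def)
    show "arcs (app_iso f ?K) \<subseteq> arcs (with_proj (contraction G P))" using arcs by (simp add: f_def)
    show "wf_digraph (with_proj (contraction G P))" by unfold_locales (auto simp: contraction_def)
    show "wf_digraph (app_iso f ?K)"
      by unfold_locales (auto simp: f_def complete_graph_def)
    show "compatible (with_proj (contraction G P)) (app_iso f ?K)" by (simp add: compatible_def f_def)
  qed
  then show ?thesis unfolding is_minor_def using part con iso by blast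
qed

section \<open>Sparseness and large divisors from the hypotheses on the graph\<close>

lemma sum_out_degree:
  assumes "finite F" "F \<subseteq> J \<times> J" "finite J"
  shows "(\<Sum>v\<in>J. out_degree (with_proj \<lparr>pverts = J, parcs = F\<rparr>) v) = card F"
proof -
  have "card F = (\<Sum>e\<in>F. 1)" by simp
  also have "\<dots> = (\<Sum>v\<in>J. \<Sum>e\<in>{e \<in> F. fst e = v}. 1)"
    by (rule sum.group[symmetric]) (use assms in auto)
  finally show ?thesis by (simp add: out_degree_def out_arcs_def)
qed

text \<open>A minor of \<open>G\<close> has no complete minor on \<open>h + 1\<close> vertices
  either, so the Kostochka bound applies to the minor itself, whose degree sum is
  \<open>card F\<close>.\<close>

lemma sparse_if_kostochka:
  assumes "kostochka_constant a" "h \<ge> 1" "sym (parcs G)" "\<not> is_minor (complete_graph (h + 1)) G"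
  shows "sparse (a * real h * sqrt (ln (real h))) h (pverts G) (parcs G)"
  unfolding sparse_def
proof (intro allI impI conjI)
  fix J :: "nat set" and F
  assume J: "finite J" and F: "sym F" "irrefl F" and m: "minor_of J F (pverts G) (parcs G)"
  let ?H = "\<lparr>pverts = J, parcs = F\<rparr>"
  have FJ: "F \<subseteq> J \<times> J" using m by (simp add: minor_of_def)
  then have finF: "finite F" using J finite_subset by blast
  have no: "\<not> minor_of {..<h + 1} (off_diag (h + 1)) J F"
  proof
    assume "minor_of {..<h + 1} (off_diag (h + 1)) J F"
    then have "minor_of {..<h + 1} (off_diag (h + 1)) (pverts G) (parcs G)" using m by (rule minor_of_trans)
    then show False using is_minor_if_minor_of[OF assms(3)] assms(4) by blast
  qed
  have "pair_graph ?H"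
    by unfold_locales (use FJ J finF F in \<open>auto simp: symmetric_def irrefl_def\<close>)
  moreover have "\<not> is_minor (complete_graph (h + 1)) ?H"
    using no minor_of_if_is_minor[of ?H "h + 1"] F(1) by auto
  ultimately have "average_degree ?H \<le> a * real h * sqrt (ln (real h))"
    using assms(1,2) unfolding kostochka_constant_def by blast
  moreover have "average_degree ?H = real (card F) / real (card J)"
    using sum_out_degree[OF finF FJ J] by (simp add: average_degree_def flip: of_nat_sum)
  ultimately have *: "real (card F) / real (card J) \<le> a * real h * sqrt (ln (real h))" by simp
  \<comment> \<open>For empty \<open>J\<close> the quotient is 0 by convention and says nothing
    about \<open>F\<close>, but then \<open>F\<close> is empty too.\<close>
  show "real (card F) \<le> a * real h * sqrt (ln (real h)) * real (card J)"
  proof (cases "J = {}")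
    case True then show ?thesis using FJ by simp
  next
    case False
    then have "real (card J) > 0" using J by (simp add: card_gt_0_iff)
    then show ?thesis using * by (simp add: pos_divide_le_eq)
  qed
  show "\<not> (card J = Suc h \<and> F = {(i, j). i \<in> J \<and> j \<in> J \<and> i \<noteq> j})"
  proof
    assume c: "card J = Suc h \<and> F = {(i, j). i \<in> J \<and> j \<in> J \<and> i \<noteq> j}"
    then obtain e where e: "bij_betw e {..<Suc h} J"
      using J by (metis card_lessThan finite_lessThan finite_same_card_bij)
    have "minor_of {..<h + 1} (off_diag (h + 1)) J F"
    proof (rule minor_ofI[where A = "\<lambda>i. {e i}"])
      fix i j assume "(i, j) \<in> off_diag (h + 1)"
      then have "e i \<in> J" "e j \<in> J" "e i \<noteq> e j"
        using e by (auto simp: off_diag_def bij_betw_def inj_on_def)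
      then show "\<exists>u\<in>{e i}. \<exists>v\<in>{e j}. (u, v) \<in> F" using c by simp
    qed (use e in \<open>auto simp: off_diag_def conn_singleton bij_betw_def inj_on_def\<close>)
    then show False using no by blast
  qed
qed

lemma large_divisors:
  assumes "kostochka_constant a" "h \<ge> 1" "n > 0"
    and primes: "\<forall>p \<in> prime_factors n. int p > max (alpha a h) 2"
    and d: "d dvd n" "d \<noteq> 1"
  shows "a * real h * sqrt (ln (real h)) < real d \<and> h < d \<and> 2 < d"
proof -
  let ?r = "a * real h * sqrt (ln (real h))"
  obtain p where p: "prime p" "p dvd d" using d(2) prime_factor_nat by blast
  have "d > 0" using d(1) assms(3) by (metis dvd_pos_nat)
  then have "p \<le> d" using p(2) by (simp add: dvd_imp_le)
  have "p \<in> prime_factors n" using p d(1) assms(3) by (intro prime_factorsI) (auto dest: dvd_trans)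
  then have al: "alpha a h < int p" "2 < p" using primes by auto
  then have "?r < real p" unfolding alpha_def by linarith
  \<comment> \<open>For \<open>h \<ge> 3\<close> the logarithm is at least 1, because
    \<open>exp 1 \<le> 3\<close>, so the degree bound is at least \<open>h\<close>. For smaller
    \<open>h\<close> the bound 2 on the primes takes over.\<close>
  moreover have "h < p"
  proof (cases "h \<le> 2")
    case True then show ?thesis using al(2) by simp
  next
    case False
    have a: "1 \<le> a" using assms(1) by (simp add: kostochka_constant_def)
    have "exp 1 \<le> (3 :: real)" using exp_le by simp
    then have "exp 1 \<le> real h" using False by simp
    then have "1 \<le> ln (real h)" using False by (simp add: ln_ge_iff)
    then have "1 \<le> sqrt (ln (real h))" by simp
    then have "1 * real h * 1 \<le> ?r" using a by (intro mult_mono) auto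
    then show ?thesis using \<open>?r < real p\<close> by simp
  qed
  ultimately show ?thesis using \<open>p \<le> d\<close> al(2) by simp
qed

text \<open>Vertices are renamed to natural numbers because \<^const>\<open>abelian_wreath_class\<close> only admits wreath
  products over sets of natural numbers.\<close>

definition nat_auts :: "nat set \<Rightarrow> (nat \<times> nat) set \<Rightarrow> (nat \<Rightarrow> nat) set" where
  "nat_auts V E = {\<pi>. \<pi> permutes V \<and> (\<forall>(u, v)\<in>E. (\<pi> u, \<pi> v) \<in> E)}"

lemma nat_auts_edge: "g \<in> nat_auts V E \<Longrightarrow> (u, v) \<in> E \<Longrightarrow> (g u, g v) \<in> E"
  by (auto simp: nat_auts_def)

text \<open>Edges are required to be preserved in one direction; inverses inherit this because an
  injective self-map of the finite edge set is onto.\<close>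

lemma perm_grp_nat_auts:
  assumes "finite V" "E \<subseteq> V \<times> V"
  shows "perm_grp (nat_auts V E)"
proof
  have finE: "finite E" using assms finite_subset by blast
  show "finite (nat_auts V E)"
    by (rule finite_subset[OF _ finite_permutations[OF assms(1)]]) (auto simp: nat_auts_def)
  show "bij g" if "g \<in> nat_auts V E" for g using that permutes_bij by (auto simp: nat_auts_def)
  show "id \<in> nat_auts V E" by (auto simp: nat_auts_def permutes_def)
  show "g \<circ> k \<in> nat_auts V E" if "g \<in> nat_auts V E" "k \<in> nat_auts V E" for g k
    using that permutes_compose[of k V g] by (fastforce simp: nat_auts_def)
  show "pinv g \<in> nat_auts V E" if "g \<in> nat_auts V E" for g
  proof -
    have g: "g permutes V" "\<forall>(u, v)\<in>E. (g u, g v) \<in> E" using that by (auto simp: nat_auts_def)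
    have "map_prod g g ` E = E"
    proof (rule endo_inj_surj[OF finE])
      show "map_prod g g ` E \<subseteq> E" using g(2) by auto
      have "inj g" using g(1) by (rule permutes_inj)
      then show "inj_on (map_prod g g) E" by (auto simp: inj_on_def dest: injD)
    qed
    have "(pinv g u, pinv g v) \<in> E" if uv: "(u, v) \<in> E" for u v
    proof -
      have "(u, v) \<in> map_prod g g ` E" using uv \<open>map_prod g g ` E = E\<close> by simp
      then obtain x y where "(x, y) \<in> E" "u = g x" "v = g y" by auto
      then show ?thesis using permutes_inverses(2)[OF g(1)] by simp
    qed
    then show ?thesis using permutes_inv[OF g(1)] by (auto simp: nat_auts_def)
  qed
qed

text \<open>Members of \<open>aut_group\<close> are \<open>undefined\<close> off the vertex set,
  members of \<open>nat_auts\<close> are the identity there. \<open>\<Theta>\<close> renames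
  vertices and changes this default value, and \<open>\<Xi>\<close> undoes both.\<close>

lemma aut_group_iso_nat:
  assumes "pair_graph G" and f: "inj_on f (pverts G)"
  shows "aut_group G \<cong> grp_of (nat_auts (f ` pverts G) (map_prod f f ` parcs G))"
proof -
  interpret pair_graph G by fact
  let ?V = "pverts G" and ?E = "parcs G"
  let ?V' = "f ` ?V" and ?E' = "map_prod f f ` ?E"
  let ?k = "the_inv_into ?V f"
  have EV: "?E \<subseteq> ?V \<times> ?V" using in_arcsD1 in_arcsD2 by auto
  have kf [simp]: "?k (f v) = v" if "v \<in> ?V" for v using f that by (rule the_inv_into_f_f)
  interpret P: perm_grp "nat_auts ?V' ?E'"
    by (rule perm_grp_nat_auts) (use EV pair_finite_verts in auto)
  have E'_iff: "(f u, f v) \<in> ?E' \<longleftrightarrow> (u, v) \<in> ?E" if "u \<in> ?V" "v \<in> ?V" for u v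
  proof
    assume "(f u, f v) \<in> ?E'"
    then obtain x y where xy: "(x, y) \<in> ?E" "f u = f x" "f v = f y" by auto
    then have "u = x" "v = y" using f that EV by (auto dest: inj_onD)
    then show "(u, v) \<in> ?E" using xy by simp
  qed auto
  define \<Theta> where "\<Theta> \<pi> n = (if n \<in> ?V' then f (\<pi> (?k n)) else n)" for \<pi> n
  define \<Xi> where "\<Xi> \<sigma> = (\<lambda>v\<in>?V. ?k (\<sigma> (f v)))" for \<sigma>
  have aut: "\<pi> \<in> carrier (aut_group G) \<longleftrightarrow> \<pi> \<in> extensional ?V \<and> bij_betw \<pi> ?V ?V
      \<and> (\<forall>u\<in>?V. \<forall>v\<in>?V. (\<pi> u, \<pi> v) \<in> ?E \<longleftrightarrow> (u, v) \<in> ?E)" for \<pi>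
    by (auto simp: aut_group_def Bij_def)
  have app: "\<pi> v \<in> ?V" if "\<pi> \<in> carrier (aut_group G)" "v \<in> ?V" for \<pi> v
    using that aut by (auto simp: bij_betw_def)
  have Theta: "\<Theta> \<pi> (f v) = f (\<pi> v)" if "v \<in> ?V" for \<pi> v using that by (simp add: \<Theta>_def)
  have "\<Theta> \<in> hom (aut_group G) (grp_of (nat_auts ?V' ?E'))"
  proof (rule homI)
    fix \<pi> assume p: "\<pi> \<in> carrier (aut_group G)"
    have "\<Theta> \<pi> permutes ?V'"
    proof (rule inj_imp_permutes)
      show "inj_on (\<Theta> \<pi>) ?V'"
      proof (rule inj_onI)
        fix m n assume "m \<in> ?V'" "n \<in> ?V'" "\<Theta> \<pi> m = \<Theta> \<pi> n"
        then obtain u v where uv: "u \<in> ?V" "v \<in> ?V" "m = f u" "n = f v" "f (\<pi> u) = f (\<pi> v)" using Theta by auto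
        then have "\<pi> u = \<pi> v" using f app[OF p] by (auto dest: inj_onD)
        then show "m = n" using uv p aut by (auto simp: bij_betw_def dest: inj_onD)
      qed
      show "finite ?V'" using pair_finite_verts by simp
      show "\<Theta> \<pi> n \<in> ?V'" if "n \<in> ?V'" for n using that Theta app[OF p] by auto
    qed (simp add: \<Theta>_def)
    moreover have "(\<Theta> \<pi> m, \<Theta> \<pi> n) \<in> ?E'" if "(m, n) \<in> ?E'" for m n
    proof -
      obtain u v where uv: "(u, v) \<in> ?E" "m = f u" "n = f v" using \<open>(m, n) \<in> ?E'\<close> by auto
      then have V: "u \<in> ?V" "v \<in> ?V" using EV by auto
      then have "(\<pi> u, \<pi> v) \<in> ?E" using p aut uv(1) by blast
      then show ?thesis using uv V Theta by auto
    qed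
    then have "\<forall>e\<in>?E'. case e of (m, n) \<Rightarrow> (\<Theta> \<pi> m, \<Theta> \<pi> n) \<in> ?E'" by blast
    ultimately show "\<Theta> \<pi> \<in> carrier (grp_of (nat_auts ?V' ?E'))" by (simp add: nat_auts_def)
  next
    fix \<pi> \<rho> assume p: "\<pi> \<in> carrier (aut_group G)" "\<rho> \<in> carrier (aut_group G)"
    have "\<pi> \<otimes>\<^bsub>aut_group G\<^esub> \<rho> = compose ?V \<pi> \<rho>"
      using p by (simp add: aut_group_def BijGroup_def)
    moreover have "\<Theta> (compose ?V \<pi> \<rho>) n = (\<Theta> \<pi> \<circ> \<Theta> \<rho>) n" for n
    proof (cases "n \<in> ?V'")
      case True
      then obtain v where v: "v \<in> ?V" "n = f v" by blast
      have "\<Theta> (compose ?V \<pi> \<rho>) (f v) = f (\<pi> (\<rho> v))" using Theta[OF v(1)] v(1) by (simp add: compose_eq)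
      also have "\<dots> = \<Theta> \<pi> (\<Theta> \<rho> (f v))" using Theta[OF v(1)] Theta[OF app[OF p(2) v(1)]] by simp
      finally show ?thesis using v(2) by simp
    qed (simp add: \<Theta>_def)
    then have "\<Theta> (compose ?V \<pi> \<rho>) = \<Theta> \<pi> \<circ> \<Theta> \<rho>" by (rule ext)
    ultimately show "\<Theta> (\<pi> \<otimes>\<^bsub>aut_group G\<^esub> \<rho>) = \<Theta> \<pi> \<otimes>\<^bsub>grp_of (nat_auts ?V' ?E')\<^esub> \<Theta> \<rho>"
      by simp
  qed
  moreover from this have "bij_betw \<Theta> (carrier (aut_group G)) (carrier (grp_of (nat_auts ?V' ?E')))"
  proof (intro bij_betw_byWitness[where f' = \<Xi>])
    assume hom: "\<Theta> \<in> hom (aut_group G) (grp_of (nat_auts ?V' ?E'))"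
    then show "\<Theta> ` carrier (aut_group G) \<subseteq> carrier (grp_of (nat_auts ?V' ?E'))" by (auto simp: hom_def)
    show "\<forall>\<pi>\<in>carrier (aut_group G). \<Xi> (\<Theta> \<pi>) = \<pi>"
    proof
      fix \<pi> assume p: "\<pi> \<in> carrier (aut_group G)"
      have "\<Xi> (\<Theta> \<pi>) = restrict \<pi> ?V"
        unfolding \<Xi>_def using Theta app[OF p] by (intro restrict_ext) simp
      also have "\<dots> = \<pi>" using p aut by (simp add: extensional_restrict)
      finally show "\<Xi> (\<Theta> \<pi>) = \<pi>" .
    qed
    have in_V': "\<sigma> (f v) \<in> ?V'" if "\<sigma> \<in> nat_auts ?V' ?E'" "v \<in> ?V" for \<sigma> v
      using that permutes_in_image[of \<sigma> ?V' "f v"] by (auto simp: nat_auts_def)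
    have fk: "f (?k n) = n" "?k n \<in> ?V" if "n \<in> ?V'" for n using that by auto
    have fXi: "f (\<Xi> \<sigma> v) = \<sigma> (f v)" "\<Xi> \<sigma> v \<in> ?V" if "\<sigma> \<in> nat_auts ?V' ?E'" "v \<in> ?V" for \<sigma> v
      using fk[OF in_V'[OF that]] that by (simp_all add: \<Xi>_def)
    show "\<forall>\<sigma>\<in>carrier (grp_of (nat_auts ?V' ?E')). \<Theta> (\<Xi> \<sigma>) = \<sigma>"
    proof (intro ballI ext)
      fix \<sigma> n assume s: "\<sigma> \<in> carrier (grp_of (nat_auts ?V' ?E'))"
      show "\<Theta> (\<Xi> \<sigma>) n = \<sigma> n"
      proof (cases "n \<in> ?V'")
        case True
        then show ?thesis using Theta fXi(1) s by auto
      next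
        case False
        moreover have "\<sigma> permutes ?V'" using s by (simp add: nat_auts_def)
        ultimately show ?thesis unfolding \<Theta>_def by (simp add: permutes_not_in)
      qed
    qed
    show "\<Xi> ` carrier (grp_of (nat_auts ?V' ?E')) \<subseteq> carrier (aut_group G)"
    proof
      fix \<pi> assume "\<pi> \<in> \<Xi> ` carrier (grp_of (nat_auts ?V' ?E'))"
      then obtain \<sigma> where s: "\<sigma> \<in> nat_auts ?V' ?E'" "\<pi> = \<Xi> \<sigma>" by auto
      have inj: "inj_on (\<Xi> \<sigma>) ?V"
      proof (rule inj_onI)
        fix u v assume uv: "u \<in> ?V" "v \<in> ?V" "\<Xi> \<sigma> u = \<Xi> \<sigma> v"
        then have "\<sigma> (f u) = \<sigma> (f v)" using fXi(1)[OF s(1)] by metis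
        then have "f u = f v" using s(1) by simp
        then show "u = v" using f uv by (auto dest: inj_onD)
      qed
      have "\<Xi> \<sigma> ` ?V = ?V"
        by (rule endo_inj_surj[OF pair_finite_verts _ inj]) (use fXi(2)[OF s(1)] in auto)
      then have "bij_betw (\<Xi> \<sigma>) ?V ?V" using inj by (simp add: bij_betw_def)
      moreover have "\<Xi> \<sigma> \<in> extensional ?V" by (simp add: \<Xi>_def)
      moreover have "(\<Xi> \<sigma> u, \<Xi> \<sigma> v) \<in> ?E \<longleftrightarrow> (u, v) \<in> ?E" if uv: "u \<in> ?V" "v \<in> ?V" for u v
      proof -
        have "(\<Xi> \<sigma> u, \<Xi> \<sigma> v) \<in> ?E \<longleftrightarrow> (\<sigma> (f u), \<sigma> (f v)) \<in> ?E'"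
          using E'_iff[OF fXi(2)[OF s(1) uv(1)] fXi(2)[OF s(1) uv(2)]] fXi(1)[OF s(1)] uv by simp
        also have "\<dots> \<longleftrightarrow> (f u, f v) \<in> ?E'"
          using nat_auts_edge[OF s(1)] nat_auts_edge[OF P.inv_mem[OF s(1)], of "\<sigma> (f u)" "\<sigma> (f v)"] P.inv_app[OF s(1)] by metis
        also have "\<dots> \<longleftrightarrow> (u, v) \<in> ?E" by (rule E'_iff[OF uv])
        finally show ?thesis .
      qed
      ultimately show "\<pi> \<in> carrier (aut_group G)" using s(2) aut by blast
    qed
  qed
  ultimately show ?thesis by (intro is_isoI isoI)
qed

theorem theorem6p4:
  fixes a :: real and h :: nat and G :: "'a pair_pre_digraph"
  assumes "kostochka_constant a"
    and "h \<ge> 1"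
    and "pair_graph G"
    and "\<not> is_minor (complete_graph (h + 1)) G"
    and "\<forall>p \<in> prime_factors (order (aut_group G)). int p > max (alpha a h) 2"
  shows "built_from_abelian (aut_group G)"
proof -
  interpret pair_graph G by fact
  let ?r = "a * real h * sqrt (ln (real h))"
  obtain f :: "'a \<Rightarrow> nat" where f: "inj_on f (pverts G)"
    using finite_imp_inj_to_nat_seg[OF pair_finite_verts] by auto
  define V where "V = f ` pverts G"
  define E where "E = map_prod f f ` parcs G"
  have EV: "parcs G \<subseteq> pverts G \<times> pverts G" using in_arcsD1 in_arcsD2 by auto
  have symG: "sym (parcs G)" using pair_sym_arcs by (simp add: symmetric_def)
  have minor: "minor_of V E (pverts G) (parcs G)"
    unfolding V_def E_def by (rule minor_of_bij[OF f EV])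
  have iso: "aut_group G \<cong> grp_of (nat_auts V E)"
    unfolding V_def E_def by (rule aut_group_iso_nat[OF assms(3) f])
  have finV: "finite V" using pair_finite_verts by (simp add: V_def)
  have E_sub: "E \<subseteq> V \<times> V" using EV by (auto simp: V_def E_def)
  interpret P: perm_grp "nat_auts V E" by (rule perm_grp_nat_auts[OF finV E_sub])
  have card: "card (nat_auts V E) = order (aut_group G)"
    using iso_same_card[OF iso] by (simp add: order_def)
  have "closed_action (nat_auts V E) ?r h V E"
  proof
    show "finite V" by (rule finV)
    show "E \<subseteq> V \<times> V" by (rule E_sub)
    show "sym E" using symG by (auto simp: E_def sym_def)
    show "irrefl E"
      unfolding irrefl_def
    proof (intro allI notI)
      fix n assume "(n, n) \<in> E"
      then obtain u v where uv: "(u, v) \<in> parcs G" "f u = f v" by (auto simp: E_def)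
      then have "u = v" using f EV by (auto dest: inj_onD)
      then show False using pair_no_loops[OF uv(1)] by simp
    qed
    show "sparse ?r h V E"
      using sparse_minor[OF sparse_if_kostochka[OF assms(1,2) symG assms(4)] minor] .
    have "1 \<le> a" using assms(1) by (simp add: kostochka_constant_def)
    moreover have "0 \<le> ln (real h)" using assms(2) by simp
    ultimately show "0 \<le> ?r" by simp
    show "(g u, g v) \<in> E" if "g \<in> nat_auts V E" "(u, v) \<in> E" for g u v
      using that by (rule nat_auts_edge)
    show "g v \<in> V" if "g \<in> nat_auts V E" "v \<in> V" for g v
      using that permutes_in_image by (fastforce simp: nat_auts_def)
    show "?r < real d \<and> h < d \<and> 2 < d" if "d dvd card (nat_auts V E)" "d \<noteq> 1" for d
      using large_divisors[OF assms(1,2) P.card_pos _ that] assms(5) unfolding card by blast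
    show "g permutes V" if "g \<in> nat_auts V E" for g using that by (simp add: nat_auts_def)
    \<comment> \<open>Being an automorphism is a condition on single edges, so agreeing on each edge
      with some automorphism is enough.\<close>
    show "\<pi> \<in> nat_auts V E" if perm: "\<pi> permutes V"
      and edges: "\<And>u v. (u, v) \<in> E \<Longrightarrow> \<exists>g\<in>nat_auts V E. g u = \<pi> u \<and> g v = \<pi> v" for \<pi>
    proof -
      have "(\<pi> u, \<pi> v) \<in> E" if uv: "(u, v) \<in> E" for u v
      proof -
        obtain g where "g \<in> nat_auts V E" "g u = \<pi> u" "g v = \<pi> v" using edges[OF uv] by blast
        moreover from this have "(g u, g v) \<in> E" using nat_auts_edge uv by blast
        ultimately show ?thesis by simp
      qed
      then show ?thesis using perm by (auto simp: nat_auts_def)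
    qed
  qed
  then have "built_from_abelian (grp_of (nat_auts V E))" by (rule closed_action_built_from_abelian)
  then show ?thesis using iso built_from_abelian_iso by blast
qed

end
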